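(* Let $\mathcal{G}$ be any fixed finite group with $|\mathcal{G}|\geq 2$. For any constant $c>0$, there is a deterministic polynomial-time algorithm which, given as input a generating set of a subgroup $\mathcal{H}$ of $\mathcal{G}^n$ with $\delta(\mathcal{H})\leq n/2$ and a number $r\leq c\log n$, outputs $x\in\mathcal{G}^n$ with $x\notin B(\mathcal{H},r)$. In the paper's terminology: the Remote Point Problem over $\mathcal{G}$ has a polynomial time $(n/2,c\log n)$-algorithm.
   Context: For $x,y\in\mathcal{G}^n$, $\Delta(x,y)=|\{i: x_i\neq y_i\}|$ and $\Delta(x,S)=\min_{y\in S}\Delta(x,y)$. $wt(x)$ is the number of coordinates $i$ with $x_i\neq 1$; $B(r)=\{x\in\mathcal{G}^n: wt(x)\leq r\}$ and $B(S,r)=\{sx: s\in S, x\in B(r)\}$, so $x\in B(S,r)$ iff $\Delta(x,S)\leq r$. For a subgroup $\mathcal{H}\leq\mathcal{G}^n$, $\delta(\mathcal{H})=\log_{|\mathcal{G}|}|\mathcal{H}|$. The Remote Point Problem over $\mathcal{G}$: given a subgroup $\mathcal{H}$ of $\mathcal{G}^n$ by generators and $r\in\mathbb{N}$, output $x\in\mathcal{G}^n$ with $x\notin B(\mathcal{H},r)$. A $(k(n),r(n))$-algorithm solves it on all inputs with $\delta(\mathcal{H})\leq k(n)$ and $r\leq r(n)$.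
   Formalization: Correctness of the output is claimed only for all sufficiently large n (depending on the group and c), since for small n the bound c log n can reach n, so that B(H,r) is all of G^n and no remote point exists (e.g. n = 2, c = 10, r = 2). *)

theory Defs
  imports
    Complex_Main
    "HOL-Computational_Algebra.Polynomial"
    "HOL-Algebra.Generated_Groups"
    "HOL-Algebra.Product_Groups"
begin

section \<open>Model of computation\<close>

text \<open>
  Algorithms are programs of the WHILE language on binary trees of N. D. Jones
  (Computability and Complexity from a Programming Perspective, MIT Press, 1997).
  The atomic operations (variable, constant, pairing, the two projections, test for
  being a leaf) have unit cost; in particular there is no unit-cost arithmetic and no
  unit-cost comparison of trees. With trees stored as shared pointer structures such a
  program is simulated by a deterministic Turing machine with polynomial overhead, and
  conversely, so polynomial time here is the usual polynomial time.
\<close>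

datatype tree = Leaf | Pair tree tree

fun left :: "tree \<Rightarrow> tree" where
  "left Leaf = Leaf"
| "left (Pair a b) = a"

fun right :: "tree \<Rightarrow> tree" where
  "right Leaf = Leaf"
| "right (Pair a b) = b"

type_synonym store = "nat \<Rightarrow> tree"

datatype expr = Var nat | Const tree | MkPair expr expr | Left expr | Right expr

fun eval_expr :: "expr \<Rightarrow> store \<Rightarrow> tree" where
  "eval_expr (Var v) s = s v"
| "eval_expr (Const d) s = d"
| "eval_expr (MkPair e1 e2) s = Pair (eval_expr e1 s) (eval_expr e2 s)"
| "eval_expr (Left e) s = left (eval_expr e s)"
| "eval_expr (Right e) s = right (eval_expr e s)"

fun expr_cost :: "expr \<Rightarrow> nat" where
  "expr_cost (Var v) = 1"
| "expr_cost (Const d) = 1"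
| "expr_cost (MkPair e1 e2) = 1 + expr_cost e1 + expr_cost e2"
| "expr_cost (Left e) = 1 + expr_cost e"
| "expr_cost (Right e) = 1 + expr_cost e"

datatype prog =
    Skip
  | Assign nat expr
  | Seq prog prog
  | Cond expr prog prog
  | While expr prog

text \<open>
  \<open>exec P s t s'\<close>: started in store \<open>s\<close>, the program \<open>P\<close> halts after time \<open>t\<close> in
  store \<open>s'\<close>. A test succeeds iff its value is not \<open>Leaf\<close>.
\<close>

inductive exec :: "prog \<Rightarrow> store \<Rightarrow> nat \<Rightarrow> store \<Rightarrow> bool" where
  Skip: "exec Skip s 1 s"
| Assign: "exec (Assign v e) s (1 + expr_cost e) (s(v := eval_expr e s))"
| Seq: "exec P s t s' \<Longrightarrow> exec Q s' t' s'' \<Longrightarrow> exec (Seq P Q) s (t + t') s''"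
| CondTrue: "eval_expr e s \<noteq> Leaf \<Longrightarrow> exec P s t s' \<Longrightarrow>
    exec (Cond e P Q) s (1 + expr_cost e + t) s'"
| CondFalse: "eval_expr e s = Leaf \<Longrightarrow> exec Q s t s' \<Longrightarrow>
    exec (Cond e P Q) s (1 + expr_cost e + t) s'"
| WhileFalse: "eval_expr e s = Leaf \<Longrightarrow> exec (While e P) s (1 + expr_cost e) s"
| WhileTrue: "eval_expr e s \<noteq> Leaf \<Longrightarrow> exec P s t s' \<Longrightarrow> exec (While e P) s' t' s'' \<Longrightarrow>
    exec (While e P) s (1 + expr_cost e + t + t') s''"

inductive_cases exec_SkipE: "exec Skip s t s'"
inductive_cases exec_AssignE: "exec (Assign v e) s t s'"
inductive_cases exec_SeqE: "exec (Seq P Q) s t s'"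
inductive_cases exec_CondE: "exec (Cond e P Q) s t s'"
inductive_cases exec_WhileE: "exec (While e P) s t s'"

lemma exec_deterministic:
  "exec P s t s' \<Longrightarrow> exec P s u s'' \<Longrightarrow> u = t \<and> s'' = s'"
proof (induction arbitrary: u s'' rule: exec.induct)
  case (Skip s)
  then show ?case by (auto elim: exec_SkipE)
next
  case (Assign v e s)
  then show ?case by (auto elim: exec_AssignE)
next
  case (Seq P s t s' Q t' s2)
  from Seq.prems show ?case by (rule exec_SeqE) (auto dest!: Seq.IH)
next
  case (CondTrue e s P t s' Q)
  from CondTrue.prems show ?case
    by (rule exec_CondE) (auto dest!: CondTrue.IH simp: CondTrue.hyps)
next
  case (CondFalse e s Q t s' P)
  from CondFalse.prems show ?case
    by (rule exec_CondE) (auto dest!: CondFalse.IH simp: CondFalse.hyps)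
next
  case (WhileFalse e s P)
  from WhileFalse.prems show ?case
    by (rule exec_WhileE) (auto simp: WhileFalse.hyps)
next
  case (WhileTrue e s P t s' t' s2)
  from WhileTrue.prems show ?case
    by (rule exec_WhileE) (auto dest!: WhileTrue.IH simp: WhileTrue.hyps)
qed

definition input_store :: "tree \<Rightarrow> store" where
  "input_store d = (\<lambda>_. Leaf)(0 := d)"

definition computes_in_time :: "prog \<Rightarrow> tree \<Rightarrow> nat \<Rightarrow> tree \<Rightarrow> bool" where
  "computes_in_time P d t d' \<longleftrightarrow> (\<exists>s. exec P (input_store d) t s \<and> s 0 = d')"

text \<open>The size of a tree is the number of its \<open>Pair\<close> nodes.\<close>

definition polynomial_time_on :: "prog \<Rightarrow> tree set \<Rightarrow> bool" where
  "polynomial_time_on P D \<longleftrightarrow>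
    (\<exists>p :: nat poly. \<forall>d\<in>D. \<exists>t d'. computes_in_time P d t d' \<and> t \<le> poly p (size d))"


section \<open>Powers of a group and Hamming balls\<close>

definition power_group :: "('a, 'b) monoid_scheme \<Rightarrow> nat \<Rightarrow> (nat \<Rightarrow> 'a) monoid" where
  "power_group G n = product_group {..<n} (\<lambda>_. G)"

definition weight :: "('a, 'b) monoid_scheme \<Rightarrow> nat \<Rightarrow> (nat \<Rightarrow> 'a) \<Rightarrow> nat" where
  "weight G n x = card {i \<in> {..<n}. x i \<noteq> \<one>\<^bsub>G\<^esub>}"

definition hamming_ball :: "('a, 'b) monoid_scheme \<Rightarrow> nat \<Rightarrow> nat \<Rightarrow> (nat \<Rightarrow> 'a) set" where
  "hamming_ball G n r = {x \<in> carrier (power_group G n). weight G n x \<le> r}"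

definition ball_around ::
  "('a, 'b) monoid_scheme \<Rightarrow> nat \<Rightarrow> (nat \<Rightarrow> 'a) set \<Rightarrow> nat \<Rightarrow> (nat \<Rightarrow> 'a) set" where
  "ball_around G n S r = S <#>\<^bsub>power_group G n\<^esub> hamming_ball G n r"

definition group_dim :: "('a, 'b) monoid_scheme \<Rightarrow> (nat \<Rightarrow> 'a) set \<Rightarrow> real" where
  "group_dim G H = log (real (order G)) (real (card H))"


section \<open>The Remote Point Problem\<close>

fun encode_list :: "tree list \<Rightarrow> tree" where
  "encode_list [] = Leaf"
| "encode_list (d # ds) = Pair d (encode_list ds)"

definition encode_unary :: "nat \<Rightarrow> tree" where
  "encode_unary n = encode_list (replicate n Leaf)"

text \<open>Binary representation, least significant bit first.\<close>

fun encode_binary :: "nat \<Rightarrow> tree" where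
  "encode_binary r = (if r = 0 then Leaf
     else Pair (encode_unary (r mod 2)) (encode_binary (r div 2)))"

declare encode_binary.simps [simp del]

text \<open>
  The group is fixed, so its elements are symbols of a finite alphabet, given by a
  numbering \<open>e\<close> of the group.
\<close>

definition encode_vector :: "('a \<Rightarrow> nat) \<Rightarrow> nat \<Rightarrow> (nat \<Rightarrow> 'a) \<Rightarrow> tree" where
  "encode_vector e n x = encode_list (map (\<lambda>i. encode_unary (e (x i))) [0..<n])"

text \<open>
  The length \<open>n\<close> is part of the instance since the list of generators may be empty.
  It is written in unary, so that \<open>n\<close> is at most the size of the instance.
\<close>

definition encode_instance ::
  "('a \<Rightarrow> nat) \<Rightarrow> nat \<Rightarrow> (nat \<Rightarrow> 'a) list \<Rightarrow> nat \<Rightarrow> tree" where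
  "encode_instance e n gens r =
     Pair (encode_unary n) (Pair (encode_binary r) (encode_list (map (encode_vector e n) gens)))"

definition RPP_instances :: "('a, 'b) monoid_scheme \<Rightarrow> ('a \<Rightarrow> nat) \<Rightarrow> tree set" where
  "RPP_instances G e =
     {encode_instance e n gens r | n gens r. set gens \<subseteq> carrier (power_group G n)}"

text \<open>
  \<open>RPP_algorithm G e k \<rho> P\<close>: the program \<open>P\<close> is a \<open>(k(n), \<rho>(n))\<close>-algorithm for the Remote
  Point Problem over \<open>G\<close>. The bounds are asymptotic in \<open>n\<close>, so correctness is required for
  all sufficiently large \<open>n\<close>: for small \<open>n\<close> a bound such as \<open>c log n\<close> may exceed \<open>n\<close>, in
  which case the ball is the whole group and no remote point exists.
\<close>

definition RPP_algorithm ::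
  "('a, 'b) monoid_scheme \<Rightarrow> ('a \<Rightarrow> nat) \<Rightarrow> (nat \<Rightarrow> real) \<Rightarrow> (nat \<Rightarrow> real) \<Rightarrow> prog \<Rightarrow> bool" where
  "RPP_algorithm G e k \<rho> P \<longleftrightarrow>
    (\<forall>\<^sub>F n in sequentially. \<forall>H gens r.
       subgroup H (power_group G n) \<and>
       set gens \<subseteq> carrier (power_group G n) \<and>
       generate (power_group G n) (set gens) = H \<and>
       group_dim G H \<le> k n \<and> real r \<le> \<rho> n \<longrightarrow>
       (\<exists>x t. x \<in> carrier (power_group G n) \<and> x \<notin> ball_around G n H r \<and>
          computes_in_time P (encode_instance e n gens r) t (encode_vector e n x)))"

end

theory Submission
  imports Defs "HOL-Real_Asymp.Real_Asymp"
begin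

text \<open>
  Split the coordinates into \<open>k = O(log n)\<close> residue classes, with \<open>k\<close> a large multiple of the radius
  bound. A point at distance at most \<open>c log n\<close> from \<open>H\<close> lies in \<open>H\<cdot>G\<^sup>U\<close> where \<open>U\<close>, the union of the
  classes containing an error, has at most \<open>n/8 + o(n)\<close> coordinates. So it suffices to avoid the polynomially many
  subgroups \<open>H\<cdot>G\<^sup>U\<close>, for all unions \<open>U\<close> of classes; the radius itself is not needed.

  A Schreier--Sims table decides for each of these subgroups which values of the next coordinate keep the
  chosen prefix extendable to an element. The point is chosen coordinate by coordinate from a
  list of the subgroups that are still alive. A subgroup that is killed by some value is killed by at least half of
  them and is listed twice if it survives; choosing the value with the shortest new list keeps
  the length at most \<open>2\<^sup>k\<close>. A subgroup with small \<open>U\<close> can be killed at a linear number of coordinates, so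
  it would end with more than \<open>2\<^sup>k\<close> copies if the point belonged to it.

  The programs are obtained from closure properties of the functions computable in polynomial time, all
  loops being folds over lists with states of polynomial size.
\<close>

section \<open>Running programs\<close>

text \<open>The greedy choice is a method of conditional expectations. For a uniformly random value
  at coordinate \<open>i\<close>, a living subgroup survives with probability
  \<open>card (level T i) / order G\<close>, which is 1 or at most 1/2. Giving weight 2 to the
  survivor of a risky coordinate keeps the expected total weight from growing. Storing weights as
  repeated list entries replaces arithmetic, which the machine does not offer at unit cost, by a
  comparison of list lengths.

  \<open>G\<close> need not be abelian, so there is no rank of a matrix to count with. The
  substitute is the number of coordinates where \<open>level\<close> is all of \<open>G\<close>. At
  most \<open>n/2\<close> of them lie outside \<open>U\<close>: the values at such coordinates can
  be prescribed independently, while outside \<open>U\<close> every vector of the enlarged subgroup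
  agrees with one of \<open>H\<close>. Each remaining coordinate doubles the copies of a surviving
  subgroup, so there are more than \<open>k\<close> doublings as soon as
  \<open>2 * k + 2 * r * (n div k + 1) < n\<close>. This inequality dictates the number
  \<open>k\<close> of classes.\<close>

text \<open>Variables 1 to m are scratch space: empty at the start and empty again at the end. All other
  variables are untouched, so that programs can be composed without renaming.\<close>

definition runs :: "prog \<Rightarrow> nat \<Rightarrow> tree \<Rightarrow> nat \<Rightarrow> tree \<Rightarrow> bool" where
  "runs P m a T b \<longleftrightarrow> (\<forall>s. s 0 = a \<and> (\<forall>v. 0 < v \<and> v \<le> m \<longrightarrow> s v = Leaf) \<longrightarrow>
     (\<exists>t\<le>T. exec P s t (s(0 := b))))"

lemma runsI:
  assumes "\<And>s. s 0 = a \<Longrightarrow> (\<And>v. 0 < v \<Longrightarrow> v \<le> m \<Longrightarrow> s v = Leaf) \<Longrightarrow>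
    \<exists>t\<le>T. exec P s t (s(0 := b))"
  shows "runs P m a T b"
  unfolding runs_def using assms by simp

lemma runsE:
  assumes "runs P m a T b" "s 0 = a" "\<And>v. 0 < v \<Longrightarrow> v \<le> m \<Longrightarrow> s v = Leaf"
  obtains t where "t \<le> T" "exec P s t (s(0 := b))"
  using assms(1)[unfolded runs_def, rule_format, of s] assms(2,3) that by auto

lemma runs_mono: "runs P m a T b \<Longrightarrow> m \<le> m' \<Longrightarrow> T \<le> T' \<Longrightarrow> runs P m' a T' b"
  unfolding runs_def by (metis order.trans)

lemma runs_Assign:
  assumes "\<And>s. s 0 = a \<Longrightarrow> eval_expr ex s = b"
  shows "runs (Assign 0 ex) m a (1 + expr_cost ex) b"
proof (rule runsI)
  fix s :: store assume "s 0 = a"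
  then show "\<exists>t\<le>1 + expr_cost ex. exec (Assign 0 ex) s t (s(0 := b))"
    using exec.Assign[of 0 ex s] assms[of s] by auto
qed

lemma runs_Seq:
  assumes "runs P m a T b" "runs Q m b T' c"
  shows "runs (Seq P Q) m a (T + T') c"
proof (rule runsI)
  fix s :: store assume s: "s 0 = a" "\<And>v. 0 < v \<Longrightarrow> v \<le> m \<Longrightarrow> s v = Leaf"
  obtain t where t: "t \<le> T" "exec P s t (s(0 := b))"
    by (rule runsE[OF assms(1), of s]) (use s in auto)
  obtain t' where t': "t' \<le> T'" "exec Q (s(0 := b)) t' (s(0 := b, 0 := c))"
    by (rule runsE[OF assms(2), of "s(0 := b)"]) (use s in auto)
  show "\<exists>t\<le>T + T'. exec (Seq P Q) s t (s(0 := c))"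
    using exec.Seq[OF t(2) t'(2)] t(1) t'(1) by (intro exI[of _ "t + t'"]) simp
qed

text \<open>Both programs read variable 0, so \<open>m + 1\<close> keeps the input while
  \<open>P\<close> runs and \<open>m + 2\<close> keeps the result of \<open>P\<close> while
  \<open>Q\<close> runs. They lie above the scratch space of \<open>P\<close> and \<open>Q\<close>
  and are cleared again.\<close>

definition pair_prog :: "nat \<Rightarrow> prog \<Rightarrow> prog \<Rightarrow> prog" where
  "pair_prog m P Q =
     Seq (Assign (m + 1) (Var 0)) (Seq P (Seq (Assign (m + 2) (Var 0))
       (Seq (Assign 0 (Var (m + 1))) (Seq (Assign (m + 1) (Const Leaf)) (Seq Q
         (Seq (Assign 0 (MkPair (Var (m + 2)) (Var 0))) (Assign (m + 2) (Const Leaf))))))))"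

lemma exec_Assign_eq: "t = 1 + expr_cost ex \<Longrightarrow> s' = s(v := eval_expr ex s) \<Longrightarrow> exec (Assign v ex) s t s'"
  by (simp only: exec.Assign)

lemma runs_pair_prog:
  assumes P: "runs P m a T b" and Q: "runs Q m a T' c"
  shows "runs (pair_prog m P Q) (m + 2) a (T + T' + 14) (Pair b c)"
proof (rule runsI)
  fix s :: store assume s: "s 0 = a" "\<And>v. 0 < v \<Longrightarrow> v \<le> m + 2 \<Longrightarrow> s v = Leaf"
  obtain t where t: "t \<le> T" "exec P (s(m + 1 := a)) t (s(m + 1 := a, 0 := b))"
    by (rule runsE[OF P, of "s(m + 1 := a)"]) (use s in auto)
  obtain t' where t': "t' \<le> T'" "exec Q (s(m + 2 := b)) t' (s(m + 2 := b, 0 := c))"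
    by (rule runsE[OF Q, of "s(m + 2 := b)"]) (use s in auto)
  \<comment> \<open>Copying a variable or a constant costs 2 and the final pairing 4, which adds up
    to the overhead of 14.\<close>
  have "exec (pair_prog m P Q) s (2 + (t + (2 + (2 + (2 + (t' + (4 + 2))))))) (s(0 := Pair b c))"
    unfolding pair_prog_def
    apply (rule exec.Seq[where s' = "s(m + 1 := a)"])
     apply (rule exec_Assign_eq; simp add: s)
    apply (rule exec.Seq[OF t(2)])
    apply (rule exec.Seq[where s' = "s(m + 1 := a, 0 := b, m + 2 := b)"])
     apply (rule exec_Assign_eq; simp)
    apply (rule exec.Seq[where s' = "s(m + 1 := a, m + 2 := b)"])
     apply (rule exec_Assign_eq; simp add: s fun_eq_iff)
    apply (rule exec.Seq[where s' = "s(m + 2 := b)"])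
     apply (rule exec_Assign_eq; simp add: s fun_eq_iff)
    apply (rule exec.Seq[OF t'(2)])
    apply (rule exec.Seq[where s' = "s(m + 2 := b, 0 := Pair b c)"])
     apply (rule exec_Assign_eq; simp add: s fun_eq_iff)
    apply (rule exec_Assign_eq; simp add: s fun_eq_iff)
    done
  then show "\<exists>t\<le>T + T' + 14. exec (pair_prog m P Q) s t (s(0 := Pair b c))"
    using t(1) t'(1) by (intro exI conjI) auto
qed

text \<open>The input is a pair of the tested tree and the argument of the branches.\<close>

definition if_prog :: "nat \<Rightarrow> prog \<Rightarrow> prog \<Rightarrow> prog" where
  "if_prog m P Q =
     Cond (Left (Var 0)) (Seq (Assign 0 (Right (Var 0))) P) (Seq (Assign 0 (Right (Var 0))) Q)"

lemma runs_if_prog: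
  assumes "c \<noteq> Leaf \<Longrightarrow> runs P m a T b" "c = Leaf \<Longrightarrow> runs Q m a T b"
  shows "runs (if_prog m P Q) m (Pair c a) (T + 6) b"
proof (rule runsI)
  fix s :: store assume s: "s 0 = Pair c a" "\<And>v. 0 < v \<Longrightarrow> v \<le> m \<Longrightarrow> s v = Leaf"
  have proj: "exec (Assign 0 (Right (Var 0))) s 3 (s(0 := a))"
    by (rule exec_Assign_eq) (simp_all add: s)
  show "\<exists>t\<le>T + 6. exec (if_prog m P Q) s t (s(0 := b))"
  proof (cases "c = Leaf")
    case True
    obtain t where t: "t \<le> T" "exec Q (s(0 := a)) t (s(0 := a, 0 := b))"
      by (rule runsE[OF assms(2)[OF True], of "s(0 := a)"]) (use s in auto)
    have "exec (if_prog m P Q) s (1 + expr_cost (Left (Var 0)) + (3 + t)) (s(0 := b))"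
      unfolding if_prog_def
      by (rule exec.CondFalse) (use s True exec.Seq[OF proj t(2)] in auto)
    then show ?thesis using t(1) by (intro exI conjI) auto
  next
    case False
    obtain t where t: "t \<le> T" "exec P (s(0 := a)) t (s(0 := a, 0 := b))"
      by (rule runsE[OF assms(1)[OF False], of "s(0 := a)"]) (use s in auto)
    have "exec (if_prog m P Q) s (1 + expr_cost (Left (Var 0)) + (3 + t)) (s(0 := b))"
      unfolding if_prog_def
      by (rule exec.CondTrue) (use s False exec.Seq[OF proj t(2)] in auto)
    then show ?thesis using t(1) by (intro exI conjI) auto
  qed
qed

definition code_list :: "('a \<Rightarrow> tree) \<Rightarrow> 'a list \<Rightarrow> tree" where
  "code_list X xs = encode_list (map X xs)"

lemma code_list_simps [simp]:
  "code_list X [] = Leaf" "code_list X (x # xs) = Pair (X x) (code_list X xs)"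
  by (simp_all add: code_list_def)

text \<open>The list still to be processed is its own loop condition, as \<open>code_list\<close>
  maps exactly the empty list to \<open>Leaf\<close>. The environment stays in \<open>m + 1\<close>,
  the state in variable 0.\<close>

definition while_prog :: "nat \<Rightarrow> prog \<Rightarrow> prog" where
  "while_prog m P = While (Var (m + 2))
     (Seq (Assign 0 (MkPair (Var (m + 1)) (MkPair (Left (Var (m + 2))) (Var 0))))
       (Seq (Assign (m + 2) (Right (Var (m + 2)))) P))"

text \<open>The input is the environment, the list and the initial state; each step gets the environment, one
  element and the current state.\<close>

definition fold_prog :: "nat \<Rightarrow> prog \<Rightarrow> prog" where
  "fold_prog m P =
     Seq (Assign (m + 1) (Left (Var 0))) (Seq (Assign (m + 2) (Left (Right (Var 0))))
       (Seq (Assign 0 (Right (Right (Var 0)))) (Seq (while_prog m P)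
         (Assign (m + 1) (Const Leaf)))))"

text \<open>The body is trusted only on states that a prefix of the list really produces, so facts
  about reached states are available when a body is verified. Per element, the test and the two
  assignments cost 2 + 7 + 3 = 12; the last test costs 2.\<close>

lemma exec_while_prog:
  assumes "\<And>ys x zs. xs = ys @ x # zs \<Longrightarrow>
      runs P m (Pair w (Pair (X x) (Z (fold h ys a)))) T (Z (h x (fold h ys a)))"
    and "s 0 = Z a" "s (m + 1) = w" "s (m + 2) = code_list X xs"
    and "\<And>v. 0 < v \<Longrightarrow> v \<le> m \<Longrightarrow> s v = Leaf"
  shows "\<exists>t\<le>length xs * (T + 12) + 2. exec (while_prog m P) s t (s(0 := Z (fold h xs a), m + 2 := Leaf))"
  using assms
proof (induction xs arbitrary: a s)
  case Nil
  have "exec (while_prog m P) s (1 + expr_cost (Var (m + 2))) s"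
    unfolding while_prog_def by (rule exec.WhileFalse) (use Nil.prems(2-) in simp)
  moreover have "s(0 := Z (fold h [] a), m + 2 := Leaf) = s"
    using Nil.prems(2-) by (auto simp: fun_eq_iff)
  moreover have "1 + expr_cost (Var (m + 2)) \<le> length [] * (T + 12) + 2" by simp
  ultimately show ?case by metis
next
  case (Cons x xs)
  let ?s1 = "s(0 := Pair w (Pair (X x) (Z a)))"
  let ?s2 = "?s1(m + 2 := code_list X xs)"
  let ?s3 = "?s2(0 := Z (h x a))"
  obtain t where t: "t \<le> T" "exec P ?s2 t ?s3"
    by (rule runsE[OF Cons.prems(1)[of "[]" x xs], of ?s2]) (use Cons.prems(2-) in auto)
  have "\<exists>t\<le>length xs * (T + 12) + 2. exec (while_prog m P) ?s3 t
      (?s3(0 := Z (fold h xs (h x a)), m + 2 := Leaf))"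
  proof (rule Cons.IH)
    show "runs P m (Pair w (Pair (X x') (Z (fold h ys (h x a))))) T (Z (h x' (fold h ys (h x a))))"
      if "xs = ys @ x' # zs" for ys x' zs
      using Cons.prems(1)[of "x # ys" x' zs] that by simp
  qed (use Cons.prems(2-) in auto)
  then obtain t' where t': "t' \<le> length xs * (T + 12) + 2"
    "exec (while_prog m P) ?s3 t' (?s3(0 := Z (fold h xs (h x a)), m + 2 := Leaf))"
    by blast
  have body: "exec (Seq (Assign 0 (MkPair (Var (m + 1)) (MkPair (Left (Var (m + 2))) (Var 0))))
      (Seq (Assign (m + 2) (Right (Var (m + 2)))) P)) s (7 + (3 + t)) ?s3"
    apply (rule exec.Seq[where s' = ?s1])
     apply (rule exec_Assign_eq; use Cons.prems(2-) in simp)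
    apply (rule exec.Seq[OF _ t(2)])
    apply (rule exec_Assign_eq; use Cons.prems(2-) in simp)
    done
  have "exec (while_prog m P) s (1 + expr_cost (Var (m + 2)) + (7 + (3 + t)) + t')
      (?s3(0 := Z (fold h xs (h x a)), m + 2 := Leaf))"
    unfolding while_prog_def
    by (rule exec.WhileTrue[OF _ body t'(2)[unfolded while_prog_def]]) (use Cons.prems(2-) in simp)
  moreover have "?s3(0 := Z (fold h xs (h x a)), m + 2 := Leaf) = s(0 := Z (fold h (x # xs) a), m + 2 := Leaf)"
    by (auto simp: fun_eq_iff)
  moreover have "1 + expr_cost (Var (m + 2)) + (7 + (3 + t)) + t' \<le> length (x # xs) * (T + 12) + 2"
    using t(1) t'(1) by simp
  ultimately show ?case by metis
qed

lemma runs_fold_prog: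
  assumes "\<And>ys x zs. xs = ys @ x # zs \<Longrightarrow>
      runs P m (Pair w (Pair (X x) (Z (fold h ys a)))) T (Z (h x (fold h ys a)))"
  shows "runs (fold_prog m P) (m + 2) (Pair w (Pair (code_list X xs) (Z a)))
    (length xs * (T + 12) + 20) (Z (fold h xs a))"
proof (rule runsI)
  fix s :: store
  assume s: "s 0 = Pair w (Pair (code_list X xs) (Z a))" "\<And>v. 0 < v \<Longrightarrow> v \<le> m + 2 \<Longrightarrow> s v = Leaf"
  let ?s = "s(m + 1 := w, m + 2 := code_list X xs, 0 := Z a)"
  have "\<exists>t\<le>length xs * (T + 12) + 2. exec (while_prog m P) ?s t (?s(0 := Z (fold h xs a), m + 2 := Leaf))"
    by (rule exec_while_prog[where w = w and X = X], fact assms) (use s in auto)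
  then obtain t where t: "t \<le> length xs * (T + 12) + 2"
    "exec (while_prog m P) ?s t (?s(0 := Z (fold h xs a), m + 2 := Leaf))" by blast
  have "exec (fold_prog m P) s (3 + (4 + (4 + (t + 2)))) (s(0 := Z (fold h xs a)))"
    unfolding fold_prog_def
    apply (rule exec.Seq[where s' = "s(m + 1 := w)"])
     apply (rule exec_Assign_eq; simp add: s)
    apply (rule exec.Seq[where s' = "s(m + 1 := w, m + 2 := code_list X xs)"])
     apply (rule exec_Assign_eq; simp add: s)
    apply (rule exec.Seq[where s' = ?s])
     apply (rule exec_Assign_eq; simp add: s)
    apply (rule exec.Seq[OF t(2)])
    apply (rule exec_Assign_eq; use s in \<open>simp add: fun_eq_iff\<close>)
    done
  then show "\<exists>t\<le>length xs * (T + 12) + 20. exec (fold_prog m P) s t (s(0 := Z (fold h xs a)))"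
    using t(1) by (intro exI conjI) auto
qed

section \<open>Polynomial bounds\<close>

text \<open>One power of a base that is at least 2 instead of a polynomial: constants, sums and
  products are again bounded by such a power, with no coefficients to track.\<close>

definition pbounded :: "'x set \<Rightarrow> ('x \<Rightarrow> tree) \<Rightarrow> ('x \<Rightarrow> nat) \<Rightarrow> bool" where
  "pbounded D inp f \<longleftrightarrow> (\<exists>k. \<forall>x\<in>D. f x \<le> (size (inp x) + 2) ^ k)"

lemma pbounded_const: "pbounded D inp (\<lambda>_. c)"
proof -
  have "c \<le> (size (inp x) + 2) ^ c" for x
  proof -
    have "c \<le> 2 ^ c" by (rule less_imp_le) (rule less_exp)
    also have "\<dots> \<le> (size (inp x) + 2) ^ c" by (rule power_mono) simp_all
    finally show ?thesis .
  qed
  then show ?thesis unfolding pbounded_def by blast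
qed

lemma pbounded_size: "pbounded D inp (\<lambda>x. size (inp x))"
  unfolding pbounded_def by (rule exI[of _ 1]) simp

lemma pbounded_mono: "pbounded D inp f \<Longrightarrow> (\<And>x. x \<in> D \<Longrightarrow> g x \<le> f x) \<Longrightarrow> pbounded D inp g"
  unfolding pbounded_def by (meson order.trans)

lemma pbounded_subset: "pbounded D inp f \<Longrightarrow> D' \<subseteq> D \<Longrightarrow> pbounded D' inp f"
  unfolding pbounded_def by blast

lemma pbounded_mult: "pbounded D inp f \<Longrightarrow> pbounded D inp g \<Longrightarrow> pbounded D inp (\<lambda>x. f x * g x)"
  unfolding pbounded_def
proof (elim exE)
  fix j k assume "\<forall>x\<in>D. f x \<le> (size (inp x) + 2) ^ j" "\<forall>x\<in>D. g x \<le> (size (inp x) + 2) ^ k"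
  then show "\<exists>l. \<forall>x\<in>D. f x * g x \<le> (size (inp x) + 2) ^ l"
    by (intro exI[of _ "j + k"]) (auto simp: power_add intro: mult_mono)
qed

lemma pbounded_power: "pbounded D inp f \<Longrightarrow> pbounded D inp (\<lambda>x. f x ^ k)"
  by (induction k) (auto intro: pbounded_const pbounded_mult)

lemma pbounded_add: assumes "pbounded D inp f" "pbounded D inp g" shows "pbounded D inp (\<lambda>x. f x + g x)"
proof -
  obtain j k where jk: "\<forall>x\<in>D. f x \<le> (size (inp x) + 2) ^ j" "\<forall>x\<in>D. g x \<le> (size (inp x) + 2) ^ k"
    using assms unfolding pbounded_def by blast
  have "f x + g x \<le> (size (inp x) + 2) ^ (j + k + 1)" if "x \<in> D" for x
  proof -
    let ?b = "size (inp x) + 2"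
    have "?b ^ j \<le> ?b ^ (j + k)" "?b ^ k \<le> ?b ^ (j + k)"
      by (rule power_increasing; simp)+
    then have "f x + g x \<le> ?b ^ (j + k) * 2"
      using jk(1)[rule_format, OF that] jk(2)[rule_format, OF that] by linarith
    also have "\<dots> \<le> ?b ^ (j + k) * ?b" by (rule mult_left_mono) simp_all
    finally show ?thesis by (simp add: mult.commute)
  qed
  then show ?thesis unfolding pbounded_def by blast
qed

section \<open>Functions computable in polynomial time\<close>

text \<open>The bound on the output size is not implied by the running time: trees are shared, so their size
  can double in constant time.\<close>

definition ptime :: "'x set \<Rightarrow> ('x \<Rightarrow> tree) \<Rightarrow> ('x \<Rightarrow> tree) \<Rightarrow> bool" where
  "ptime D inp F \<longleftrightarrow> pbounded D inp (\<lambda>x. size (F x)) \<and>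
     (\<exists>P m T. pbounded D inp T \<and> (\<forall>x\<in>D. runs P m (inp x) (T x) (F x)))"

lemma ptimeI:
  "pbounded D inp (\<lambda>x. size (F x)) \<Longrightarrow> pbounded D inp T \<Longrightarrow>
    (\<And>x. x \<in> D \<Longrightarrow> runs P m (inp x) (T x) (F x)) \<Longrightarrow> ptime D inp F"
  unfolding ptime_def by blast

lemma ptimeE:
  assumes "ptime D inp F"
  obtains P m T where "pbounded D inp (\<lambda>x. size (F x))" "pbounded D inp T"
    "\<And>x. x \<in> D \<Longrightarrow> runs P m (inp x) (T x) (F x)"
  using assms unfolding ptime_def by blast

lemma ptime_size: "ptime D inp F \<Longrightarrow> pbounded D inp (\<lambda>x. size (F x))"
  unfolding ptime_def by blast

lemma ptime_cong:
  assumes "ptime D inp F" "\<And>x. x \<in> D \<Longrightarrow> G x = F x"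
  shows "ptime D inp G"
proof -
  obtain P m T where P: "pbounded D inp (\<lambda>x. size (F x))" "pbounded D inp T"
    "\<And>x. x \<in> D \<Longrightarrow> runs P m (inp x) (T x) (F x)" by (rule ptimeE[OF assms(1)], rule that; assumption)
  show ?thesis
    by (rule ptimeI[where T = T and P = P and m = m]) (use P assms(2) in \<open>auto elim: pbounded_mono\<close>)
qed

lemma ptime_subset: "ptime D inp F \<Longrightarrow> D' \<subseteq> D \<Longrightarrow> ptime D' inp F"
  unfolding ptime_def using pbounded_subset by (metis subsetD)

lemma pbounded_comp:
  assumes "pbounded E inp' b" "pbounded D inp (\<lambda>x. size (inp' (h x)))" "\<And>x. x \<in> D \<Longrightarrow> h x \<in> E"
  shows "pbounded D inp (\<lambda>x. b (h x))"
proof -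
  obtain k where "\<forall>y\<in>E. b y \<le> (size (inp' y) + 2) ^ k"
    using assms(1) unfolding pbounded_def by blast
  then have le: "b (h x) \<le> (size (inp' (h x)) + 2) ^ k" if "x \<in> D" for x
    using assms(3)[OF that] by blast
  show ?thesis
    by (rule pbounded_mono[OF _ le]) (intro pbounded_power pbounded_add assms(2) pbounded_const)
qed

lemma pbounded_mono_input:
  assumes "pbounded D inp f" "\<And>x. x \<in> D \<Longrightarrow> size (inp x) \<le> size (inp' x)"
  shows "pbounded D inp' f"
  using pbounded_comp[of D inp f D inp' "\<lambda>x. x", OF assms(1) pbounded_mono[OF pbounded_size assms(2)]] by simp

text \<open>Substitution rule. With \<open>h\<close> the identity and two different encodings it
  also changes the input format, which is how conditionals and folds receive their prepared
  argument.\<close>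

lemma ptime_call:
  assumes "ptime E inp' G" "ptime D inp (\<lambda>x. inp' (h x))" "\<And>x. x \<in> D \<Longrightarrow> h x \<in> E"
  shows "ptime D inp (\<lambda>x. G (h x))"
proof -
  obtain P m T where "pbounded D inp (\<lambda>x. size (inp' (h x)))" and P: "pbounded D inp T"
    "\<And>x. x \<in> D \<Longrightarrow> runs P m (inp x) (T x) (inp' (h x))" by (rule ptimeE[OF assms(2)], rule that; assumption)
  obtain Q m' T' where Q: "pbounded E inp' (\<lambda>x. size (G x))" "pbounded E inp' T'"
    "\<And>x. x \<in> E \<Longrightarrow> runs Q m' (inp' x) (T' x) (G x)" by (rule ptimeE[OF assms(1)], rule that; assumption)
  note bd = pbounded_comp[OF _ ptime_size[OF assms(2)] assms(3)]
  show ?thesis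
  proof (rule ptimeI)
    show "pbounded D inp (\<lambda>x. size (G (h x)))" using bd[OF Q(1)] .
    show "pbounded D inp (\<lambda>x. T x + T' (h x))" using pbounded_add[OF P(1) bd[OF Q(2)]] .
    show "runs (Seq P Q) (max m m') (inp x) (T x + T' (h x)) (G (h x))" if "x \<in> D" for x
      by (rule runs_Seq[OF runs_mono[OF P(2)[OF that]] runs_mono[OF Q(3)[OF assms(3)[OF that]]]])
        simp_all
  qed
qed

lemma ptime_Assign:
  assumes "\<And>s. eval_expr ex s = f (s 0)" "pbounded UNIV (\<lambda>t. t) (\<lambda>t. size (f t))"
  shows "ptime UNIV (\<lambda>t. t) f"
  by (rule ptimeI[where P = "Assign 0 ex" and m = 0, OF assms(2) pbounded_const])
    (rule runs_Assign, simp add: assms(1))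

lemma ptime_id: "ptime D inp inp"
  by (rule ptimeI[where P = "Assign 0 (Var 0)" and m = 0, OF pbounded_size pbounded_const]) (rule runs_Assign, simp)

lemma ptime_const: "ptime D inp (\<lambda>_. c)"
  by (rule ptimeI[where P = "Assign 0 (Const c)" and m = 0, OF pbounded_const pbounded_const]) (rule runs_Assign, simp)

lemma size_left_le: "size (left t) \<le> size t" and size_right_le: "size (right t) \<le> size t"
  by (cases t; simp)+

lemma ptime_left: "ptime D inp F \<Longrightarrow> ptime D inp (\<lambda>x. left (F x))"
  by (rule ptime_call[where E = UNIV and G = left and inp' = "\<lambda>t. t"])
    (auto intro!: ptime_Assign[of "Left (Var 0)"] pbounded_mono[OF pbounded_size] size_left_le)

lemma ptime_right: "ptime D inp F \<Longrightarrow> ptime D inp (\<lambda>x. right (F x))"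
  by (rule ptime_call[where E = UNIV and G = right and inp' = "\<lambda>t. t"])
    (auto intro!: ptime_Assign[of "Right (Var 0)"] pbounded_mono[OF pbounded_size] size_right_le)

fun tree_tree_path :: "bool list \<Rightarrow> tree \<Rightarrow> tree" where
  "tree_tree_path [] t = t"
| "tree_tree_path (b # bs) t = tree_tree_path bs (if b then right t else left t)"

lemma ptime_path: "ptime D inp F \<Longrightarrow> ptime D inp (\<lambda>x. tree_tree_path bs (F x))"
proof (induction bs arbitrary: F)
  case (Cons b bs)
  show ?case
    using Cons.IH[OF ptime_left[OF Cons.prems]] Cons.IH[OF ptime_right[OF Cons.prems]] by (cases b) simp_all
qed simp

text \<open>Access to a component of a nested environment follows a fixed path, where
  \<open>True\<close> means right.\<close>

lemma ptime_sel:
  assumes "\<And>x. x \<in> D \<Longrightarrow> G x = tree_tree_path bs (inp x)"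
  shows "ptime D inp G"
  by (rule ptime_cong[OF ptime_path[OF ptime_id, of _ _ bs]]) (fact assms)

lemma ptime_Pair:
  assumes "ptime D inp F" "ptime D inp G"
  shows "ptime D inp (\<lambda>x. Pair (F x) (G x))"
proof -
  obtain P m T where P: "pbounded D inp (\<lambda>x. size (F x))" "pbounded D inp T"
    "\<And>x. x \<in> D \<Longrightarrow> runs P m (inp x) (T x) (F x)" by (rule ptimeE[OF assms(1)], rule that; assumption)
  obtain Q m' T' where Q: "pbounded D inp (\<lambda>x. size (G x))" "pbounded D inp T'"
    "\<And>x. x \<in> D \<Longrightarrow> runs Q m' (inp x) (T' x) (G x)" by (rule ptimeE[OF assms(2)], rule that; assumption)
  show ?thesis
  proof (rule ptimeI)
    show "pbounded D inp (\<lambda>x. size (Pair (F x) (G x)))"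
      using pbounded_add[OF pbounded_add[OF P(1) Q(1)] pbounded_const[of _ _ 1]] by simp
    show "pbounded D inp (\<lambda>x. T x + T' x + 14)"
      by (intro pbounded_add pbounded_const P Q)
    show "runs (pair_prog (max m m') P Q) (max m m' + 2) (inp x) (T x + T' x + 14) (Pair (F x) (G x))"
      if "x \<in> D" for x
      by (rule runs_pair_prog[OF runs_mono[OF P(3)[OF that]] runs_mono[OF Q(3)[OF that]]]) simp_all
  qed
qed

text \<open>Each branch is required only on the inputs that reach it, so a test can guard a partial
  operation such as \<open>hd\<close>.\<close>

lemma ptime_if:
  assumes "ptime D inp C" "ptime {x\<in>D. C x \<noteq> Leaf} inp F" "ptime {x\<in>D. C x = Leaf} inp G"
  shows "ptime D inp (\<lambda>x. if C x \<noteq> Leaf then F x else G x)"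
proof -
  let ?D1 = "{x\<in>D. C x \<noteq> Leaf}" and ?D2 = "{x\<in>D. C x = Leaf}"
  obtain P m T where P: "pbounded ?D1 inp (\<lambda>x. size (F x))" "pbounded ?D1 inp T"
    "\<And>x. x \<in> ?D1 \<Longrightarrow> runs P m (inp x) (T x) (F x)" by (rule ptimeE[OF assms(2)], rule that; assumption)
  obtain Q m' T' where Q: "pbounded ?D2 inp (\<lambda>x. size (G x))" "pbounded ?D2 inp T'"
    "\<And>x. x \<in> ?D2 \<Longrightarrow> runs Q m' (inp x) (T' x) (G x)" by (rule ptimeE[OF assms(3)], rule that; assumption)
  have bd: "pbounded D inp (\<lambda>x. if C x \<noteq> Leaf then f x else g x)" if fg: "pbounded ?D1 inp f" "pbounded ?D2 inp g" for f g
  proof -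
    obtain j k where "\<forall>x\<in>?D1. f x \<le> (size (inp x) + 2) ^ j" "\<forall>x\<in>?D2. g x \<le> (size (inp x) + 2) ^ k"
      using fg unfolding pbounded_def by blast
    then have "(if C x \<noteq> Leaf then f x else g x) \<le> (size (inp x) + 2) ^ j + (size (inp x) + 2) ^ k"
      if "x \<in> D" for x
      using that by (auto simp: trans_le_add1 trans_le_add2)
    note le = this
    show ?thesis
      by (rule pbounded_mono[OF _ le]) (intro pbounded_add pbounded_power pbounded_size pbounded_const)
  qed
  have "runs (if_prog (max m m') P Q) (max m m') (Pair (C x) (inp x))
      ((if C x \<noteq> Leaf then T x else T' x) + 6) (if C x \<noteq> Leaf then F x else G x)" if "x \<in> D" for x
    using that runs_mono[OF P(3)[of x], of "max m m'" "T x"] runs_mono[OF Q(3)[of x], of "max m m'" "T' x"]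
    by (intro runs_if_prog) auto
  moreover have "pbounded D inp (\<lambda>x. (if C x \<noteq> Leaf then T x else T' x) + 6)"
    by (intro pbounded_add pbounded_const bd P Q)
  moreover have "pbounded D inp (\<lambda>x. size (if C x \<noteq> Leaf then F x else G x))"
    using bd[OF P(1) Q(1)] by (simp only: if_distrib[of size])
  ultimately have "ptime D (\<lambda>x. Pair (C x) (inp x)) (\<lambda>x. if C x \<noteq> Leaf then F x else G x)"
    by (intro ptimeI[where T = "\<lambda>x. (if C x \<noteq> Leaf then T x else T' x) + 6"
          and P = "if_prog (max m m') P Q" and m = "max m m'"])
      (auto elim!: pbounded_mono_input)
  from ptime_call[OF this, of D inp "\<lambda>x. x"] ptime_Pair[OF assms(1) ptime_id] show ?thesis by simp
qed

text \<open>A polynomial step iterated freely could square the size of its state every time. The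
  bound \<open>B\<close>, polynomial in the original input, holds for all intermediate states and
  thereby makes the cost of every single step polynomial in that input. \<open>S\<close> collects
  the arguments on which the step has to be correct.\<close>

lemma ptime_fold:
  fixes l :: "'x \<Rightarrow> 'a list" and h :: "'x \<Rightarrow> 'a \<Rightarrow> 's \<Rightarrow> 's"
  assumes l: "ptime D inp (\<lambda>x. code_list X (l x))"
    and s0: "ptime D inp (\<lambda>x. Z (s0 x))"
    and step: "ptime S (\<lambda>p. Pair (inp (fst p)) (Pair (X (fst (snd p))) (Z (snd (snd p)))))
      (\<lambda>p. Z (h (fst p) (fst (snd p)) (snd (snd p))))"
    and S: "\<And>x ys a zs. x \<in> D \<Longrightarrow> l x = ys @ a # zs \<Longrightarrow> (x, a, fold (h x) ys (s0 x)) \<in> S"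
    and B: "pbounded D inp B" "\<And>x ys zs. x \<in> D \<Longrightarrow> l x = ys @ zs \<Longrightarrow> size (Z (fold (h x) ys (s0 x))) \<le> B x"
  shows "ptime D inp (\<lambda>x. Z (fold (h x) (l x) (s0 x)))"
proof -
  let ?i = "\<lambda>p. Pair (inp (fst p)) (Pair (X (fst (snd p))) (Z (snd (snd p))))"
  obtain P m T where "pbounded S ?i (\<lambda>p. size (Z (h (fst p) (fst (snd p)) (snd (snd p)))))"
    and P: "pbounded S ?i T"
    "\<And>p. p \<in> S \<Longrightarrow> runs P m (?i p) (T p) (Z (h (fst p) (fst (snd p)) (snd (snd p))))"
    by (rule ptimeE[OF step], rule that; assumption)
  obtain k where k: "\<And>p. p \<in> S \<Longrightarrow> T p \<le> (size (?i p) + 2) ^ k"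
    using P(1) unfolding pbounded_def by blast
  \<comment> \<open>The 4 consists of the 2 from \<open>pbounded\<close> and the two
    \<open>Pair\<close> nodes that join environment, element and state.\<close>
  define U where "U x = (size (inp x) + size (code_list X (l x)) + B x + 4) ^ k" for x
  have elem: "size (X a) \<le> size (code_list X (ys @ a # zs))" for a ys zs
    by (induction ys) auto
  have len: "length xs \<le> size (code_list X xs)" for xs
    by (induction xs) auto
  have U: "pbounded D inp U"
    unfolding U_def by (intro pbounded_power pbounded_add pbounded_size pbounded_const B ptime_size[OF l])
  let ?j = "\<lambda>x. Pair (inp x) (Pair (code_list X (l x)) (Z (s0 x)))"
  have j: "ptime D inp ?j" by (intro ptime_Pair ptime_id l s0)
  have "ptime D ?j (\<lambda>x. Z (fold (h x) (l x) (s0 x)))"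
  proof (rule ptimeI)
    have trans: "pbounded D ?j f" if "pbounded D inp f" for f
      using that by (rule pbounded_mono_input) simp
    show "pbounded D ?j (\<lambda>x. size (Z (fold (h x) (l x) (s0 x))))"
      by (rule pbounded_mono[OF trans[OF B(1)]]) (use B(2) in auto)
    show "pbounded D ?j (\<lambda>x. size (code_list X (l x)) * (U x + 12) + 20)"
      by (intro trans pbounded_add pbounded_mult pbounded_const U ptime_size[OF l])
    show "runs (fold_prog m P) (m + 2) (?j x) (size (code_list X (l x)) * (U x + 12) + 20)
        (Z (fold (h x) (l x) (s0 x)))" if x: "x \<in> D" for x
    proof (rule runs_mono[OF runs_fold_prog])
      show "length (l x) * (U x + 12) + 20 \<le> size (code_list X (l x)) * (U x + 12) + 20"
        using len[of "l x"] by simp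
      fix ys a zs assume split: "l x = ys @ a # zs"
      let ?p = "(x, a, fold (h x) ys (s0 x))"
      have p: "?p \<in> S" using S[OF x split] .
      have "T ?p \<le> (size (?i ?p) + 2) ^ k" by (rule k[OF p])
      also have "\<dots> \<le> U x"
        unfolding U_def using B(2)[OF x split] elem[of a ys zs] split
        by (intro power_mono) simp_all
      finally show "runs P m (Pair (inp x) (Pair (X a) (Z (fold (h x) ys (s0 x))))) (U x)
          (Z (h x a (fold (h x) ys (s0 x))))"
        using runs_mono[OF P(2)[OF p] order_refl] by simp
    qed simp
  qed
  from ptime_call[OF this, of D inp "\<lambda>x. x"] j show ?thesis by simp
qed

text \<open>For states known only through an invariant; \<open>ptime_fold\<close> remains for loops
  whose intermediate states are known explicitly.\<close>

lemma ptime_fold_inv: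
  fixes l :: "'x \<Rightarrow> 'a list" and h :: "'x \<Rightarrow> 'a \<Rightarrow> 's \<Rightarrow> 's"
  assumes l: "ptime D inp (\<lambda>x. code_list X (l x))"
    and s0: "ptime D inp (\<lambda>x. Z (s0 x))"
    and step: "ptime {p. fst p \<in> D \<and> fst (snd p) \<in> set (l (fst p)) \<and> I (fst p) (snd (snd p))}
      (\<lambda>p. Pair (inp (fst p)) (Pair (X (fst (snd p))) (Z (snd (snd p)))))
      (\<lambda>p. Z (h (fst p) (fst (snd p)) (snd (snd p))))"
    and I: "\<And>x. x \<in> D \<Longrightarrow> I x (s0 x)"
      "\<And>x a s. x \<in> D \<Longrightarrow> a \<in> set (l x) \<Longrightarrow> I x s \<Longrightarrow> I x (h x a s)"
    and B: "pbounded D inp B" "\<And>x s. x \<in> D \<Longrightarrow> I x s \<Longrightarrow> size (Z s) \<le> B x"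
  shows "ptime D inp (\<lambda>x. Z (fold (h x) (l x) (s0 x)))"
proof -
  have inv: "I x (fold (h x) ys (s0 x))" if "x \<in> D" "set ys \<subseteq> set (l x)" for x ys
    using that(2) by (induction ys rule: rev_induct) (auto intro: I that(1))
  show ?thesis
    by (rule ptime_fold[OF l s0 step _ B(1)]) (auto intro!: inv B(2))
qed

section \<open>Lists\<close>

lemma ptime_Nil: "ptime D inp (\<lambda>_. code_list X [])"
  by (simp add: ptime_const)

lemma ptime_Cons: "ptime D inp (\<lambda>x. X (a x)) \<Longrightarrow> ptime D inp (\<lambda>x. code_list X (l x)) \<Longrightarrow>
    ptime D inp (\<lambda>x. code_list X (a x # l x))"
  by (simp add: ptime_Pair)

lemma ptime_hd:
  assumes "ptime D inp (\<lambda>x. code_list X (l x))" "\<And>x. x \<in> D \<Longrightarrow> l x \<noteq> []"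
  shows "ptime D inp (\<lambda>x. X (hd (l x)))"
proof (rule ptime_cong[OF ptime_left[OF assms(1)]])
  show "X (hd (l x)) = left (code_list X (l x))" if "x \<in> D" for x
    using assms(2)[OF that] by (cases "l x") auto
qed

lemma ptime_tl:
  assumes "ptime D inp (\<lambda>x. code_list X (l x))"
  shows "ptime D inp (\<lambda>x. code_list X (tl (l x)))"
proof (rule ptime_cong[OF ptime_right[OF assms(1)]])
  show "code_list X (tl (l x)) = right (code_list X (l x))" for x
    by (cases "l x") auto
qed

lemma size_code_list: "size (code_list X xs) = (\<Sum>x\<leftarrow>xs. size (X x) + 1)"
  by (induction xs) auto

lemma length_le_size_code_list: "length xs \<le> size (code_list X xs)"
  by (induction xs) auto

lemma size_code_list_le:
  "(\<And>x. x \<in> set xs \<Longrightarrow> size (X x) \<le> b) \<Longrightarrow> size (code_list X xs) \<le> length xs * (b + 1)"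
proof (induction xs)
  case (Cons x xs)
  have "size (code_list X xs) \<le> length xs * (b + 1)" by (rule Cons.IH) (simp add: Cons.prems)
  moreover have "size (X x) \<le> b" by (rule Cons.prems) simp
  ultimately show ?case by simp
qed simp

lemma size_member_code_list: "a \<in> set xs \<Longrightarrow> size (X a) \<le> size (code_list X xs)"
  by (induction xs) auto

lemma code_list_eq_Leaf [simp]: "code_list X xs = Leaf \<longleftrightarrow> xs = []"
  by (cases xs) auto

lemma size_code_list_append: "size (code_list X (xs @ ys)) = size (code_list X xs) + size (code_list X ys)"
  by (simp add: size_code_list)

lemma size_code_list_rev: "size (code_list X (rev xs)) = size (code_list X xs)"
  by (induction xs) (simp_all add: size_code_list_append)

lemma size_code_list_drop: "size (code_list X (drop k xs)) \<le> size (code_list X xs)"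
  using size_code_list_append[of X "take k xs" "drop k xs"] by simp

lemma ptime_rev:
  assumes "ptime D inp (\<lambda>x. code_list X (l x))"
  shows "ptime D inp (\<lambda>x. code_list X (rev (l x)))"
proof -
  have "ptime D inp (\<lambda>x. code_list X (fold Cons (l x) []))"
  proof (rule ptime_fold[where Z = "code_list X" and S = UNIV, OF assms ptime_Nil])
    show "ptime UNIV (\<lambda>p. Pair (inp (fst p)) (Pair (X (fst (snd p))) (code_list X (snd (snd p)))))
        (\<lambda>p. code_list X (fst (snd p) # snd (snd p)))"
      by (rule ptime_sel[of _ _ "[True]"]) simp
    show "pbounded D inp (\<lambda>x. size (code_list X (l x)))" using ptime_size[OF assms] .
    show "size (code_list X (fold Cons ys [])) \<le> size (code_list X (l x))" if "l x = ys @ zs" for x ys zs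
      using that by (simp add: size_code_list_append size_code_list_rev fold_Cons_rev)
  qed simp
  then show ?thesis by (simp add: fold_Cons_rev)
qed

text \<open>Consing the images in a fold reverses them, so a reversal follows. The accumulator has
  at most as many elements as the input list, and each image is polynomial in the environment and
  one element.\<close>

lemma ptime_map:
  fixes l :: "'x \<Rightarrow> 'a list"
  assumes l: "ptime D inp (\<lambda>x. code_list X (l x))"
    and step: "ptime {p. fst p \<in> D \<and> snd p \<in> set (l (fst p))} (\<lambda>p. Pair (inp (fst p)) (X (snd p)))
      (\<lambda>p. Y (h (fst p) (snd p)))"
  shows "ptime D inp (\<lambda>x. code_list Y (map (h x) (l x)))"
proof -
  let ?S = "{p. fst p \<in> D \<and> fst (snd p) \<in> set (l (fst p))}"
  obtain k where k: "\<And>x a. x \<in> D \<Longrightarrow> a \<in> set (l x) \<Longrightarrow>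
      size (Y (h x a)) \<le> (size (inp x) + size (X a) + 3) ^ k"
    using ptime_size[OF step] unfolding pbounded_def by (force simp: ac_simps numeral_3_eq_3)
  have "ptime D inp (\<lambda>x. code_list Y (fold (\<lambda>a s. h x a # s) (l x) []))"
  proof (rule ptime_fold[where Z = "code_list Y" and S = ?S, OF l ptime_Nil])
    let ?i = "\<lambda>p. Pair (inp (fst p)) (Pair (X (fst (snd p))) (code_list Y (snd (snd p))))"
    have "ptime ?S ?i (\<lambda>p. Y (h (fst p) (fst (snd p))))"
    proof (rule ptime_cong[OF ptime_call[OF step]])
      show "ptime ?S ?i (\<lambda>p. Pair (inp (fst (fst p, fst (snd p)))) (X (snd (fst p, fst (snd p)))))"
        by (intro ptime_Pair; rule ptime_sel[of _ _ "[False]"] ptime_sel[of _ _ "[True, False]"]; simp)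
    qed auto
    then show "ptime ?S ?i (\<lambda>p. code_list Y (h (fst p) (fst (snd p)) # snd (snd p)))"
      by (rule ptime_Cons) (rule ptime_sel[of _ _ "[True, True]"], simp)
    let ?B = "\<lambda>x. size (code_list X (l x)) * ((size (inp x) + size (code_list X (l x)) + 3) ^ k + 1)"
    show "pbounded D inp ?B"
      by (intro pbounded_mult pbounded_add pbounded_power pbounded_size pbounded_const ptime_size[OF l])
    show "size (code_list Y (fold (\<lambda>a s. h x a # s) ys [])) \<le> ?B x"
      if x: "x \<in> D" and split: "l x = ys @ zs" for x ys zs
    proof -
      have eq: "fold (\<lambda>a s. h x a # s) ys s = rev (map (h x) ys) @ s" for s
        by (induction ys arbitrary: s) auto
      have "size (code_list Y (rev (map (h x) ys))) \<le>
          length (rev (map (h x) ys)) * ((size (inp x) + size (code_list X (l x)) + 3) ^ k + 1)"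
      proof (rule size_code_list_le)
        fix b assume "b \<in> set (rev (map (h x) ys))"
        then obtain a where a: "a \<in> set (l x)" "b = h x a" using split by auto
        have "size (Y b) \<le> (size (inp x) + size (X a) + 3) ^ k" using k[OF x a(1)] a(2) by simp
        also have "\<dots> \<le> (size (inp x) + size (code_list X (l x)) + 3) ^ k"
          using size_member_code_list[OF a(1), of X] by (intro power_mono) simp_all
        finally show "size (Y b) \<le> \<dots>" .
      qed
      also have "\<dots> \<le> ?B x"
        using length_le_size_code_list[of "l x" X] split by (intro mult_right_mono) simp_all
      finally show ?thesis by (simp add: eq)
    qed
  qed auto
  moreover have "fold (\<lambda>a s. h x a # s) xs s = rev (map (h x) xs) @ s" for x s xs
    by (induction xs arbitrary: s) auto
  ultimately have "ptime D inp (\<lambda>x. code_list Y (rev (map (h x) (l x))))" by simp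
  from ptime_rev[OF this] show ?thesis by simp
qed

lemma ptime_append:
  assumes "ptime D inp (\<lambda>x. code_list X (l x))" "ptime D inp (\<lambda>x. code_list X (l' x))"
  shows "ptime D inp (\<lambda>x. code_list X (l x @ l' x))"
proof -
  have "ptime D inp (\<lambda>x. code_list X (fold Cons (rev (l x)) (l' x)))"
  proof (rule ptime_fold[where Z = "code_list X" and S = UNIV, OF ptime_rev[OF assms(1)] assms(2)])
    show "ptime UNIV (\<lambda>p. Pair (inp (fst p)) (Pair (X (fst (snd p))) (code_list X (snd (snd p)))))
        (\<lambda>p. code_list X (fst (snd p) # snd (snd p)))"
      by (rule ptime_sel[of _ _ "[True]"]) simp
    show "pbounded D inp (\<lambda>x. size (code_list X (l x)) + size (code_list X (l' x)))"
      by (intro pbounded_add ptime_size assms)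
    show "size (code_list X (fold Cons ys (l' x))) \<le> size (code_list X (l x)) + size (code_list X (l' x))"
      if "rev (l x) = ys @ zs" for x ys zs
      using that size_code_list_rev[of X "l x"]
      by (simp add: size_code_list_append size_code_list_rev fold_Cons_rev)
  qed simp
  then show ?thesis by (simp add: fold_Cons_rev)
qed

lemma ptime_concat:
  assumes "ptime D inp (\<lambda>x. code_list (code_list X) (l x))"
  shows "ptime D inp (\<lambda>x. code_list X (concat (l x)))"
proof -
  have eq: "fold append (rev xs) [] = concat xs" for xs :: "'b list list"
    by (induction xs) auto
  have size: "size (code_list X (concat xs)) \<le> size (code_list (code_list X) xs)" for xs
    by (induction xs) (auto simp: size_code_list)
  have "ptime D inp (\<lambda>x. code_list X (fold append (rev (l x)) []))"
  proof (rule ptime_fold[where Z = "code_list X" and S = UNIV, OF ptime_rev[OF assms(1)] ptime_Nil])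
    show "ptime UNIV (\<lambda>p. Pair (inp (fst p)) (Pair (code_list X (fst (snd p))) (code_list X (snd (snd p)))))
        (\<lambda>p. code_list X (fst (snd p) @ snd (snd p)))"
      by (rule ptime_append; rule ptime_sel[of _ _ "[True, False]"] ptime_sel[of _ _ "[True, True]"]; simp)
    show "pbounded D inp (\<lambda>x. size (code_list (code_list X) (l x)))"
      by (rule ptime_size[OF assms])
    show "size (code_list X (fold append ys [])) \<le> size (code_list (code_list X) (l x))"
      if "rev (l x) = ys @ zs" for x ys zs
    proof -
      have "l x = rev zs @ rev ys" using that by (metis rev_append rev_rev_ident)
      then have "size (code_list (code_list X) (rev ys)) \<le> size (code_list (code_list X) (l x))"
        by (simp add: size_code_list)
      then show ?thesis using size[of "rev ys"] eq[of "rev ys"] by simp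
    qed
  qed simp
  then show ?thesis by (simp add: eq)
qed

definition code_pair :: "('a \<Rightarrow> tree) \<Rightarrow> ('b \<Rightarrow> tree) \<Rightarrow> 'a \<times> 'b \<Rightarrow> tree" where
  "code_pair X Y p = Pair (X (fst p)) (Y (snd p))"

lemma ptime_code_pair: "ptime D inp (\<lambda>x. X (a x)) \<Longrightarrow> ptime D inp (\<lambda>x. Y (b x)) \<Longrightarrow>
    ptime D inp (\<lambda>x. code_pair X Y (a x, b x))"
  by (simp add: code_pair_def ptime_Pair)

lemma ptime_fst: "ptime D inp (\<lambda>x. code_pair X Y (a x)) \<Longrightarrow> ptime D inp (\<lambda>x. X (fst (a x)))"
  using ptime_left[of D inp "\<lambda>x. code_pair X Y (a x)"] by (simp add: code_pair_def)

lemma ptime_snd: "ptime D inp (\<lambda>x. code_pair X Y (a x)) \<Longrightarrow> ptime D inp (\<lambda>x. Y (snd (a x)))"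
  using ptime_right[of D inp "\<lambda>x. code_pair X Y (a x)"] by (simp add: code_pair_def)

text \<open>A fold over the first list that consumes the second one inside its state. Equal lengths
  guarantee that the consumed list is nonempty whenever a step is taken.\<close>

lemma ptime_zip:
  fixes l :: "'x \<Rightarrow> 'a list" and l' :: "'x \<Rightarrow> 'b list"
  assumes l: "ptime D inp (\<lambda>x. code_list X (l x))" and l': "ptime D inp (\<lambda>x. code_list Y (l' x))"
    and len: "\<And>x. x \<in> D \<Longrightarrow> length (l x) = length (l' x)"
  shows "ptime D inp (\<lambda>x. code_list (code_pair X Y) (zip (l x) (l' x)))"
proof -
  let ?h = "\<lambda>a s. (tl (fst s), (a, hd (fst s)) # snd s)"
  let ?Z = "code_pair (code_list Y) (code_list (code_pair X Y))"
  let ?S = "{p. fst (snd (snd p)) \<noteq> []} :: ('x \<times> 'a \<times> 'b list \<times> ('a \<times> 'b) list) set"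
  let ?i = "\<lambda>p. Pair (inp (fst p)) (Pair (X (fst (snd p))) (?Z (snd (snd p))))"
  have eq: "fold ?h ys (s, acc) = (drop (length ys) s, rev (zip ys s) @ acc)"
    if "length ys \<le> length s" for ys :: "'a list" and s :: "'b list" and acc
    using that
  proof (induction ys arbitrary: s acc)
    case (Cons y ys)
    then show ?case by (cases s) auto
  qed simp
  have "ptime D inp (\<lambda>x. ?Z (fold ?h (l x) (l' x, [])))"
  proof (rule ptime_fold[where S = ?S, OF l])
    show "ptime D inp (\<lambda>x. ?Z (l' x, []))" by (intro ptime_code_pair l' ptime_Nil)
    have st: "ptime ?S ?i (\<lambda>p. ?Z (snd (snd p)))" "ptime ?S ?i (\<lambda>p. X (fst (snd p)))"
      by (rule ptime_sel[of _ _ "[True, True]"] ptime_sel[of _ _ "[True, False]"]; simp)+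
    show "ptime ?S ?i (\<lambda>p. ?Z (tl (fst (snd (snd p))), (fst (snd p), hd (fst (snd (snd p)))) # snd (snd (snd p))))"
      by (intro ptime_code_pair ptime_tl ptime_fst[OF st(1)] ptime_Cons st(2) ptime_hd ptime_snd[OF st(1)]) auto
    show "(x, a, fold ?h ys (l' x, [])) \<in> ?S" if "x \<in> D" "l x = ys @ a # zs" for x ys a zs
      using that len[OF that(1)] by (simp add: eq)
    \<comment> \<open>The second list is counted twice, for its remainder and for its share in the
      pairs already formed.\<close>
    let ?B = "\<lambda>x. size (code_list X (l x)) + 2 * size (code_list Y (l' x)) + 1"
    show "pbounded D inp ?B"
      by (intro pbounded_mult pbounded_add pbounded_const ptime_size[OF l] ptime_size[OF l'])
    show "size (?Z (fold ?h ys (l' x, []))) \<le> ?B x" if "x \<in> D" "l x = ys @ zs" for x ys zs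
    proof -
      have "size (code_list (code_pair X Y) (zip us vs)) \<le> size (code_list X us) + size (code_list Y vs)" for us vs
      proof (induction us arbitrary: vs)
        case (Cons u us)
        then show ?case by (cases vs) (auto simp: code_pair_def add_mono)
      qed simp
      from this[of ys "l' x"] have
        "size (code_list (code_pair X Y) (rev (zip ys (l' x)))) \<le> size (code_list X (l x)) + size (code_list Y (l' x))"
        using that(2) by (simp add: size_code_list_rev size_code_list_append)
      then show ?thesis
        using that len[OF that(1)] size_code_list_drop[of Y "length ys" "l' x"]
        by (simp add: eq) (simp add: code_pair_def add_mono)
    qed
  qed
  then have "ptime D inp (\<lambda>x. ?Z (drop (length (l x)) (l' x), rev (zip (l x) (l' x))))"
    by (rule ptime_cong) (simp add: eq len)
  from ptime_rev[OF ptime_snd[OF this]] show ?thesis by simp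
qed

section \<open>Finite functions and Booleans\<close>

fun eq_const :: "tree \<Rightarrow> tree \<Rightarrow> bool" where
  "eq_const Leaf t \<longleftrightarrow> t = Leaf"
| "eq_const (Pair a b) t \<longleftrightarrow> t \<noteq> Leaf \<and> eq_const a (left t) \<and> eq_const b (right t)"

lemma eq_const_iff: "eq_const d t \<longleftrightarrow> t = d"
  by (induction d arbitrary: t; case_tac t) auto

definition code_bool :: "bool \<Rightarrow> tree" where
  "code_bool b = (if b then Pair Leaf Leaf else Leaf)"

lemma code_bool_eq_Leaf [simp]: "code_bool b = Leaf \<longleftrightarrow> \<not> b" "code_bool b \<noteq> Leaf \<longleftrightarrow> b"
  by (simp_all add: code_bool_def)

lemma ptime_If:
  assumes "ptime D inp (\<lambda>x. code_bool (c x))" "ptime {x\<in>D. c x} inp F" "ptime {x\<in>D. \<not> c x} inp G"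
  shows "ptime D inp (\<lambda>x. if c x then F x else G x)"
  using ptime_if[OF assms(1), of F G] assms(2,3) by simp

lemma ptime_conj:
  assumes "ptime D inp (\<lambda>x. code_bool (a x))" "ptime {x\<in>D. a x} inp (\<lambda>x. code_bool (b x))"
  shows "ptime D inp (\<lambda>x. code_bool (a x \<and> b x))"
  by (rule ptime_cong[OF ptime_If[OF assms ptime_const[of _ _ Leaf]]]) (simp add: code_bool_def)

text \<open>The constant is unrolled into the program: recursion on \<open>d\<close> yields a fixed
  nest of tests for \<open>Leaf\<close>.\<close>

lemma ptime_eq_const: "ptime D inp F \<Longrightarrow> ptime D inp (\<lambda>x. code_bool (F x = d))"
  unfolding eq_const_iff[symmetric]
proof (induction d arbitrary: F D)
  case Leaf
  have "ptime D inp (\<lambda>x. if F x \<noteq> Leaf then Leaf else Pair Leaf Leaf)"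
    by (rule ptime_if[OF Leaf ptime_const ptime_const])
  then show ?case by (rule ptime_cong) (simp add: code_bool_def)
next
  case (Pair a b)
  have "ptime D inp (\<lambda>x. if F x \<noteq> Leaf then code_bool (eq_const a (left (F x)) \<and> eq_const b (right (F x))) else Leaf)"
    by (intro ptime_if Pair ptime_const ptime_conj ptime_left ptime_right ptime_subset[OF Pair.prems]) auto
  then show ?case by (rule ptime_cong) (simp add: code_bool_def)
qed

text \<open>A lookup table, compiled into a cascade of comparisons with constants. The
  multiplication table of the fixed group enters the programs in this way.\<close>

lemma ptime_finite:
  assumes "ptime D inp (\<lambda>x. c (h x))" "finite S" "inj_on c S" "\<And>x. x \<in> D \<Longrightarrow> h x \<in> S"
  shows "ptime D inp (\<lambda>x. F (h x))"
  using assms(2,1,3,4)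
proof (induction S arbitrary: D rule: finite_induct)
  case empty
  then have "D = {}" by auto
  then show ?case using ptime_cong[OF ptime_const[of "{}" inp Leaf]] by blast
next
  case (insert a S)
  have "ptime D inp (\<lambda>x. if c (h x) = c a then F a else F (h x))"
  proof (rule ptime_If)
    show "ptime D inp (\<lambda>x. code_bool (c (h x) = c a))" by (rule ptime_eq_const[OF insert.prems(1)])
    show "ptime {x \<in> D. c (h x) \<noteq> c a} inp (\<lambda>x. F (h x))"
      by (rule insert.IH) (use insert.prems in \<open>auto intro: ptime_subset\<close>)
  qed (rule ptime_const)
  then show ?case
  proof (rule ptime_cong)
    fix x assume "x \<in> D"
    then show "F (h x) = (if c (h x) = c a then F a else F (h x))"
      using inj_onD[OF insert.prems(2), of "h x" a] insert.prems(3)[of x] by auto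
  qed
qed

lemma ptime_Ball:
  fixes l :: "'x \<Rightarrow> 'a list"
  assumes l: "ptime D inp (\<lambda>x. code_list X (l x))"
    and step: "ptime {p. fst p \<in> D \<and> snd p \<in> set (l (fst p))} (\<lambda>p. Pair (inp (fst p)) (X (snd p)))
      (\<lambda>p. code_bool (Q (fst p) (snd p)))"
  shows "ptime D inp (\<lambda>x. code_bool (\<forall>a\<in>set (l x). Q x a))"
proof -
  have m: "ptime D inp (\<lambda>x. code_list code_bool (map (Q x) (l x)))"
    by (rule ptime_map[where h = Q and X = X, OF l step])
  have "ptime D inp (\<lambda>x. code_bool (fold (\<lambda>b s. b \<and> s) (map (Q x) (l x)) True))"
  proof (rule ptime_fold[where Z = code_bool and S = UNIV, OF m ptime_const])
    show "ptime UNIV (\<lambda>p. Pair (inp (fst p)) (Pair (code_bool (fst (snd p))) (code_bool (snd (snd p)))))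
        (\<lambda>p. code_bool (fst (snd p) \<and> snd (snd p)))"
      by (rule ptime_conj; rule ptime_sel[of _ _ "[True, False]"] ptime_sel[of _ _ "[True, True]"]; simp)
    show "pbounded D inp (\<lambda>_. 1)" by (rule pbounded_const)
  qed (simp_all add: code_bool_def)
  moreover have "fold (\<lambda>b s. b \<and> s) bs s = (s \<and> (\<forall>b\<in>set bs. b))" for bs s
    by (induction bs arbitrary: s) auto
  ultimately show ?thesis by simp
qed

text \<open>Lengths are compared without counting: one element of \<open>l'\<close> is dropped for
  every element of \<open>l\<close>.\<close>

lemma ptime_length_le:
  fixes l :: "'x \<Rightarrow> 'a list" and l' :: "'x \<Rightarrow> 'b list"
  assumes l: "ptime D inp (\<lambda>x. code_list X (l x))" and l': "ptime D inp (\<lambda>x. code_list Y (l' x))"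
  shows "ptime D inp (\<lambda>x. code_bool (length (l' x) \<le> length (l x)))"
proof -
  have eq: "fold (\<lambda>_. tl) ys s = drop (length ys) s" for ys :: "'a list" and s :: "'b list"
    by (induction ys arbitrary: s) (auto simp: drop_Suc)
  have "ptime D inp (\<lambda>x. code_list Y (fold (\<lambda>_. tl) (l x) (l' x)))"
  proof (rule ptime_fold[where S = UNIV and Z = "code_list Y", OF l l'])
    show "ptime UNIV (\<lambda>p. Pair (inp (fst p)) (Pair (X (fst (snd p))) (code_list Y (snd (snd p)))))
        (\<lambda>p. code_list Y (tl (snd (snd p))))"
      by (rule ptime_tl) (rule ptime_sel[of _ _ "[True, True]"], simp)
    show "pbounded D inp (\<lambda>x. size (code_list Y (l' x)))" by (rule ptime_size[OF l'])
    show "size (code_list Y (fold (\<lambda>_. tl) ys (l' x))) \<le> size (code_list Y (l' x))" for x and ys :: "'a list"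
      by (simp add: size_code_list_drop eq)
  qed simp
  then have "ptime D inp (\<lambda>x. code_list Y (drop (length (l x)) (l' x)))" by (simp add: eq)
  then have "ptime D inp (\<lambda>x. code_bool (code_list Y (drop (length (l x)) (l' x)) = Leaf))"
    by (rule ptime_eq_const)
  then show ?thesis by simp
qed

section \<open>Vectors over a finite group\<close>

locale coded_group = group G for G (structure) +
  fixes e :: "'a \<Rightarrow> nat"
  assumes finite_carrier: "finite (carrier G)"
    and order_ge_2: "order G \<ge> 2"
    and e_bij: "bij_betw e (carrier G) {..<order G}"
begin

definition vecs :: "nat \<Rightarrow> 'a list set" where
  "vecs n = {v. length v = n \<and> set v \<subseteq> carrier G}"

definition vone :: "nat \<Rightarrow> 'a list" where
  "vone n = replicate n \<one>"

definition vmul :: "'a list \<Rightarrow> 'a list \<Rightarrow> 'a list" where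
  "vmul u v = map (\<lambda>p. fst p \<otimes> snd p) (zip u v)"

text \<open>Left quotient. The side matters as \<open>G\<close> need not be abelian: dividing by
  elements of a subgroup on the left stays within one right coset of it.\<close>

definition vdiv :: "'a list \<Rightarrow> 'a list \<Rightarrow> 'a list" where
  "vdiv u v = map (\<lambda>p. inv (fst p) \<otimes> snd p) (zip u v)"

lemma vecs_length: "v \<in> vecs n \<Longrightarrow> length v = n"
  by (simp add: vecs_def)

lemma vecs_nth: "v \<in> vecs n \<Longrightarrow> i < n \<Longrightarrow> v ! i \<in> carrier G"
  using nth_mem[of i v] by (auto simp: vecs_def)

lemma vecsI: "length v = n \<Longrightarrow> (\<And>i. i < n \<Longrightarrow> v ! i \<in> carrier G) \<Longrightarrow> v \<in> vecs n"
  by (auto simp: vecs_def set_conv_nth)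

lemma vecs_eqI: "u \<in> vecs n \<Longrightarrow> v \<in> vecs n \<Longrightarrow> (\<And>i. i < n \<Longrightarrow> u ! i = v ! i) \<Longrightarrow> u = v"
  by (simp add: list_eq_iff_nth_eq vecs_length)

lemma finite_vecs: "finite (vecs n)"
  using finite_lists_length_eq[OF finite_carrier, of n] by (simp add: vecs_def conj_commute)

lemma vone_nth [simp]: "i < n \<Longrightarrow> vone n ! i = \<one>"
  by (simp add: vone_def)

lemma vone_vecs [simp]: "vone n \<in> vecs n"
  by (auto simp: vecs_def vone_def)

lemma vmul_nth [simp]: "u \<in> vecs n \<Longrightarrow> v \<in> vecs n \<Longrightarrow> i < n \<Longrightarrow> vmul u v ! i = u ! i \<otimes> v ! i"
  by (simp add: vmul_def vecs_length)

lemma vdiv_nth [simp]: "u \<in> vecs n \<Longrightarrow> v \<in> vecs n \<Longrightarrow> i < n \<Longrightarrow> vdiv u v ! i = inv (u ! i) \<otimes> v ! i"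
  by (simp add: vdiv_def vecs_length)

lemma vmul_vecs [simp]: "u \<in> vecs n \<Longrightarrow> v \<in> vecs n \<Longrightarrow> vmul u v \<in> vecs n"
  by (rule vecsI) (simp_all add: vecs_nth, simp add: vmul_def vecs_length)

lemma vdiv_vecs [simp]: "u \<in> vecs n \<Longrightarrow> v \<in> vecs n \<Longrightarrow> vdiv u v \<in> vecs n"
  by (rule vecsI) (simp_all add: vecs_nth, simp add: vdiv_def vecs_length)

lemma vmul_assoc:
  "u \<in> vecs n \<Longrightarrow> v \<in> vecs n \<Longrightarrow> w \<in> vecs n \<Longrightarrow> vmul (vmul u v) w = vmul u (vmul v w)"
  by (rule vecs_eqI[where n = n]) (simp_all add: vmul_nth[of _ n] vdiv_nth[of _ n] m_assoc vecs_nth)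

lemma vmul_vone: "v \<in> vecs n \<Longrightarrow> vmul v (vone n) = v"
  by (rule vecs_eqI[where n = n]) (simp_all add: vmul_nth[of _ n] vdiv_nth[of _ n] vecs_nth)

lemma vone_vmul: "v \<in> vecs n \<Longrightarrow> vmul (vone n) v = v"
  by (rule vecs_eqI[where n = n]) (simp_all add: vmul_nth[of _ n] vdiv_nth[of _ n] vecs_nth)

lemma vmul_vdiv: "u \<in> vecs n \<Longrightarrow> v \<in> vecs n \<Longrightarrow> vmul u (vdiv u v) = v"
  by (rule vecs_eqI[where n = n]) (simp_all add: vmul_nth[of _ n] vdiv_nth[of _ n] vecs_nth m_assoc[symmetric])

lemma vdiv_vmul: "u \<in> vecs n \<Longrightarrow> v \<in> vecs n \<Longrightarrow> vdiv u (vmul u v) = v"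
  by (rule vecs_eqI[where n = n]) (simp_all add: vmul_nth[of _ n] vdiv_nth[of _ n] vecs_nth m_assoc[symmetric])

lemma vone_vdiv: "v \<in> vecs n \<Longrightarrow> vdiv (vone n) v = v"
  by (rule vecs_eqI[where n = n]) (simp_all add: vmul_nth[of _ n] vdiv_nth[of _ n] vecs_nth)

lemma vdiv_vmul_left:
  "u \<in> vecs n \<Longrightarrow> v \<in> vecs n \<Longrightarrow> w \<in> vecs n \<Longrightarrow> vdiv (vmul u v) w = vdiv v (vdiv u w)"
  by (rule vecs_eqI[where n = n]) (simp_all add: vmul_nth[of _ n] vdiv_nth[of _ n] vecs_nth inv_mult_group m_assoc)

lemma vmul_vdiv_assoc:
  "u \<in> vecs n \<Longrightarrow> v \<in> vecs n \<Longrightarrow> w \<in> vecs n \<Longrightarrow> vmul (vdiv u v) w = vdiv u (vmul v w)"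
  by (rule vecs_eqI[where n = n]) (simp_all add: vmul_nth[of _ n] vdiv_nth[of _ n] vecs_nth m_assoc)

definition vsubgroup :: "nat \<Rightarrow> 'a list set \<Rightarrow> bool" where
  "vsubgroup n M \<longleftrightarrow> M \<subseteq> vecs n \<and> vone n \<in> M \<and> (\<forall>u\<in>M. \<forall>v\<in>M. vmul u v \<in> M)"

lemma vsubgroupD:
  assumes "vsubgroup n M"
  shows "u \<in> M \<Longrightarrow> u \<in> vecs n" "vone n \<in> M" "u \<in> M \<Longrightarrow> v \<in> M \<Longrightarrow> vmul u v \<in> M"
  using assms by (auto simp: vsubgroup_def)

text \<open>Left multiplication by \<open>u\<close> maps the finite set \<open>M\<close> injectively
  into itself, hence onto, and the preimage of \<open>v\<close> is the quotient.\<close>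

lemma vsubgroup_vdiv:
  assumes M: "vsubgroup n M" and uv: "u \<in> M" "v \<in> M"
  shows "vdiv u v \<in> M"
proof -
  have "finite M" using M finite_vecs finite_subset by (auto simp: vsubgroup_def)
  moreover have "inj_on (vmul u) M"
    by (rule inj_on_inverseI[where g = "vdiv u"]) (meson vdiv_vmul vsubgroupD(1)[OF M] uv(1))
  ultimately have "vmul u ` M = M"
    using M uv by (intro endo_inj_surj) (auto dest: vsubgroupD(3))
  then obtain w where "w \<in> M" "vmul u w = v" using uv by (metis imageE)
  then show ?thesis using M uv vdiv_vmul by (metis vsubgroupD(1))
qed

definition leads :: "'a list \<Rightarrow> nat \<Rightarrow> bool" where
  "leads v i \<longleftrightarrow> i < length v \<and> v ! i \<noteq> \<one> \<and> (\<forall>j<i. v ! j = \<one>)"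

text \<open>The analogue of a common pivot. Among the elements of a subgroup that are trivial before
  \<open>i\<close>, two with the same value at \<open>i\<close> differ by an element trivial up to
  and including \<open>i\<close>. Without a field, pivots cannot be normalised, so a table may hold
  one entry per position and nontrivial value.\<close>

definition same_lead :: "'a list \<Rightarrow> 'a list \<Rightarrow> bool" where
  "same_lead t g \<longleftrightarrow> (\<exists>i. leads t i \<and> leads g i \<and> t ! i = g ! i)"

lemma leads_unique: "leads v i \<Longrightarrow> leads v j \<Longrightarrow> i = j"
  unfolding leads_def by (metis linorder_neqE_nat)

lemma leads_exists:
  assumes "v \<in> vecs n" "v \<noteq> vone n"
  shows "\<exists>i<n. leads v i"
proof -
  define i where "i = (LEAST i. i < n \<and> v ! i \<noteq> \<one>)"
  have ex: "\<exists>i. i < n \<and> v ! i \<noteq> \<one>"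
    using assms vecs_eqI[of v n "vone n"] by (metis vone_nth vone_vecs)
  have "i < n" "v ! i \<noteq> \<one>"
    using LeastI_ex[OF ex] by (simp_all add: i_def)
  moreover have "v ! j = \<one>" if "j < i" for j
    using not_less_Least[of j "\<lambda>i. i < n \<and> v ! i \<noteq> \<one>"] that \<open>i < n\<close> by (auto simp: i_def)
  ultimately show ?thesis using assms by (auto simp: leads_def vecs_length)
qed

section \<open>Normal forms with respect to a table\<close>

text \<open>The Schreier--Sims method for powers of a group: if the product of any two table entries has a
  normal form, then so has every product of normal forms, and the normal forms are a subgroup.\<close>

inductive nform :: "nat \<Rightarrow> 'a list set \<Rightarrow> nat \<Rightarrow> 'a list \<Rightarrow> bool" for n T where
  one: "nform n T j (vone n)"
| mult: "t \<in> T \<Longrightarrow> leads t i \<Longrightarrow> j \<le> i \<Longrightarrow> nform n T (Suc i) z \<Longrightarrow> nform n T j (vmul t z)"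

lemma nform_vecs: "nform n T j z \<Longrightarrow> T \<subseteq> vecs n \<Longrightarrow> z \<in> vecs n"
  by (induction rule: nform.induct) auto

lemma nform_prefix: "nform n T j z \<Longrightarrow> T \<subseteq> vecs n \<Longrightarrow> k < j \<Longrightarrow> k < n \<Longrightarrow> z ! k = \<one>"
proof (induction rule: nform.induct)
  case (mult t i j z)
  then have "t \<in> vecs n" "z \<in> vecs n" by (auto dest: nform_vecs)
  then show ?case using mult by (simp add: leads_def)
qed simp

lemma nform_antimono: "nform n T j z \<Longrightarrow> j' \<le> j \<Longrightarrow> nform n T j' z"
  by (cases rule: nform.cases) (auto intro: nform.intros)

lemma nform_mono: "nform n T j z \<Longrightarrow> T \<subseteq> T' \<Longrightarrow> nform n T' j z"
  by (induction rule: nform.induct) (auto intro: nform.intros)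

lemma nform_lead:
  assumes "T \<subseteq> vecs n" "t \<in> T" "leads t i" "nform n T (Suc i) z"
  shows "i < n" "vmul t z ! i = t ! i" "j < i \<Longrightarrow> vmul t z ! j = \<one>"
proof -
  have t: "t \<in> vecs n" and z: "z \<in> vecs n" using assms by (auto dest: nform_vecs)
  show i: "i < n" using assms t by (simp add: leads_def vecs_length)
  show "vmul t z ! i = t ! i"
    using t z i nform_prefix[OF assms(4,1), of i] by (simp add: vecs_nth)
  show "vmul t z ! j = \<one>" if "j < i"
    using t z i nform_prefix[OF assms(4,1), of j] that assms(3) by (simp add: leads_def)
qed

text \<open>If the first factor led at some \<open>i < l\<close>, its leading value would survive in
  \<open>z\<close>, because the rest of the product is trivial at \<open>i\<close>.\<close>

lemma nform_raise:
  assumes "nform n T j z" "T \<subseteq> vecs n" "\<And>k. k < l \<Longrightarrow> k < n \<Longrightarrow> z ! k = \<one>"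
  shows "nform n T l z"
  using assms(1)
proof cases
  case one
  then show ?thesis by (simp add: nform.one)
next
  case (mult t i z')
  then have "\<not> i < l"
    using nform_lead[OF assms(2), of t i z'] assms(3)[of i] by (auto simp: leads_def)
  then show ?thesis using mult by (auto intro: nform.mult)
qed

lemma nform_cases_level:
  assumes "nform n T j z"
  obtains "nform n T (Suc j) z"
  | t z' where "t \<in> T" "leads t j" "nform n T (Suc j) z'" "z = vmul t z'"
  using assms
proof cases
  case one
  then show ?thesis using that(1) nform.one by blast
next
  case (mult t i z')
  then show ?thesis using that nform.mult[of t T i "Suc j"] by (cases "i = j") auto
qed

context
  fixes n :: nat and T :: "'a list set"
  assumes T: "T \<subseteq> vecs n" and closed: "\<And>s t. s \<in> T \<Longrightarrow> t \<in> T \<Longrightarrow> nform n T 0 (vmul s t)"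
begin

text \<open>Moves an entry leading at \<open>j\<close> to the left of a normal form. Left
  multiplication by an entry leading beyond \<open>j\<close> changes nothing up to \<open>j\<close>,
  so the normal form that \<open>closed\<close> gives for a product of two entries again begins with
  an entry leading at \<open>j\<close>. The remainders live at level \<open>Suc j\<close>, where
  \<open>IH\<close> multiplies them.\<close>

lemma nform_push:
  assumes IH: "\<And>u v. nform n T (Suc j) u \<Longrightarrow> nform n T (Suc j) v \<Longrightarrow> nform n T (Suc j) (vmul u v)"
    and m: "nform n T l m" "Suc j \<le> l" and t: "t \<in> T" "leads t j"
  shows "\<exists>t'\<in>T. \<exists>z. leads t' j \<and> nform n T (Suc j) z \<and> vmul m t = vmul t' z"
  using m
proof (induction rule: nform.induct)
  case (one l)
  then show ?case
    using t T by (auto intro!: bexI[of _ t] exI[of _ "vone n"] nform.one simp: vone_vmul vmul_vone subsetD)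
next
  case (mult s i l z)
  then obtain t' z' where t': "t' \<in> T" "leads t' j" "nform n T (Suc j) z'" "vmul z t = vmul t' z'"
    by auto
  have vec: "s \<in> vecs n" "t' \<in> vecs n" "z \<in> vecs n" "z' \<in> vecs n" "t \<in> vecs n"
    using mult t' t T by (auto dest: nform_vecs)
  have jn: "j < n" using t' vec by (simp add: leads_def vecs_length)
  have entries: "vmul s t' ! j = t' ! j" "\<And>k. k < j \<Longrightarrow> vmul s t' ! k = \<one>"
    using vec jn mult t' by (auto simp: leads_def vecs_nth)
  have "nform n T j (vmul s t')"
    by (rule nform_raise[OF closed[OF mult(1) t'(1)] T]) (use entries in auto)
  then obtain t'' z'' where t'': "t'' \<in> T" "leads t'' j" "nform n T (Suc j) z''" "vmul s t' = vmul t'' z''"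
  proof (cases rule: nform_cases_level)
    case 1
    then show ?thesis using nform_prefix[OF 1 T, of j] entries jn t' by (auto simp: leads_def)
  qed blast
  have vec'': "t'' \<in> vecs n" "z'' \<in> vecs n" using t'' T by (auto dest: nform_vecs)
  have "vmul (vmul s z) t = vmul (vmul s t') z'"
    using vec t'(4) by (simp add: vmul_assoc[of _ n])
  also have "\<dots> = vmul t'' (vmul z'' z')"
    using vec vec'' t''(4) by (simp add: vmul_assoc[of _ n])
  finally show ?case using t'' IH[OF t''(3) t'(3)] by blast
qed

text \<open>Induction on the number \<open>n - j\<close> of coordinates still free. A left factor
  from level \<open>Suc j\<close> passes the leading entry of \<open>v\<close> by
  \<open>nform_push\<close>; a leading entry of \<open>u\<close> is then multiplied with a leading
  entry by \<open>closed\<close>.\<close>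

lemma nform_vmul: "nform n T j u \<Longrightarrow> nform n T j v \<Longrightarrow> nform n T j (vmul u v)"
proof (induction "n - j" arbitrary: j u v)
  case 0
  have eq: "z = vone n" if "nform n T j z" for z
    using 0(1) by (intro vecs_eqI[OF nform_vecs[OF that T] vone_vecs])
      (use nform_prefix[OF that T] in auto)
  show ?case using eq[OF 0(2)] eq[OF 0(3)] by (simp add: vone_vmul nform.one)
next
  case (Suc d)
  have IH: "nform n T (Suc j) (vmul u v)" if "nform n T (Suc j) u" "nform n T (Suc j) v" for u v
    using Suc(1)[of "Suc j"] Suc(2) that by simp
  have low: "nform n T j z" if "nform n T (Suc j) z" for z using that by (rule nform_antimono) simp
  have left: "nform n T j (vmul m v)" if m: "nform n T (Suc j) m" and v: "nform n T j v" for m v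
    using v
  proof (cases rule: nform_cases_level)
    case 1
    then show ?thesis using IH[OF m] low by blast
  next
    case (2 t z)
    obtain t' z' where t': "t' \<in> T" "leads t' j" "nform n T (Suc j) z'" "vmul m t = vmul t' z'"
      using nform_push[OF IH m order_refl 2(1,2)] by blast
    have vec: "m \<in> vecs n" "t \<in> vecs n" "z \<in> vecs n" "t' \<in> vecs n" "z' \<in> vecs n"
      using 2 t' m T by (auto dest: nform_vecs)
    have "vmul m v = vmul (vmul m t) z" using vec 2(4) by (simp add: vmul_assoc[of _ n])
    also have "\<dots> = vmul t' (vmul z' z)" using vec t'(4) by (simp add: vmul_assoc[of _ n])
    finally have "vmul m v = vmul t' (vmul z' z)" .
    then show ?thesis using nform.mult[OF t'(1,2) order_refl IH[OF t'(3) 2(3)]] by simp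
  qed
  show ?case using Suc.prems(1)
  proof (cases rule: nform_cases_level)
    case 1
    then show ?thesis using left Suc.prems(2) by blast
  next
    case (2 s m)
    \<comment> \<open>Applied later to \<open>w = vmul m v\<close>, which \<open>left\<close> has
      brought into normal form, so that only a single entry remains to be multiplied from the
      left.\<close>
    have prod: "nform n T j (vmul s w)" if w: "nform n T j w" for w
      using w
    proof (cases rule: nform_cases_level)
      case 1
      then show ?thesis using nform.mult[OF 2(1,2) order_refl] by blast
    next
      case w: (2 t z)
      have vec: "s \<in> vecs n" "t \<in> vecs n" "z \<in> vecs n" using 2 w T by (auto dest: nform_vecs)
      have "nform n T j (vmul s t)"
        by (rule nform_raise[OF closed[OF 2(1) w(1)] T])
          (use vec 2(2) w(2) in \<open>simp add: leads_def vecs_length\<close>)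
      then have "nform n T j (vmul (vmul s t) z)"
      proof (cases rule: nform_cases_level)
        case 1
        then show ?thesis using IH[OF 1 w(3)] low by blast
      next
        case (2 t' z')
        have "t' \<in> vecs n" "z' \<in> vecs n" using 2 T by (auto dest: nform_vecs)
        then have "vmul (vmul s t) z = vmul t' (vmul z' z)"
          using 2 vec by (simp add: vmul_assoc[of _ n])
        then show ?thesis using nform.mult[OF 2(1,2) order_refl IH[OF 2(3) w(3)]] by simp
      qed
      then show ?thesis using vec w(4) by (simp add: vmul_assoc[of _ n])
    qed
    have "s \<in> vecs n" "m \<in> vecs n" "v \<in> vecs n"
      using 2 Suc.prems(2) T by (auto dest: nform_vecs)
    then have "vmul u v = vmul s (vmul m v)"
      using 2 by (simp add: vmul_assoc[of _ n])
    then show ?thesis using prod[OF left[OF 2(3) Suc.prems(2)]] by simp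
  qed
qed

lemma vsubgroup_nform: "vsubgroup n {z. nform n T 0 z}"
  using nform_vmul nform_vecs[OF _ T] by (auto simp: vsubgroup_def nform.one)

end

section \<open>Sifting\<close>

definition reduce :: "'a list list \<Rightarrow> 'a list \<Rightarrow> 'a list" where
  "reduce T g = fold (\<lambda>t g. if same_lead t g then vdiv t g else g) T g"

text \<open>The list \<open>g\<close> is a loop counter of length \<open>n\<close>. Several passes
  are made because one pass may miss an entry that stands before the one whose division exposes the
  matching lead.\<close>

definition sift :: "'a list list \<Rightarrow> 'a list \<Rightarrow> 'a list" where
  "sift T g = fold (\<lambda>_. reduce T) g g"

definition ins :: "'a list \<Rightarrow> 'a list list \<Rightarrow> 'a list list" where
  "ins g T = (if \<forall>a\<in>set (sift T g). a = \<one> then T else sift T g # T)"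

definition saturate :: "'a list list \<Rightarrow> 'a list list" where
  "saturate T = fold ins (concat (map (\<lambda>s. map (vmul s) T) T)) T"

text \<open>Only the length of \<open>us\<close> matters, as the number of saturation rounds; a list
  that the program has at hand anyway avoids counting.\<close>

definition table :: "'c list \<Rightarrow> 'a list list \<Rightarrow> 'a list list" where
  "table us gens = fold (\<lambda>_. saturate) us (fold ins gens [])"

definition vdiv_closed :: "'a list set \<Rightarrow> bool" where
  "vdiv_closed S \<longleftrightarrow> (\<forall>u\<in>S. \<forall>v\<in>S. vdiv u v \<in> S)"

lemma reduce_closed: "vdiv_closed S \<Longrightarrow> set T \<subseteq> S \<Longrightarrow> g \<in> S \<Longrightarrow> reduce T g \<in> S"
  unfolding reduce_def by (induction T arbitrary: g) (auto simp: vdiv_closed_def)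

lemma vdiv_closed_vecs: "vdiv_closed (vecs n)"
  by (simp add: vdiv_closed_def)

lemma reduce_vecs: "set T \<subseteq> vecs n \<Longrightarrow> g \<in> vecs n \<Longrightarrow> reduce T g \<in> vecs n"
  by (rule reduce_closed[OF vdiv_closed_vecs])

lemma iterate_closed:
  "(\<And>g. g \<in> S \<Longrightarrow> f g \<in> S) \<Longrightarrow> g \<in> S \<Longrightarrow> fold (\<lambda>_. f) xs g \<in> S"
  by (induction xs arbitrary: g) auto

lemma sift_closed: "vdiv_closed S \<Longrightarrow> set T \<subseteq> S \<Longrightarrow> g \<in> S \<Longrightarrow> sift T g \<in> S"
  unfolding sift_def by (rule iterate_closed) (auto intro: reduce_closed)

lemma sift_vecs: "set T \<subseteq> vecs n \<Longrightarrow> g \<in> vecs n \<Longrightarrow> sift T g \<in> vecs n"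
  by (rule sift_closed[OF vdiv_closed_vecs])

definition trivial_below :: "nat \<Rightarrow> 'a list \<Rightarrow> bool" where
  "trivial_below i g \<longleftrightarrow> (\<forall>j<i. g ! j = \<one>)"

text \<open>The common leading value cancels and both vectors are trivial before it, so a division
  never spoils a trivial prefix.\<close>

lemma same_lead_vdiv:
  assumes "t \<in> vecs n" "g \<in> vecs n" "same_lead t g" "trivial_below i g" "i \<le> n"
  shows "trivial_below i (vdiv t g)"
    and "i < n \<Longrightarrow> g ! i \<noteq> \<one> \<Longrightarrow> trivial_below (Suc i) (vdiv t g)"
proof -
  obtain k where k: "leads t k" "leads g k" "t ! k = g ! k"
    using assms(3) by (auto simp: same_lead_def)
  have "i \<le> k" using k assms(4) by (meson leads_def trivial_below_def not_le)
  then show "trivial_below i (vdiv t g)"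
    using assms k by (auto simp: trivial_below_def leads_def)
  assume i: "i < n" "g ! i \<noteq> \<one>"
  then have "leads g i" using assms by (auto simp: leads_def trivial_below_def vecs_length)
  then have "k = i" using leads_unique k by blast
  then show "trivial_below (Suc i) (vdiv t g)"
    using assms k i by (auto simp: trivial_below_def leads_def less_Suc_eq vecs_nth)
qed

lemma reduce_trivial_below:
  assumes "set T \<subseteq> vecs n" "g \<in> vecs n" "trivial_below i g" "i \<le> n"
  shows "trivial_below i (reduce T g)"
  using assms
proof (induction T arbitrary: g)
  case (Cons t T)
  have "t \<in> vecs n" using Cons.prems by simp
  then show ?case
    using Cons same_lead_vdiv(1)[of t n g i] by (simp add: reduce_def)
qed (simp add: reduce_def)

lemma reduce_stuck: "\<forall>t\<in>set T. \<not> same_lead t g \<Longrightarrow> reduce T g = g"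
  unfolding reduce_def by (induction T) auto

text \<open>The first entry sharing the lead of \<open>g\<close> clears position \<open>i\<close>;
  the rest of the pass cannot undo this by \<open>reduce_trivial_below\<close>.\<close>

lemma reduce_progress:
  assumes "set T \<subseteq> vecs n" "g \<in> vecs n" "trivial_below i g" "i < n" "g ! i \<noteq> \<one>"
    and "t \<in> set T" "same_lead t g"
  shows "trivial_below (Suc i) (reduce T g)"
  using assms
proof (induction T)
  case (Cons s T)
  show ?case
  proof (cases "same_lead s g")
    case True
    have "trivial_below (Suc i) (vdiv s g)"
      using same_lead_vdiv(2)[of s n g i] True Cons.prems by simp
    then have "trivial_below (Suc i) (reduce T (vdiv s g))"
      using Cons.prems by (intro reduce_trivial_below) auto
    then show ?thesis using True by (simp add: reduce_def)
  next
    case False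
    then show ?thesis using Cons by (auto simp: reduce_def)
  qed
qed simp

lemma sift_stuck:
  assumes "set T \<subseteq> vecs n" "g \<in> vecs n" "t \<in> set T"
  shows "\<not> same_lead t (sift T g)"
proof -
  let ?f = "\<lambda>ys :: 'a list. fold (\<lambda>_. reduce T) ys g"
  have vec: "?f ys \<in> vecs n" for ys
    by (rule iterate_closed) (use assms reduce_vecs in auto)
  \<comment> \<open>Each round finds nothing to divide by or leaves one more coordinate trivial.
    After \<open>n\<close> rounds the vector is stuck or trivial, and the trivial vector has no
    lead.\<close>
  have "trivial_below (min n (length ys)) (?f ys) \<or> (\<forall>t\<in>set T. \<not> same_lead t (?f ys))" for ys
  proof (induction ys rule: rev_induct)
    case (snoc y ys)
    show ?case
    proof (cases "\<forall>t\<in>set T. \<not> same_lead t (?f ys)")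
      case True
      then show ?thesis using reduce_stuck[OF True] by simp
    next
      case False
      then obtain t where t: "t \<in> set T" "same_lead t (?f ys)" by blast
      let ?i = "min n (length ys)"
      have triv: "trivial_below ?i (?f ys)" using snoc False by blast
      have keep: "trivial_below ?i (reduce T (?f ys))"
        by (rule reduce_trivial_below[OF assms(1) vec triv]) simp
      have "trivial_below (Suc ?i) (reduce T (?f ys))" if "?i < n"
      proof (cases "?f ys ! ?i = \<one>")
        case True
        then have "trivial_below (Suc ?i) (?f ys)" using triv by (auto simp: trivial_below_def less_Suc_eq)
        then show ?thesis using that by (intro reduce_trivial_below[OF assms(1) vec]) auto
      next
        case False
        then show ?thesis using reduce_progress[OF assms(1) vec triv that _ t] by blast
      qed
      then have "trivial_below (min n (length (ys @ [y]))) (reduce T (?f ys))"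
        using keep by (cases "length ys < n") (auto simp: min_def le_Suc_eq not_less)
      then show ?thesis by simp
    qed
  qed (simp add: trivial_below_def)
  from this[of g] have "trivial_below n (sift T g) \<or> (\<forall>t\<in>set T. \<not> same_lead t (sift T g))"
    using assms by (simp add: sift_def vecs_length)
  then show ?thesis
    using assms sift_vecs[OF assms(1,2)]
    by (auto simp: same_lead_def leads_def trivial_below_def vecs_length)
qed

text \<open>The quotient is trivial up to and including the common leading position
  \<open>k\<close>, so its normal form starts beyond \<open>k\<close> and can be prefixed by
  \<open>t\<close>.\<close>

lemma nform_same_lead:
  assumes "T \<subseteq> vecs n" "t \<in> T" "g \<in> vecs n" "same_lead t g" "nform n T 0 (vdiv t g)"
  shows "nform n T 0 g"
proof -
  obtain k where k: "leads t k" "leads g k" "t ! k = g ! k"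
    using assms(4) by (auto simp: same_lead_def)
  have t: "t \<in> vecs n" using assms by blast
  have "trivial_below (Suc k) (vdiv t g)"
    using k t assms by (intro same_lead_vdiv(2)[of _ n]) (auto simp: leads_def trivial_below_def vecs_length)
  then have "nform n T (Suc k) (vdiv t g)"
    by (intro nform_raise[OF assms(5,1)]) (auto simp: trivial_below_def)
  from nform.mult[OF assms(2) k(1) le0 this] show ?thesis
    using vmul_vdiv[OF t assms(3)] by simp
qed

lemma nform_reduce:
  assumes "set T \<subseteq> T'" "T' \<subseteq> vecs n" "g \<in> vecs n" "nform n T' 0 (reduce T g)"
  shows "nform n T' 0 g"
  using assms
proof (induction T arbitrary: g)
  case (Cons t T)
  have t: "t \<in> vecs n" using Cons by auto
  show ?case
  proof (cases "same_lead t g")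
    case True
    then have "nform n T' 0 (vdiv t g)" using Cons t by (auto simp: reduce_def)
    then show ?thesis using nform_same_lead[of T' n t g] True Cons.prems by auto
  qed (use Cons in \<open>auto simp: reduce_def\<close>)
qed (simp add: reduce_def)

text \<open>Sifting is undone one division at a time. \<open>T'\<close> is kept apart from
  \<open>T\<close> because the residue is added to the table before its normal form is used.\<close>

lemma nform_sift:
  assumes "set T \<subseteq> T'" "T' \<subseteq> vecs n" "g \<in> vecs n" "nform n T' 0 (sift T g)"
  shows "nform n T' 0 g"
proof -
  have "nform n T' 0 (fold (\<lambda>_. reduce T) ys g) \<Longrightarrow> g \<in> vecs n \<Longrightarrow> nform n T' 0 g" for ys :: "'a list" and g
  proof (induction ys arbitrary: g)
    case (Cons y ys)
    have "reduce T g \<in> vecs n" using assms(1,2) Cons.prems(2) by (intro reduce_vecs) auto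
    then have "nform n T' 0 (reduce T g)" using Cons by simp
    then show ?case using nform_reduce[OF assms(1,2)] Cons.prems(2) by blast
  qed simp
  then show ?thesis using assms by (simp add: sift_def)
qed

text \<open>Distinct positions and values of leading entries bound the length of a table.\<close>

definition table_inv :: "nat \<Rightarrow> 'a list list \<Rightarrow> bool" where
  "table_inv n T \<longleftrightarrow> set T \<subseteq> vecs n \<and> vone n \<notin> set T \<and>
     (\<forall>i j. i < length T \<longrightarrow> j < length T \<longrightarrow> same_lead (T ! i) (T ! j) \<longrightarrow> i = j)"

lemma table_inv_vecs: "table_inv n T \<Longrightarrow> set T \<subseteq> vecs n"
  by (simp add: table_inv_def)

lemma table_inv_Nil: "table_inv n []"
  by (simp add: table_inv_def)

lemma same_lead_sym: "same_lead s t \<longleftrightarrow> same_lead t s"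
  by (auto simp: same_lead_def)

lemma table_inv_length:
  assumes "table_inv n T"
  shows "length T \<le> n * order G"
proof -
  define key where "key i = (let k = (THE k. leads (T ! i) k) in (k, T ! i ! k))" for i
  have key: "\<exists>k<n. leads (T ! i) k \<and> key i = (k, T ! i ! k)" if i: "i < length T" for i
  proof -
    have "T ! i \<in> set T" using i by simp
    then have "T ! i \<in> vecs n" "T ! i \<noteq> vone n" using assms unfolding table_inv_def by auto
    then obtain k where k: "k < n" "leads (T ! i) k" using leads_exists by blast
    then have "(THE k. leads (T ! i) k) = k" using leads_unique by blast
    then show ?thesis using k by (auto simp: key_def)
  qed
  have "inj_on key {..<length T}"
  proof (rule inj_onI)
    fix i j assume ij: "i \<in> {..<length T}" "j \<in> {..<length T}" "key i = key j"
    then have "same_lead (T ! i) (T ! j)"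
      using key[of i] key[of j] by (auto simp: same_lead_def)
    then show "i = j" using assms ij by (simp add: table_inv_def)
  qed
  moreover have "key ` {..<length T} \<subseteq> {..<n} \<times> carrier G"
  proof (rule image_subsetI)
    fix i assume i: "i \<in> {..<length T}"
    have "T ! i \<in> vecs n" using assms i by (auto simp: table_inv_def)
    then show "key i \<in> {..<n} \<times> carrier G" using key[of i] i by (auto simp: vecs_nth)
  qed
  ultimately have "card {..<length T} \<le> card ({..<n} \<times> carrier G)"
    using finite_carrier by (intro card_inj_on_le[of key]) auto
  then show ?thesis by (simp add: card_cartesian_product order_def)
qed

lemma ins_trivial_iff: "v \<in> vecs n \<Longrightarrow> (\<forall>a\<in>set v. a = \<one>) \<longleftrightarrow> v = vone n"
  by (auto simp: vone_def vecs_length intro: replicate_eqI)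

lemma ins_vecs_eq: "set T \<subseteq> vecs n \<Longrightarrow> g \<in> vecs n \<Longrightarrow>
    ins g T = (if sift T g = vone n then T else sift T g # T)"
  unfolding ins_def by (simp add: ins_trivial_iff[OF sift_vecs])

text \<open>A nontrivial residue shares its lead with no entry, so the leads stay distinct. Once it
  is an entry it has an obvious normal form, and undoing the sift yields one for
  \<open>g\<close>.\<close>

lemma ins_props:
  assumes "table_inv n T" "g \<in> vecs n"
  shows "table_inv n (ins g T)" "\<exists>ys. ins g T = ys @ T" "nform n (set (ins g T)) 0 g"
proof -
  have T: "set T \<subseteq> vecs n" using assms(1) by (rule table_inv_vecs)
  let ?s = "sift T g"
  have s: "?s \<in> vecs n" using sift_vecs[OF T assms(2)] .
  have eq: "ins g T = (if ?s = vone n then T else ?s # T)" by (rule ins_vecs_eq[OF T assms(2)])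
  show "\<exists>ys. ins g T = ys @ T" by (simp add: eq)
  have "table_inv n (?s # T)" if "?s \<noteq> vone n"
  proof -
    have ns: "\<not> same_lead (T ! i) ?s" "\<not> same_lead ?s (T ! i)" if "i < length T" for i
      using sift_stuck[OF T assms(2), of "T ! i"] that same_lead_sym by auto
    show ?thesis
      unfolding table_inv_def
      using assms(1) that s ns by (auto simp: table_inv_def nth_Cons split: nat.splits)
  qed
  then show inv: "table_inv n (ins g T)" using assms(1) by (simp add: eq)
  have "nform n (set (ins g T)) 0 ?s"
  proof (cases "?s = vone n")
    case False
    then obtain k where "leads ?s k" using leads_exists[OF s] by blast
    then have "nform n (set (ins g T)) 0 (vmul ?s (vone n))"
      using False by (intro nform.mult[of _ _ k] nform.one) (auto simp: eq)
    then show ?thesis by (simp add: vmul_vone[OF s])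
  qed (simp add: nform.one)
  then show "nform n (set (ins g T)) 0 g"
    by (rule nform_sift[of T, rotated 3]) (use table_inv_vecs[OF inv] assms in \<open>simp_all add: eq subset_insertI\<close>)
qed

lemma ins_closed: "vdiv_closed S \<Longrightarrow> set T \<subseteq> S \<Longrightarrow> g \<in> S \<Longrightarrow> set (ins g T) \<subseteq> S"
  using sift_closed[of S T g] by (auto simp: ins_def)

lemma fold_ins_props:
  assumes "table_inv n T" "set gs \<subseteq> vecs n"
  shows "table_inv n (fold ins gs T)" "\<exists>ys. fold ins gs T = ys @ T"
    "g \<in> set gs \<Longrightarrow> nform n (set (fold ins gs T)) 0 g"
proof -
  have "table_inv n (fold ins gs T) \<and> (\<exists>ys. fold ins gs T = ys @ T) \<and>
    (\<forall>g\<in>set gs. nform n (set (fold ins gs T)) 0 g)"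
    using assms
  proof (induction gs arbitrary: T)
    case (Cons g gs)
    have g: "g \<in> vecs n" using Cons.prems by simp
    note i = ins_props[OF Cons.prems(1) g]
    have IH: "table_inv n (fold ins gs (ins g T))" "\<exists>ys. fold ins gs (ins g T) = ys @ ins g T"
      "\<forall>u\<in>set gs. nform n (set (fold ins gs (ins g T))) 0 u"
      using Cons.IH[OF i(1)] Cons.prems by simp_all
    moreover have "nform n (set (fold ins gs (ins g T))) 0 g"
      using nform_mono[OF i(3), of "set (fold ins gs (ins g T))"] IH(2) by (metis Un_upper2 set_append)
    moreover have "\<exists>ys. fold ins gs (ins g T) = ys @ T" using IH(2) i(2) by (metis append_assoc)
    ultimately show ?case by simp
  qed simp
  then show "table_inv n (fold ins gs T)" "\<exists>ys. fold ins gs T = ys @ T"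
    "g \<in> set gs \<Longrightarrow> nform n (set (fold ins gs T)) 0 g" by blast+
qed

lemma fold_ins_closed:
  "vdiv_closed S \<Longrightarrow> set T \<subseteq> S \<Longrightarrow> set gs \<subseteq> S \<Longrightarrow> set (fold ins gs T) \<subseteq> S"
  by (induction gs arbitrary: T) (use ins_closed in auto)

lemma products_vecs:
  "set T \<subseteq> vecs n \<Longrightarrow> set (concat (map (\<lambda>s. map (vmul s) T) T)) \<subseteq> vecs n"
  by (auto intro!: vmul_vecs)

lemma saturate_props:
  assumes "table_inv n T"
  shows "table_inv n (saturate T)" "\<exists>ys. saturate T = ys @ T"
    "s \<in> set T \<Longrightarrow> t \<in> set T \<Longrightarrow> nform n (set (saturate T)) 0 (vmul s t)"
  unfolding saturate_def
  by (rule fold_ins_props[OF assms products_vecs[OF table_inv_vecs[OF assms]]]; auto)+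

lemma saturate_closed:
  "vdiv_closed S \<Longrightarrow> (\<And>u v. u \<in> S \<Longrightarrow> v \<in> S \<Longrightarrow> vmul u v \<in> S) \<Longrightarrow> set T \<subseteq> S \<Longrightarrow>
    set (saturate T) \<subseteq> S"
  unfolding saturate_def by (rule fold_ins_closed) auto

text \<open>Until a fixed point is reached every round lengthens the table. Together with
  \<open>table_inv_length\<close> this shows that \<open>n * order G\<close> rounds are
  enough.\<close>

lemma saturate_iterate:
  fixes us :: "'c list"
  assumes "table_inv n T"
  shows "table_inv n (fold (\<lambda>_. saturate) us T) \<and> (\<exists>ys. fold (\<lambda>_. saturate) us T = ys @ T) \<and>
    (saturate (fold (\<lambda>_. saturate) us T) = fold (\<lambda>_. saturate) us T \<or>
     length us < length (saturate (fold (\<lambda>_. saturate) us T)))"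
proof (induction us rule: rev_induct)
  case Nil
  show ?case using saturate_props(2)[OF assms] assms by auto
next
  case (snoc u us)
  let ?T = "fold (\<lambda>_. saturate) us T"
  have inv: "table_inv n ?T" using snoc by blast
  have inv': "table_inv n (saturate ?T)" by (rule saturate_props(1)[OF inv])
  obtain ys where ys: "saturate ?T = ys @ ?T" using saturate_props(2)[OF inv] by blast
  obtain zs where zs: "saturate (saturate ?T) = zs @ saturate ?T" using saturate_props(2)[OF inv'] by blast
  have "saturate (saturate ?T) = saturate ?T \<or> length (u # us) < length (saturate (saturate ?T))"
  proof (cases "saturate ?T = ?T")
    case False
    then have "length us < length (saturate ?T)" using snoc by blast
    then show ?thesis using zs by (cases zs) auto
  qed simp
  then show ?case using inv' snoc ys by auto
qed

lemma table_props:
  assumes gens: "set gens \<subseteq> vecs n" and us: "n * order G \<le> length us"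
  shows "table_inv n (table us gens)"
    and "vsubgroup n {z. nform n (set (table us gens)) 0 z}"
    and "g \<in> set gens \<Longrightarrow> nform n (set (table us gens)) 0 g"
proof -
  let ?I = "fold ins gens []" and ?T = "table us gens"
  have T0: "table_inv n ?I" by (rule fold_ins_props[OF table_inv_Nil gens])
  have it: "table_inv n ?T" "\<exists>ys. ?T = ys @ ?I"
    "saturate ?T = ?T \<or> length us < length (saturate ?T)"
    using saturate_iterate[OF T0, of us] by (simp_all add: table_def)
  show "table_inv n (table us gens)" using it(1) by this
  have "length (saturate ?T) \<le> n * order G"
    by (rule table_inv_length[OF saturate_props(1)[OF it(1)]])
  then have stable: "saturate ?T = ?T" using it(3) us by linarith
  show "vsubgroup n {z. nform n (set ?T) 0 z}"
    by (rule vsubgroup_nform[OF table_inv_vecs[OF it(1)]]) (use saturate_props(3)[OF it(1)] stable in simp)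
  show "nform n (set ?T) 0 g" if "g \<in> set gens"
    using nform_mono[OF fold_ins_props(3)[OF table_inv_Nil gens that]] it(2) by auto
qed

text \<open>Bounds the generated subgroup from above, since entries arise by products and quotients
  only. With \<open>S\<close> the vectors that agree with an element of \<open>H\<close> outside
  \<open>U\<close>, this brings in the size of \<open>H\<close>.\<close>

lemma table_closed:
  assumes "vdiv_closed S" "\<And>u v. u \<in> S \<Longrightarrow> v \<in> S \<Longrightarrow> vmul u v \<in> S" "set gens \<subseteq> S"
  shows "set (table us gens) \<subseteq> S"
proof -
  have "fold (\<lambda>_. saturate) us (fold ins gens []) \<in> {T. set T \<subseteq> S}"
    by (rule iterate_closed) (use assms saturate_closed fold_ins_closed[of S "[]"] in auto)
  then show ?thesis by (simp add: table_def)
qed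

lemma nform_closed:
  assumes "T \<subseteq> S" "vone n \<in> S" "\<And>u v. u \<in> S \<Longrightarrow> v \<in> S \<Longrightarrow> vmul u v \<in> S" "nform n T j z"
  shows "z \<in> S"
  using assms(4) by (induction rule: nform.induct) (use assms in auto)

end

context coded_group begin

section \<open>Greedy choice of coordinates\<close>

text \<open>A nontrivial first element makes \<open>hd (unit_list n i)\<close> a marker of position
  \<open>i\<close>.\<close>

definition els :: "'a list" where
  "els = (SOME xs. set xs = carrier G \<and> distinct xs \<and> xs \<noteq> [] \<and> hd xs \<noteq> \<one>)"

lemma els: "set els = carrier G" "distinct els" "els \<noteq> []" "hd els \<noteq> \<one>"
proof -
  have "carrier G \<noteq> {\<one>}" using order_ge_2 by (auto simp: order_def)
  then obtain a where a: "a \<in> carrier G" "a \<noteq> \<one>" using one_closed by blast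
  obtain ys where ys: "set ys = carrier G - {a}" "distinct ys"
    using finite_distinct_list[of "carrier G - {a}"] finite_carrier by auto
  have "\<exists>xs. set xs = carrier G \<and> distinct xs \<and> xs \<noteq> [] \<and> hd xs \<noteq> \<one>"
    by (rule exI[of _ "a # ys"]) (use a ys in auto)
  from someI_ex[OF this] show "set els = carrier G" "distinct els" "els \<noteq> []" "hd els \<noteq> \<one>"
    unfolding els_def by blast+
qed

lemma length_els: "length els = order G"
  using distinct_card[OF els(2)] els(1) by (simp add: order_def)

lemma hd_els_carrier: "hd els \<in> carrier G"
  using hd_in_set[OF els(3)] els(1) by simp

definition unit :: "nat \<Rightarrow> nat \<Rightarrow> 'a \<Rightarrow> 'a list" where
  "unit n i a = (vone n)[i := a]"

definition unit_list :: "nat \<Rightarrow> nat \<Rightarrow> 'a list list" where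
  "unit_list n i = map (unit n i) els"

lemma unit_vecs: "a \<in> carrier G \<Longrightarrow> unit n i a \<in> vecs n"
  by (cases "i < n") (auto intro!: vecsI simp: unit_def vecs_length nth_list_update vone_def)

lemma unit_nth: "j < n \<Longrightarrow> unit n i a ! j = (if i = j then a else \<one>)"
  by (simp add: unit_def nth_list_update vone_def)

lemma set_unit_list: "set (unit_list n i) = unit n i ` carrier G"
  by (simp add: unit_list_def els)

lemma hd_unit_list: "hd (unit_list n i) = unit n i (hd els)"
  by (simp add: unit_list_def hd_map els)

text \<open>The marker m is supported at the current position; it spares the programs any indexing.\<close>

definition alive :: "'a list \<Rightarrow> 'a list \<Rightarrow> bool" where
  "alive m w \<longleftrightarrow> (\<forall>p\<in>set (zip m w). fst p = \<one> \<or> snd p = \<one>)"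

definition advance :: "'a list list \<times> 'a list \<Rightarrow> 'a list \<Rightarrow> 'a list" where
  "advance E u = reduce (fst E) (vmul (snd E) u)"

text \<open>An entry is a table of a subgroup and a vector in the coset of the point chosen so far, reduced by the
  table. If some choices kill an entry then at least half of them do, by Lagrange, so
  doubling the survivors does not increase the average length of the new list.\<close>

definition step_entry :: "'a list list \<Rightarrow> 'a list \<Rightarrow> 'a list list \<times> 'a list \<Rightarrow> ('a list list \<times> 'a list) list" where
  "step_entry ul u E =
     (if alive (hd ul) (advance E u)
      then if \<forall>v\<in>set ul. alive (hd ul) (advance E v)
           then [(fst E, advance E u)] else [(fst E, advance E u), (fst E, advance E u)]
      else [])"

definition step_entries ::
  "'a list list \<Rightarrow> ('a list list \<times> 'a list) list \<Rightarrow> 'a list \<Rightarrow> ('a list list \<times> 'a list) list" where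
  "step_entries ul L u = concat (map (step_entry ul u) L)"

definition better where
  "better ul L u B =
     (if length (step_entries ul L u) \<le> length (fst B) then (step_entries ul L u, u) else B)"

definition choose_unit where
  "choose_unit ul L = fold (better ul L) ul (step_entries ul L (hd ul), hd ul)"

definition choose_step where
  "choose_step ul S = (let B = choose_unit ul (fst S) in (fst B, vmul (snd S) (snd B)))"

section \<open>Levels of a table and the fate of one subgroup in one step\<close>

definition good_table :: "nat \<Rightarrow> 'a list list \<Rightarrow> bool" where
  "good_table n T \<longleftrightarrow> table_inv n T \<and> vsubgroup n {z. nform n (set T) 0 z}"

text \<open>The values at \<open>i\<close> of those members of the table's subgroup that are trivial
  before \<open>i\<close>, as \<open>level_eq\<close> shows. If this is all of \<open>G\<close>, no
  choice at coordinate \<open>i\<close> can kill the subgroup.\<close>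

definition level :: "'a list list \<Rightarrow> nat \<Rightarrow> 'a set" where
  "level T i = insert \<one> {t ! i | t. t \<in> set T \<and> leads t i}"

lemma good_tableD:
  assumes "good_table n T"
  shows "set T \<subseteq> vecs n" "vsubgroup n {z. nform n (set T) 0 z}" "t \<in> set T \<Longrightarrow> nform n (set T) 0 t"
proof -
  show T: "set T \<subseteq> vecs n" using assms by (simp add: good_table_def table_inv_vecs)
  show "vsubgroup n {z. nform n (set T) 0 z}" using assms by (simp add: good_table_def)
  show "nform n (set T) 0 t" if t: "t \<in> set T"
  proof -
    have v: "t \<in> vecs n" "t \<noteq> vone n" using assms t by (auto simp: good_table_def table_inv_def)
    then obtain k where "leads t k" using leads_exists by blast
    then have "nform n (set T) 0 (vmul t (vone n))"
      using t by (intro nform.mult[of _ _ k] nform.one) auto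
    then show ?thesis by (simp add: vmul_vone[OF v(1)])
  qed
qed

text \<open>A member trivial before \<open>i\<close> has a normal form at level \<open>i\<close>,
  and the first factor of that form alone decides the value at \<open>i\<close>.\<close>

lemma level_eq:
  assumes T: "good_table n T" and i: "i < n"
  shows "level T i = {z ! i | z. nform n (set T) 0 z \<and> trivial_below i z}" (is "_ = ?R")
proof (intro equalityI subsetI)
  fix a assume "a \<in> level T i"
  then consider "a = \<one>" | t where "t \<in> set T" "leads t i" "a = t ! i" by (auto simp: level_def)
  then show "a \<in> ?R"
  proof cases
    case 1
    then show ?thesis using i
      by (auto intro!: exI[of _ "vone n"] nform.one simp: trivial_below_def)
  next
    case 2
    then show ?thesis using good_tableD(3)[OF T] by (auto simp: leads_def trivial_below_def)
  qed
next
  fix a assume "a \<in> ?R"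
  then obtain z where z: "nform n (set T) 0 z" "trivial_below i z" "a = z ! i" by auto
  have "nform n (set T) i z"
    using z by (intro nform_raise[OF z(1) good_tableD(1)[OF T]]) (auto simp: trivial_below_def)
  then show "a \<in> level T i"
  proof (cases rule: nform_cases_level)
    case 1
    then show ?thesis using nform_prefix[OF 1 good_tableD(1)[OF T], of i] i z by (simp add: level_def)
  next
    case (2 t z')
    then show ?thesis using nform_lead(2)[OF good_tableD(1)[OF T] 2(1,2,3)] z by (auto simp: level_def)
  qed
qed

lemma level_subgroup:
  assumes T: "good_table n T" and i: "i < n"
  shows "subgroup (level T i) G"
proof
  let ?M = "{z. nform n (set T) 0 z}"
  note M = good_tableD(2)[OF T]
  show "level T i \<subseteq> carrier G"
    using good_tableD(1)[OF T] i by (auto simp: level_def vecs_nth subsetD)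
  show "\<one> \<in> level T i" by (simp add: level_def)
  show "a \<otimes> b \<in> level T i" if ab: "a \<in> level T i" "b \<in> level T i" for a b
  proof -
    obtain y z where yz: "y \<in> ?M" "trivial_below i y" "a = y ! i" "z \<in> ?M" "trivial_below i z" "b = z ! i"
      using ab unfolding level_eq[OF T i] by blast
    have v: "y \<in> vecs n" "z \<in> vecs n" using vsubgroupD(1)[OF M] yz by blast+
    have "vmul y z \<in> ?M" by (rule vsubgroupD(3)[OF M yz(1,4)])
    moreover have "trivial_below i (vmul y z)" "vmul y z ! i = a \<otimes> b"
      using yz v i by (simp_all add: trivial_below_def vmul_nth[of _ n])
    ultimately show ?thesis unfolding level_eq[OF T i] mem_Collect_eq by metis
  qed
  show "inv a \<in> level T i" if ab: "a \<in> level T i" for a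
  proof -
    obtain y where y: "y \<in> ?M" "trivial_below i y" "a = y ! i"
      using ab unfolding level_eq[OF T i] by blast
    have v: "y \<in> vecs n" using vsubgroupD(1)[OF M] y by blast
    have "vdiv y (vone n) \<in> ?M" by (rule vsubgroup_vdiv[OF M y(1) vsubgroupD(2)[OF M]])
    moreover have "trivial_below i (vdiv y (vone n))" "vdiv y (vone n) ! i = inv a"
      using y v i by (simp_all add: trivial_below_def vdiv_nth[of _ n] vecs_nth)
    ultimately show ?thesis unfolding level_eq[OF T i] mem_Collect_eq by metis
  qed
qed

text \<open>Reduction multiplies by members of \<open>M\<close> on the left only, so it picks
  another representative of the same coset.\<close>

lemma reduce_vdiv:
  assumes M: "vsubgroup n M" and "set T \<subseteq> M" and "g \<in> vecs n"
  shows "\<exists>h\<in>M. reduce T g = vdiv h g"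
  using assms(2,3)
proof (induction T arbitrary: g)
  case Nil
  then show ?case
    using vsubgroupD(2)[OF M] vone_vdiv[OF Nil.prems(2)]
    by (intro bexI[of _ "vone n"]) (simp_all add: reduce_def)
next
  case (Cons t T)
  show ?case
  proof (cases "same_lead t g")
    case True
    have t: "t \<in> M" "t \<in> vecs n" using Cons.prems vsubgroupD(1)[OF M] by auto
    obtain h where h: "h \<in> M" "reduce T (vdiv t g) = vdiv h (vdiv t g)"
      using Cons.IH[of "vdiv t g"] Cons.prems t by auto
    have "vdiv h (vdiv t g) = vdiv (vmul t h) g"
      using vdiv_vmul_left[of t n h g] t vsubgroupD(1)[OF M h(1)] Cons.prems by simp
    then show ?thesis
      using h True vsubgroupD(3)[OF M t(1) h(1)] by (auto simp: reduce_def)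
  next
    case False
    then show ?thesis using Cons by (auto simp: reduce_def)
  qed
qed

lemma alive_unit:
  assumes "w \<in> vecs n" "i < n"
  shows "alive (hd (unit_list n i)) w \<longleftrightarrow> w ! i = \<one>"
proof -
  have l: "length (unit n i (hd els)) = n" using unit_vecs[OF hd_els_carrier] by (rule vecs_length)
  show ?thesis
    using assms els(4) l
    by (auto simp: alive_def all_set_conv_all_nth hd_unit_list vecs_length unit_nth)
qed

text \<open>The value to be cancelled at \<open>i\<close> is \<open>w ! i \<otimes> a\<close>.
  Everything before \<open>i\<close> is already trivial, so a single pass is conclusive: it clears
  coordinate \<open>i\<close> if the value is trivial or matches the lead of an entry, and otherwise
  leaves the vector unchanged.\<close>

lemma advance_props:
  assumes T: "good_table n T" and w: "w \<in> vecs n" "trivial_below i w" and i: "i < n" and a: "a \<in> carrier G"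
  shows "advance (T, w) (unit n i a) \<in> vecs n"
    and "alive (hd (unit_list n i)) (advance (T, w) (unit n i a)) \<longleftrightarrow> w ! i \<otimes> a \<in> level T i"
    and "alive (hd (unit_list n i)) (advance (T, w) (unit n i a)) \<Longrightarrow>
      trivial_below (Suc i) (advance (T, w) (unit n i a))"
proof -
  let ?g = "vmul w (unit n i a)" and ?r = "advance (T, w) (unit n i a)"
  have u: "unit n i a \<in> vecs n" by (rule unit_vecs[OF a])
  have g: "?g \<in> vecs n" "trivial_below i ?g" "?g ! i = w ! i \<otimes> a"
    using w i u by (simp_all add: trivial_below_def vmul_nth[of _ n] unit_nth)
  have Tv: "set T \<subseteq> vecs n" by (rule good_tableD(1)[OF T])
  show r: "?r \<in> vecs n" using reduce_vecs[OF Tv g(1)] by (simp add: advance_def)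
  have below: "trivial_below i ?r" using reduce_trivial_below[OF Tv g(1,2)] i by (simp add: advance_def)
  show "alive (hd (unit_list n i)) ?r \<Longrightarrow> trivial_below (Suc i) ?r"
    using below alive_unit[OF r i] by (auto simp: trivial_below_def less_Suc_eq)
  have "?r ! i = \<one> \<longleftrightarrow> w ! i \<otimes> a \<in> level T i"
  proof (cases "?g ! i = \<one>")
    case True
    then have "trivial_below (Suc i) ?g" using g by (auto simp: trivial_below_def less_Suc_eq)
    then have "trivial_below (Suc i) ?r"
      using reduce_trivial_below[OF Tv g(1), of "Suc i"] i by (simp add: advance_def)
    then show ?thesis using True g by (simp add: trivial_below_def level_def)
  next
    case False
    have lead: "leads ?g i" using False g i by (auto simp: leads_def trivial_below_def vecs_length)
    show ?thesis
    proof (cases "\<exists>t\<in>set T. same_lead t ?g")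
      case True
      then obtain t where t: "t \<in> set T" "same_lead t ?g" by blast
      then have "leads t i" "t ! i = ?g ! i"
        using lead leads_unique by (auto simp: same_lead_def)
      moreover have "trivial_below (Suc i) ?r"
        using reduce_progress[OF Tv g(1,2) i False t] by (simp add: advance_def)
      ultimately show ?thesis using t g by (auto simp: trivial_below_def level_def)
    next
      case False
      then have "?r = ?g" using reduce_stuck[of T ?g] by (simp add: advance_def)
      moreover have "w ! i \<otimes> a \<notin> level T i"
      proof
        assume "w ! i \<otimes> a \<in> level T i"
        then obtain t where "t \<in> set T" "leads t i" "t ! i = ?g ! i"
          using g(3) \<open>?g ! i \<noteq> \<one>\<close> by (auto simp: level_def)
        then show False using False lead unfolding same_lead_def by blast
      qed
      ultimately show ?thesis using g \<open>?g ! i \<noteq> \<one>\<close> by simp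
    qed
  qed
  then show "alive (hd (unit_list n i)) ?r \<longleftrightarrow> w ! i \<otimes> a \<in> level T i"
    using alive_unit[OF r i] by simp
qed

lemma card_translate:
  assumes K: "K \<subseteq> carrier G" and g: "g \<in> carrier G"
  shows "card {a \<in> carrier G. g \<otimes> a \<in> K} = card K"
proof -
  have "bij_betw (\<lambda>a. g \<otimes> a) {a \<in> carrier G. g \<otimes> a \<in> K} K"
    by (rule bij_betwI[where g = "\<lambda>b. inv g \<otimes> b"]) (use K g in \<open>auto simp: m_assoc[symmetric] subsetD\<close>)
  then show ?thesis by (rule bij_betw_same_card)
qed

text \<open>As \<open>a\<close> runs through \<open>G\<close>, so does
  \<open>w ! i \<otimes> a\<close>. Thus the test made by the program, which sees only vectors,
  recognises a full level.\<close>

lemma all_alive_iff: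
  assumes T: "good_table n T" and w: "w \<in> vecs n" "trivial_below i w" and i: "i < n"
  shows "(\<forall>v\<in>set (unit_list n i). alive (hd (unit_list n i)) (advance (T, w) v)) \<longleftrightarrow> level T i = carrier G"
proof -
  have sub: "level T i \<subseteq> carrier G" using level_subgroup[OF T i] subgroup.subset by blast
  have wi: "w ! i \<in> carrier G" using w i vecs_nth by blast
  have "(\<forall>v\<in>set (unit_list n i). alive (hd (unit_list n i)) (advance (T, w) v)) \<longleftrightarrow>
      (\<forall>a\<in>carrier G. w ! i \<otimes> a \<in> level T i)"
    using advance_props(2)[OF T w i] by (simp add: set_unit_list)
  also have "\<dots> \<longleftrightarrow> level T i = carrier G"
  proof
    assume "\<forall>a\<in>carrier G. w ! i \<otimes> a \<in> level T i"
    then have "w ! i \<otimes> (inv (w ! i) \<otimes> b) \<in> level T i" if "b \<in> carrier G" for b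
      using that wi by blast
    then show "level T i = carrier G" using sub wi by (auto simp: m_assoc[symmetric])
  qed (use wi in auto)
  finally show ?thesis .
qed

text \<open>Translation by \<open>w ! i\<close> matches the surviving choices with the elements of
  \<open>level T i\<close>. A proper subgroup has index at least 2, so even its doubled survivors
  number at most \<open>order G\<close>; a full level yields one survivor per choice.\<close>

lemma sum_step_entry:
  assumes T: "good_table n T" and w: "w \<in> vecs n" "trivial_below i w" and i: "i < n"
  shows "(\<Sum>u\<leftarrow>unit_list n i. length (step_entry (unit_list n i) u (T, w))) \<le> order G"
proof -
  let ?ul = "unit_list n i" and ?K = "level T i"
  let ?A = "{a \<in> carrier G. w ! i \<otimes> a \<in> ?K}"
  have sg: "subgroup ?K G" by (rule level_subgroup[OF T i])
  have wi: "w ! i \<in> carrier G" using w i vecs_nth by blast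
  have len: "length (step_entry ?ul (unit n i a) (T, w)) =
      (if a \<in> ?A then if ?K = carrier G then 1 else 2 else 0)" if "a \<in> carrier G" for a
    using advance_props(2)[OF T w i that] all_alive_iff[OF T w i] that by (simp add: step_entry_def)
  have "(\<Sum>u\<leftarrow>?ul. length (step_entry ?ul u (T, w))) =
      (\<Sum>a\<in>carrier G. length (step_entry ?ul (unit n i a) (T, w)))"
    using sum_list_distinct_conv_sum_set[OF els(2)] els(1) by (simp add: unit_list_def comp_def)
  also have "\<dots> = (\<Sum>a\<in>carrier G. if a \<in> ?A then if ?K = carrier G then 1 else 2 else 0)"
    by (rule sum.cong) (use len in auto)
  also have "\<dots> = (\<Sum>a\<in>?A. if ?K = carrier G then 1 else 2)"
    using finite_carrier by (intro sum.mono_neutral_cong_right) auto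
  also have "\<dots> = card ?K * (if ?K = carrier G then 1 else 2)"
    using card_translate[OF subgroup.subset[OF sg] wi] by simp
  also have "\<dots> \<le> order G"
  proof (cases "?K = carrier G")
    case False
    have r: "card (rcosets ?K) * card ?K = order G" using lagrange[OF sg] by simp
    have "card ?K \<noteq> order G"
      using False card_subset_eq[OF finite_carrier subgroup.subset[OF sg]] by (auto simp: order_def)
    then have "card (rcosets ?K) \<noteq> 1" using r by auto
    moreover have "card (rcosets ?K) \<noteq> 0" using r order_ge_2 by (metis mult_0 not_numeral_le_zero)
    ultimately have "2 \<le> card (rcosets ?K)" by linarith
    then have "2 * card ?K \<le> card (rcosets ?K) * card ?K" by (rule mult_right_mono) simp
    then show ?thesis using False r by simp
  qed (simp add: order_def)
  finally show ?thesis .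
qed

definition entry_ok :: "nat \<Rightarrow> nat \<Rightarrow> 'a list list \<times> 'a list \<Rightarrow> bool" where
  "entry_ok n i E \<longleftrightarrow> good_table n (fst E) \<and> snd E \<in> vecs n \<and> trivial_below i (snd E)"

lemma step_entry_ok:
  assumes "entry_ok n i E" "i < n" "u \<in> set (unit_list n i)" "E' \<in> set (step_entry (unit_list n i) u E)"
  shows "entry_ok n (Suc i) E'" "fst E' = fst E"
proof -
  obtain a where a: "a \<in> carrier G" "u = unit n i a" using assms(3) by (auto simp: set_unit_list)
  have "good_table n (fst E)" "snd E \<in> vecs n" "trivial_below i (snd E)"
    using assms(1) by (simp_all add: entry_ok_def)
  note ap = advance_props[OF this assms(2) a(1)]
  have E': "E' = (fst E, advance E u) \<and> alive (hd (unit_list n i)) (advance E u)"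
    using assms(4) by (auto simp: step_entry_def split: if_splits)
  then show "entry_ok n (Suc i) E'" "fst E' = fst E"
    using ap a assms(1) by (auto simp: entry_ok_def)
qed

lemma sum_list_swap:
  fixes f :: "'c \<Rightarrow> 'd \<Rightarrow> nat"
  shows "(\<Sum>x\<leftarrow>xs. \<Sum>y\<leftarrow>ys. f x y) = (\<Sum>y\<leftarrow>ys. \<Sum>x\<leftarrow>xs. f x y)"
  by (induction xs) (simp_all add: sum_list_addf)

text \<open>Double counting over choices and entries: all candidate lists together have at most
  \<open>length L * order G\<close> elements, and there are \<open>order G\<close>
  candidates.\<close>

lemma step_entries_average:
  assumes L: "\<And>E. E \<in> set L \<Longrightarrow> entry_ok n i E" and i: "i < n"
  shows "\<exists>u\<in>set (unit_list n i). length (step_entries (unit_list n i) L u) \<le> length L"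
proof (rule ccontr)
  let ?ul = "unit_list n i"
  assume "\<not> ?thesis"
  then have "(\<Sum>u\<leftarrow>?ul. length L + 1) \<le> (\<Sum>u\<leftarrow>?ul. length (step_entries ?ul L u))"
    by (intro sum_list_mono) (auto simp: not_le)
  also have "\<dots> = (\<Sum>E\<leftarrow>L. \<Sum>u\<leftarrow>?ul. length (step_entry ?ul u E))"
    by (subst sum_list_swap) (simp add: step_entries_def length_concat comp_def)
  also have "\<dots> \<le> (\<Sum>E\<leftarrow>L. order G)"
  proof (rule sum_list_mono)
    fix E assume "E \<in> set L"
    then have "entry_ok n i E" by (rule L)
    then show "(\<Sum>u\<leftarrow>?ul. length (step_entry ?ul u E)) \<le> order G"
      using sum_step_entry[of n "fst E" "snd E" i] i by (simp add: entry_ok_def)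
  qed
  finally have "length ?ul * (length L + 1) \<le> length L * order G"
    by (simp only: sum_list_triv of_nat_id)
  then show False
    using order_ge_2 by (simp add: unit_list_def length_els algebra_simps)
qed

lemma choose_unit_props:
  assumes "ul \<noteq> []"
  obtains u where "u \<in> set ul" "choose_unit ul L = (step_entries ul L u, u)"
    "\<And>v. v \<in> set ul \<Longrightarrow> length (step_entries ul L u) \<le> length (step_entries ul L v)"
proof -
  let ?s = "step_entries ul L"
  \<comment> \<open>The start \<open>u0\<close> stays arbitrary, since it stands for the best
    candidate found so far.\<close>
  have "\<exists>u\<in>insert u0 (set vs). fold (better ul L) vs (?s u0, u0) = (?s u, u) \<and>
    (\<forall>v\<in>insert u0 (set vs). length (?s u) \<le> length (?s v))" for vs u0
  proof (induction vs arbitrary: u0)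
    case (Cons v vs)
    show ?case
    proof (cases "length (?s v) \<le> length (?s u0)")
      case True
      then show ?thesis using Cons[of v] by (auto simp: better_def)
    next
      case False
      then show ?thesis using Cons[of u0] by (auto simp: better_def)
    qed
  qed simp
  from this[of "hd ul" ul] show thesis
    using assms that by (auto simp: choose_unit_def insert_absorb)
qed

section \<open>Invariants of the greedy run\<close>

definition greedy_state where
  "greedy_state n L m = fold choose_step (map (unit_list n) [0..<m]) (L, vone n)"

lemma greedy_state_0: "greedy_state n L 0 = (L, vone n)"
  by (simp add: greedy_state_def)

lemma greedy_state_Suc: "greedy_state n L (Suc m) = choose_step (unit_list n m) (greedy_state n L m)"
  by (simp add: greedy_state_def)

lemma greedy_state_step:
  assumes "L' = fst (greedy_state n L m)" "x = snd (greedy_state n L m)"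
  obtains a where "a \<in> carrier G"
    "greedy_state n L (Suc m) = (step_entries (unit_list n m) L' (unit n m a), vmul x (unit n m a))"
    "\<And>v. v \<in> set (unit_list n m) \<Longrightarrow>
       length (step_entries (unit_list n m) L' (unit n m a)) \<le> length (step_entries (unit_list n m) L' v)"
proof -
  have "unit_list n m \<noteq> []" by (simp add: unit_list_def els)
  then obtain u where u: "u \<in> set (unit_list n m)"
    "choose_unit (unit_list n m) L' = (step_entries (unit_list n m) L' u, u)"
    "\<And>v. v \<in> set (unit_list n m) \<Longrightarrow>
       length (step_entries (unit_list n m) L' u) \<le> length (step_entries (unit_list n m) L' v)"
    using choose_unit_props by blast
  obtain a where a: "a \<in> carrier G" "u = unit n m a" using u(1) by (auto simp: set_unit_list)
  show thesis
    by (rule that[OF a(1)]) (use u a assms in \<open>auto simp: greedy_state_Suc choose_step_def\<close>)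
qed

lemma greedy_state_props:
  assumes L: "\<And>E. E \<in> set L \<Longrightarrow> entry_ok n 0 E" and "m \<le> n"
  shows "snd (greedy_state n L m) \<in> vecs n"
    and "E \<in> set (fst (greedy_state n L m)) \<Longrightarrow> entry_ok n m E \<and> fst E \<in> fst ` set L"
    and "length (fst (greedy_state n L m)) \<le> length L"
proof -
  have "snd (greedy_state n L m) \<in> vecs n \<and>
    (\<forall>E\<in>set (fst (greedy_state n L m)). entry_ok n m E \<and> fst E \<in> fst ` set L) \<and>
    length (fst (greedy_state n L m)) \<le> length L"
    using assms(2)
  proof (induction m)
    case 0
    then show ?case using L by (simp add: greedy_state_0)
  next
    case (Suc m)
    define L' where "L' = fst (greedy_state n L m)"
    define x where "x = snd (greedy_state n L m)"
    have IH: "x \<in> vecs n" "\<And>E. E \<in> set L' \<Longrightarrow> entry_ok n m E \<and> fst E \<in> fst ` set L" "length L' \<le> length L"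
      using Suc by (auto simp: L'_def x_def)
    obtain a where a: "a \<in> carrier G"
      "greedy_state n L (Suc m) = (step_entries (unit_list n m) L' (unit n m a), vmul x (unit n m a))"
      "\<And>v. v \<in> set (unit_list n m) \<Longrightarrow>
       length (step_entries (unit_list n m) L' (unit n m a)) \<le> length (step_entries (unit_list n m) L' v)"
      using greedy_state_step[OF L'_def x_def] by blast
    have mn: "m < n" using Suc by simp
    have ua: "unit n m a \<in> set (unit_list n m)" using a(1) by (simp add: set_unit_list)
    obtain v where v: "v \<in> set (unit_list n m)" "length (step_entries (unit_list n m) L' v) \<le> length L'"
      using step_entries_average[of L' n m] IH(2) mn by blast
    have "length (step_entries (unit_list n m) L' (unit n m a)) \<le> length L"
      using a(3)[OF v(1)] v(2) IH(3) by linarith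
    moreover have "entry_ok n (Suc m) E \<and> fst E \<in> fst ` set L"
      if E: "E \<in> set (step_entries (unit_list n m) L' (unit n m a))" for E
    proof -
      obtain E' where E': "E' \<in> set L'" "E \<in> set (step_entry (unit_list n m) (unit n m a) E')"
        using E by (auto simp: step_entries_def)
      show ?thesis using step_entry_ok[OF _ mn ua E'(2)] IH(2)[OF E'(1)] by metis
    qed
    ultimately show ?case using a(2) IH(1) unit_vecs[OF a(1)] by simp
  qed
  then show "snd (greedy_state n L m) \<in> vecs n"
    "E \<in> set (fst (greedy_state n L m)) \<Longrightarrow> entry_ok n m E \<and> fst E \<in> fst ` set L"
    "length (fst (greedy_state n L m)) \<le> length L" by blast+
qed

text \<open>Later choices multiply by vectors that are trivial at \<open>j\<close>.\<close>

lemma greedy_state_agree: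
  assumes L: "\<And>E. E \<in> set L \<Longrightarrow> entry_ok n 0 E" and "m \<le> m'" "m' \<le> n" "j < m"
  shows "snd (greedy_state n L m') ! j = snd (greedy_state n L m) ! j"
  using assms(2,3)
proof (induction m' rule: dec_induct)
  case (step k)
  obtain a where a: "a \<in> carrier G" "snd (greedy_state n L (Suc k)) = vmul (snd (greedy_state n L k)) (unit n k a)"
    using greedy_state_step[OF refl refl] by (metis snd_conv)
  have v: "snd (greedy_state n L k) \<in> vecs n"
    by (rule greedy_state_props(1)[OF L]) (use step in auto)
  have "vmul (snd (greedy_state n L k)) (unit n k a) ! j = snd (greedy_state n L k) ! j"
    using step assms(4) vmul_nth[OF v unit_vecs[OF a(1)], of j] vecs_nth[OF v, of j]
    by (simp add: unit_nth)
  then show ?case using step a by simp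
qed simp

lemma count_list_concat_map: "count_list L E * count_list (f E) y \<le> count_list (concat (map f L)) y"
  by (induction L) auto

text \<open>If the final point belonged to the subgroup, no choice could ever kill it, and every
  proper level would double its copies. \<open>h\<close> is the member by which the reductions so
  far have moved the partial point; it depends on the history, hence the existential.\<close>

lemma greedy_multiplicity:
  assumes L: "\<And>E. E \<in> set L \<Longrightarrow> entry_ok n 0 E" and T: "(T, vone n) \<in> set L"
    and x: "x = snd (greedy_state n L n)" "nform n (set T) 0 x" and "m \<le> n"
  shows "\<exists>h. nform n (set T) 0 h \<and>
    2 ^ card {j. j < m \<and> level T j \<noteq> carrier G} \<le>
      count_list (fst (greedy_state n L m)) (T, vdiv h (snd (greedy_state n L m)))"
  using assms(5)
proof (induction m)
  case 0
  have "0 < count_list L (T, vone n)" using T by (metis count_list_0_iff gr0I)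
  then show ?case
    by (intro exI[of _ "vone n"]) (simp add: greedy_state_0 nform.one vone_vdiv Suc_le_eq)
next
  case (Suc m)
  have gT: "good_table n T" using L[OF T] by (simp add: entry_ok_def)
  let ?M = "{z. nform n (set T) 0 z}"
  note M = good_tableD(2)[OF gT]
  define L' where "L' = fst (greedy_state n L m)"
  define y where "y = snd (greedy_state n L m)"
  have mn: "m < n" using Suc by simp
  obtain h where h: "h \<in> ?M"
    "2 ^ card {j. j < m \<and> level T j \<noteq> carrier G} \<le> count_list L' (T, vdiv h y)"
    using Suc by (auto simp: L'_def y_def)
  obtain a where a: "a \<in> carrier G"
    "greedy_state n L (Suc m) = (step_entries (unit_list n m) L' (unit n m a), vmul y (unit n m a))"
    using greedy_state_step[OF L'_def y_def] by blast
  let ?u = "unit n m a" and ?w = "vdiv h y" and ?c = "count_list L' (T, vdiv h y)"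
  have u: "?u \<in> vecs n" "?u \<in> set (unit_list n m)" using a by (simp_all add: unit_vecs set_unit_list)
  have hv: "h \<in> vecs n" using vsubgroupD(1)[OF M h(1)] .
  have yv: "y \<in> vecs n" using greedy_state_props(1)[OF L, where m = m] mn by (simp add: y_def)
  have xv: "x \<in> vecs n" using greedy_state_props(1)[OF L, where m = n] by (simp add: x)
  have "0 < ?c" using h(2) by (meson less_le_trans zero_less_numeral zero_less_power)
  then have "(T, ?w) \<in> set L'" by (metis count_list_0_iff less_irrefl)
  then have "entry_ok n m (T, ?w)" using greedy_state_props(2)[OF L, where m = m] mn by (simp add: L'_def)
  then have w: "?w \<in> vecs n" "trivial_below m ?w" by (simp_all add: entry_ok_def)
  have agree: "x ! j = vmul y ?u ! j" if "j < Suc m" for j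
    using greedy_state_agree[OF L, where m = "Suc m" and m' = n and j = j] that mn a(2) by (simp add: x)
  have wu: "vmul ?w ?u = vdiv h (vmul y ?u)" by (rule vmul_vdiv_assoc[OF hv yv u(1)])
  have z: "vdiv h x \<in> ?M" by (rule vsubgroup_vdiv[OF M h(1)]) (use x in simp)
  have zj: "vdiv h x ! j = vmul ?w ?u ! j" if "j < Suc m" for j
    using agree[OF that] that mn hv yv u xv by (simp add: wu vdiv_nth[of _ n])
  \<comment> \<open>\<open>vdiv h x\<close> is a member that agrees up to \<open>m\<close> with the
    current vector times the chosen unit. It is therefore trivial before \<open>m\<close>, and the
    value to be cancelled at \<open>m\<close> lies in the level.\<close>
  have "trivial_below m (vdiv h x)"
    using zj w u mn by (simp add: trivial_below_def vmul_nth[OF w(1) u(1)] unit_nth)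
  then have "vdiv h x ! m \<in> level T m" using z by (auto simp: level_eq[OF gT mn])
  then have "?w ! m \<otimes> a \<in> level T m"
    using zj[of m] mn by (simp add: vmul_nth[OF w(1) u(1)] unit_nth)
  then have alive: "alive (hd (unit_list n m)) (advance (T, ?w) ?u)"
    using advance_props(2)[OF gT w mn a(1)] by simp
  obtain h' where h': "h' \<in> ?M" "advance (T, ?w) ?u = vdiv h' (vmul ?w ?u)"
    using reduce_vdiv[OF M _ vmul_vecs[OF w(1) u(1)], of T] good_tableD(3)[OF gT]
    by (auto simp: advance_def)
  let ?v = "advance (T, ?w) ?u"
  have v: "?v = vdiv (vmul h h') (vmul y ?u)"
    using vdiv_vmul_left[OF hv vsubgroupD(1)[OF M h'(1)] vmul_vecs[OF yv u(1)]] by (simp add: h' wu)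
  have mult: "count_list (step_entry (unit_list n m) ?u (T, ?w)) (T, ?v) =
      (if level T m = carrier G then 1 else 2)"
    using alive all_alive_iff[OF gT w mn] by (simp add: step_entry_def)
  have "{j. j < Suc m \<and> level T j \<noteq> carrier G} =
      (if level T m = carrier G then {} else {m}) \<union> {j. j < m \<and> level T j \<noteq> carrier G}"
    by (auto simp: less_Suc_eq)
  then have "(2 :: nat) ^ card {j. j < Suc m \<and> level T j \<noteq> carrier G} =
      (if level T m = carrier G then 1 else 2) * 2 ^ card {j. j < m \<and> level T j \<noteq> carrier G}"
    by simp
  also have "\<dots> \<le> (if level T m = carrier G then 1 else 2) * ?c"
    using h(2) by (intro mult_left_mono) auto
  also have "\<dots> = ?c * count_list (step_entry (unit_list n m) ?u (T, ?w)) (T, ?v)"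
    by (simp add: mult)
  also have "\<dots> \<le> count_list (step_entries (unit_list n m) L' ?u) (T, ?v)"
    unfolding step_entries_def by (rule count_list_concat_map)
  finally have "2 ^ card {j. j < Suc m \<and> level T j \<noteq> carrier G} \<le>
      count_list (fst (greedy_state n L (Suc m))) (T, vdiv (vmul h h') (snd (greedy_state n L (Suc m))))"
    by (simp add: a(2) v)
  then show ?case using vsubgroupD(3)[OF M h(1) h'(1)] by blast
qed

text \<open>Membership would require more copies of one entry than the final list has
  places.\<close>

lemma greedy_avoids:
  assumes L: "\<And>E. E \<in> set L \<Longrightarrow> entry_ok n 0 E" and T: "(T, vone n) \<in> set L"
    and "length L < 2 ^ card {j. j < n \<and> level T j \<noteq> carrier G}"
  shows "\<not> nform n (set T) 0 (snd (greedy_state n L n))"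
proof
  assume "nform n (set T) 0 (snd (greedy_state n L n))"
  from greedy_multiplicity[OF L T refl this order_refl]
  obtain h where "2 ^ card {j. j < n \<and> level T j \<noteq> carrier G} \<le>
      count_list (fst (greedy_state n L n)) (T, vdiv h (snd (greedy_state n L n)))"
    by blast
  also have "\<dots> \<le> length (fst (greedy_state n L n))" by (rule count_le_length)
  also have "\<dots> \<le> length L" by (rule greedy_state_props(3)[OF L order_refl])
  finally show False using assms(3) by simp
qed

text \<open>Values at full levels are prescribed from left to right: a member that is trivial before
  \<open>m\<close> and has value \<open>inv (z ! m) \<otimes> y m\<close> at \<open>m\<close>
  corrects coordinate \<open>m\<close> by right multiplication and leaves the earlier ones
  alone.\<close>

lemma level_surj:
  assumes T: "good_table n T" and y: "\<And>j. j < n \<Longrightarrow> y j \<in> carrier G"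
  shows "\<exists>z. nform n (set T) 0 z \<and> (\<forall>j<n. level T j = carrier G \<longrightarrow> z ! j = y j)"
proof -
  let ?M = "{z. nform n (set T) 0 z}"
  note M = good_tableD(2)[OF T]
  have "m \<le> n \<Longrightarrow> \<exists>z\<in>?M. \<forall>j<m. level T j = carrier G \<longrightarrow> z ! j = y j" for m
  proof (induction m)
    case 0
    then show ?case using vsubgroupD(2)[OF M] by blast
  next
    case (Suc m)
    then obtain z where z: "z \<in> ?M" "\<forall>j<m. level T j = carrier G \<longrightarrow> z ! j = y j" by auto
    have mn: "m < n" using Suc by simp
    have zv: "z \<in> vecs n" by (rule vsubgroupD(1)[OF M z(1)])
    show ?case
    proof (cases "level T m = carrier G")
      case True
      have "inv (z ! m) \<otimes> y m \<in> level T m" using y[OF mn] vecs_nth[OF zv mn] True by simp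
      then obtain t where t: "t \<in> ?M" "trivial_below m t" "t ! m = inv (z ! m) \<otimes> y m"
        unfolding level_eq[OF T mn] by auto
      have tv: "t \<in> vecs n" by (rule vsubgroupD(1)[OF M t(1)])
      have "vmul z t ! j = y j" if "j < Suc m" "level T j = carrier G" for j
        using that t z(2) mn y[OF mn] y[of j] vecs_nth[OF zv]
        by (auto simp: vmul_nth[OF zv tv] trivial_below_def less_Suc_eq m_assoc[symmetric])
      then show ?thesis using vsubgroupD(3)[OF M z(1) t(1)] by blast
    qed (use z in \<open>auto simp: less_Suc_eq\<close>)
  qed
  from this[of n] show ?thesis by auto
qed

text \<open>By \<open>level_surj\<close> all patterns on the full coordinates outside
  \<open>U\<close> occur in the table's subgroup. There its vectors agree with vectors of
  \<open>H\<close>, so restriction to these coordinates maps \<open>H\<close> onto all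
  patterns.\<close>

lemma card_full_levels:
  assumes T: "good_table n T" and "finite H"
    and H: "\<And>z. nform n (set T) 0 z \<Longrightarrow> \<exists>h\<in>H. \<forall>j<n. j \<notin> U \<longrightarrow> z ! j = h ! j"
  shows "order G ^ card ({j. j < n \<and> level T j = carrier G} - U) \<le> card H"
proof -
  let ?F = "{j. j < n \<and> level T j = carrier G} - U"
  have "PiE ?F (\<lambda>_. carrier G) \<subseteq> (\<lambda>h. restrict ((!) h) ?F) ` H"
  proof
    fix y assume y: "y \<in> PiE ?F (\<lambda>_. carrier G)"
    \<comment> \<open>Full levels inside \<open>U\<close> need some value too; the unit serves, as
      nothing is read off there.\<close>
    have "(if j \<in> ?F then y j else \<one>) \<in> carrier G" for j using y by (auto simp: PiE_iff)
    then obtain z where z: "nform n (set T) 0 z"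
      "\<forall>j<n. level T j = carrier G \<longrightarrow> z ! j = (if j \<in> ?F then y j else \<one>)"
      using level_surj[OF T, of "\<lambda>j. if j \<in> ?F then y j else \<one>"] by blast
    obtain h where h: "h \<in> H" "\<forall>j<n. j \<notin> U \<longrightarrow> z ! j = h ! j" using H[OF z(1)] by blast
    have "y = restrict ((!) h) ?F"
    proof
      fix j show "y j = restrict ((!) h) ?F j"
        using y z(2) h(2) by (cases "j \<in> ?F") (auto simp: PiE_iff extensional_def)
    qed
    then show "y \<in> (\<lambda>h. restrict ((!) h) ?F) ` H" using h(1) by blast
  qed
  then have "card (PiE ?F (\<lambda>_. carrier G)) \<le> card H"
    using assms(2) by (meson card_image_le card_mono finite_imageI order.trans)
  then show ?thesis by (simp add: card_PiE order_def)
qed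

end

section \<open>Programs for table computations\<close>

text \<open>Weakening for nested loops: a loop body receives the outer input as its left component,
  so whatever is computable outside stays computable inside.\<close>

lemma ptime_env:
  assumes "ptime D inp F" "\<And>p. p \<in> S \<Longrightarrow> fst p \<in> D"
  shows "ptime S (\<lambda>p. Pair (inp (fst p)) (R p)) (\<lambda>p. F (fst p))"
  by (rule ptime_call[OF assms(1) _ assms(2)]) (rule ptime_sel[of _ _ "[False]"], simp)

lemma ptime_map_elem: "ptime S (\<lambda>p. Pair (inp (fst p)) (X (snd p))) (\<lambda>p. X (snd p))"
  by (rule ptime_sel[of _ _ "[True]"]) simp

lemma ptime_fold_elem: "ptime S (\<lambda>p. Pair (inp (fst p)) (Pair (X (fst (snd p))) (Z (snd (snd p))))) (\<lambda>p. X (fst (snd p)))"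
  by (rule ptime_sel[of _ _ "[True, False]"]) simp

lemma ptime_fold_state: "ptime S (\<lambda>p. Pair (inp (fst p)) (Pair (X (fst (snd p))) (Z (snd (snd p))))) (\<lambda>p. Z (snd (snd p)))"
  by (rule ptime_sel[of _ _ "[True, True]"]) simp

lemma pbounded_env:
  assumes "pbounded D inp f" "\<And>p. p \<in> S \<Longrightarrow> fst p \<in> D"
  shows "pbounded S (\<lambda>p. Pair (inp (fst p)) (R p)) (\<lambda>p. f (fst p))"
  by (rule pbounded_comp[OF assms(1) _ assms(2)]) (rule pbounded_mono[OF pbounded_size], simp)

lemma size_encode_unary: "size (encode_unary k) = k"
  unfolding encode_unary_def by (induction k) auto

lemma inj_encode_unary: "inj encode_unary"
  by (rule injI) (metis size_encode_unary)

definition code_status :: "bool option \<Rightarrow> tree" where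
  "code_status s = (case s of None \<Rightarrow> Leaf | Some b \<Rightarrow> Pair Leaf (code_bool b))"

lemma inj_code_status: "inj code_status"
  by (rule injI) (auto simp: code_status_def code_bool_def split: option.splits if_splits)

context coded_group begin

definition code_el :: "'a \<Rightarrow> tree" where
  "code_el a = encode_unary (e a)"

abbreviation "code_vec \<equiv> code_list code_el"
abbreviation "code_tab \<equiv> code_list code_vec"
abbreviation "code_entry \<equiv> code_pair code_tab code_vec"
abbreviation "code_entries \<equiv> code_list code_entry"

lemma inj_code_el: "inj_on code_el (carrier G)"
  using e_bij inj_encode_unary unfolding code_el_def bij_betw_def inj_on_def by blast

lemma size_code_el: "a \<in> carrier G \<Longrightarrow> size (code_el a) \<le> order G"
  using e_bij by (auto simp: code_el_def size_encode_unary bij_betw_def intro: less_imp_le)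

lemma size_code_vec: "v \<in> vecs n \<Longrightarrow> size (code_vec v) \<le> n * (order G + 1)"
  using size_code_list_le[of v code_el "order G"] size_code_el by (auto simp: vecs_def)

lemma size_code_tab: "set T \<subseteq> vecs n \<Longrightarrow> size (code_tab T) \<le> length T * (n * (order G + 1) + 1)"
  by (rule size_code_list_le) (rule size_code_vec, blast)

lemma ptime_el:
  assumes "ptime D inp (\<lambda>x. code_el (a x))" "\<And>x. x \<in> D \<Longrightarrow> a x \<in> carrier G"
  shows "ptime D inp (\<lambda>x. F (a x))"
  by (rule ptime_finite[OF assms(1) finite_carrier inj_code_el assms(2)])

lemma inj_code_el2: "inj_on (code_pair code_el code_el) (carrier G \<times> carrier G)"
  using inj_code_el by (auto simp: code_pair_def inj_on_def)

lemma ptime_el2: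
  assumes "ptime D inp (\<lambda>x. code_pair code_el code_el (a x))" "\<And>x. x \<in> D \<Longrightarrow> a x \<in> carrier G \<times> carrier G"
  shows "ptime D inp (\<lambda>x. F (a x))"
  by (rule ptime_finite[OF assms(1) _ inj_code_el2 assms(2)]) (simp_all add: finite_carrier)

lemma zip_vecs: "u \<in> vecs n \<Longrightarrow> v \<in> vecs n \<Longrightarrow> set (zip u v) \<subseteq> carrier G \<times> carrier G"
  by (auto simp: vecs_def dest: set_zip_leftD set_zip_rightD)

lemma ptime_vzip:
  assumes "ptime D inp (\<lambda>x. code_vec (u x))" "ptime D inp (\<lambda>x. code_vec (v x))"
    "\<And>x. x \<in> D \<Longrightarrow> u x \<in> vecs (d x)" "\<And>x. x \<in> D \<Longrightarrow> v x \<in> vecs (d x)"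
  shows "ptime D inp (\<lambda>x. code_list (code_pair code_el code_el) (zip (u x) (v x)))"
  by (rule ptime_zip[OF assms(1,2)]) (simp add: vecs_length[OF assms(3)] vecs_length[OF assms(4)])

lemma ptime_vmap2:
  assumes "ptime D inp (\<lambda>x. code_vec (u x))" "ptime D inp (\<lambda>x. code_vec (v x))"
    "\<And>x. x \<in> D \<Longrightarrow> u x \<in> vecs (d x)" "\<And>x. x \<in> D \<Longrightarrow> v x \<in> vecs (d x)"
  shows "ptime D inp (\<lambda>x. code_list Y (map F (zip (u x) (v x))))"
proof (rule ptime_map[where h = "\<lambda>_. F", OF ptime_vzip[OF assms]])
  show "ptime {p. fst p \<in> D \<and> snd p \<in> set (zip (u (fst p)) (v (fst p)))}
      (\<lambda>p. Pair (inp (fst p)) (code_pair code_el code_el (snd p))) (\<lambda>p. Y (F (snd p)))"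
    by (rule ptime_el2[OF ptime_map_elem]) (use zip_vecs assms(3,4) in blast)
qed

lemma ptime_vmul:
  assumes "ptime D inp (\<lambda>x. code_vec (u x))" "ptime D inp (\<lambda>x. code_vec (v x))"
    "\<And>x. x \<in> D \<Longrightarrow> u x \<in> vecs (d x)" "\<And>x. x \<in> D \<Longrightarrow> v x \<in> vecs (d x)"
  shows "ptime D inp (\<lambda>x. code_vec (vmul (u x) (v x)))"
  unfolding vmul_def by (rule ptime_vmap2[OF assms])

lemma ptime_vdiv:
  assumes "ptime D inp (\<lambda>x. code_vec (u x))" "ptime D inp (\<lambda>x. code_vec (v x))"
    "\<And>x. x \<in> D \<Longrightarrow> u x \<in> vecs (d x)" "\<And>x. x \<in> D \<Longrightarrow> v x \<in> vecs (d x)"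
  shows "ptime D inp (\<lambda>x. code_vec (vdiv (u x) (v x)))"
  unfolding vdiv_def by (rule ptime_vmap2[OF assms])

lemma ptime_alive:
  assumes "ptime D inp (\<lambda>x. code_vec (u x))" "ptime D inp (\<lambda>x. code_vec (v x))"
    "\<And>x. x \<in> D \<Longrightarrow> u x \<in> vecs (d x)" "\<And>x. x \<in> D \<Longrightarrow> v x \<in> vecs (d x)"
  shows "ptime D inp (\<lambda>x. code_bool (alive (u x) (v x)))"
  unfolding alive_def
proof (rule ptime_Ball[OF ptime_vzip[OF assms]])
  show "ptime {p. fst p \<in> D \<and> snd p \<in> set (zip (u (fst p)) (v (fst p)))}
      (\<lambda>p. Pair (inp (fst p)) (code_pair code_el code_el (snd p)))
      (\<lambda>p. code_bool (fst (snd p) = \<one> \<or> snd (snd p) = \<one>))"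
    by (rule ptime_el2[OF ptime_map_elem]) (use zip_vecs assms(3,4) in blast)
qed

text \<open>\<open>None\<close> means that both vectors have been trivial so far. The first position
  where this fails decides: equal values there are nontrivial and form a common lead, unequal ones
  exclude it.\<close>

definition lead_status :: "'a \<times> 'a \<Rightarrow> bool option \<Rightarrow> bool option" where
  "lead_status p s = (case s of
     None \<Rightarrow> if fst p = \<one> \<and> snd p = \<one> then None else Some (fst p = snd p)
   | Some b \<Rightarrow> Some b)"

lemma fold_lead_status_Some: "fold lead_status ps (Some b) = Some b"
  by (induction ps) (auto simp: lead_status_def)

lemma leads_Cons: "leads (a # v) i \<longleftrightarrow> (case i of 0 \<Rightarrow> a \<noteq> \<one> | Suc j \<Rightarrow> a = \<one> \<and> leads v j)"
  by (auto simp: leads_def less_Suc_eq_0_disj split: nat.splits)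

lemma same_lead_iff:
  "length t = length g \<Longrightarrow> same_lead t g \<longleftrightarrow> fold lead_status (zip t g) None = Some True"
proof (induction t g rule: list_induct2)
  case Nil
  show ?case by (simp add: same_lead_def leads_def)
next
  case (Cons a t b g)
  have "same_lead (a # t) (b # g) \<longleftrightarrow> (if a = \<one> \<and> b = \<one> then same_lead t g else a = b)"
  proof -
    have ex: "(\<exists>i. P i) \<longleftrightarrow> P 0 \<or> (\<exists>j. P (Suc j))" for P by (metis nat.exhaust)
    show ?thesis unfolding same_lead_def by (subst ex) (auto simp: leads_Cons)
  qed
  then show ?case using Cons by (auto simp: lead_status_def[of "(a, b)" None] fold_lead_status_Some)
qed

text \<open>The scanning state and a pair of group elements range over finite sets, so each step is
  a table lookup.\<close>

lemma ptime_same_lead: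
  assumes "ptime D inp (\<lambda>x. code_vec (u x))" "ptime D inp (\<lambda>x. code_vec (v x))"
    "\<And>x. x \<in> D \<Longrightarrow> u x \<in> vecs (d x)" "\<And>x. x \<in> D \<Longrightarrow> v x \<in> vecs (d x)"
  shows "ptime D inp (\<lambda>x. code_bool (same_lead (u x) (v x)))"
proof -
  let ?c = "code_pair (code_pair code_el code_el) code_status"
  let ?S = "{p. fst p \<in> D \<and> fst (snd p) \<in> set (zip (u (fst p)) (v (fst p))) \<and> True}"
  let ?i = "\<lambda>p. Pair (inp (fst p)) (Pair (code_pair code_el code_el (fst (snd p))) (code_status (snd (snd p))))"
  have "ptime D inp (\<lambda>x. code_status (fold lead_status (zip (u x) (v x)) None))"
  proof (rule ptime_fold_inv[where I = "\<lambda>_ _. True" and h = "\<lambda>_. lead_status", OF ptime_vzip[OF assms] ptime_const])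
    have "ptime ?S ?i (\<lambda>p. ?c (fst (snd p), snd (snd p)))"
      by (rule ptime_code_pair[OF ptime_fold_elem ptime_fold_state])
    then show "ptime ?S ?i (\<lambda>p. code_status (lead_status (fst (snd p)) (snd (snd p))))"
    proof (rule ptime_finite[where F = "\<lambda>q. code_status (lead_status (fst q) (snd q))"
          and h = "\<lambda>p. (fst (snd p), snd (snd p))", simplified fst_conv snd_conv])
      show "finite ((carrier G \<times> carrier G) \<times> (UNIV :: bool option set))"
        by (simp add: finite_carrier)
      show "inj_on ?c ((carrier G \<times> carrier G) \<times> UNIV)"
        using inj_code_el2 inj_code_status by (auto simp: code_pair_def[of "code_pair code_el code_el"] inj_on_def)
      show "(fst (snd p), snd (snd p)) \<in> (carrier G \<times> carrier G) \<times> UNIV" if "p \<in> ?S" for p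
        using that zip_vecs assms(3,4) by blast
    qed
    show "pbounded D inp (\<lambda>_. 2)" by (rule pbounded_const)
    show "size (code_status s) \<le> 2" for s
      by (auto simp: code_status_def code_bool_def split: option.splits)
  qed auto
  then have "ptime D inp (\<lambda>x. code_bool (code_status (fold lead_status (zip (u x) (v x)) None) = code_status (Some True)))"
    by (rule ptime_eq_const)
  then show ?thesis
    by (rule ptime_cong) (simp add: same_lead_iff vecs_length[OF assms(3)] vecs_length[OF assms(4)] inj_eq[OF inj_code_status])
qed

text \<open>The dimension \<open>d x\<close> is a parameter of the analysis: membership in
  \<open>vecs (d x)\<close> bounds every intermediate vector, while the program itself merely scans
  lists.\<close>

lemma ptime_reduce:
  assumes T: "ptime D inp (\<lambda>x. code_tab (T x))" and g: "ptime D inp (\<lambda>x. code_vec (g x))"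
    and v: "\<And>x. x \<in> D \<Longrightarrow> set (T x) \<subseteq> vecs (d x)" "\<And>x. x \<in> D \<Longrightarrow> g x \<in> vecs (d x)"
    and d: "pbounded D inp d"
  shows "ptime D inp (\<lambda>x. code_vec (reduce (T x) (g x)))"
  unfolding reduce_def
proof (rule ptime_fold_inv[where I = "\<lambda>x s. s \<in> vecs (d x)" and h = "\<lambda>_ t g. if same_lead t g then vdiv t g else g", OF T g])
  let ?S = "{p. fst p \<in> D \<and> fst (snd p) \<in> set (T (fst p)) \<and> snd (snd p) \<in> vecs (d (fst p))}"
  let ?i = "\<lambda>p. Pair (inp (fst p)) (Pair (code_vec (fst (snd p))) (code_vec (snd (snd p))))"
  have vec: "fst (snd p) \<in> vecs (d (fst p))" "snd (snd p) \<in> vecs (d (fst p))" if "p \<in> ?S" for p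
    using that v(1) by blast+
  have "ptime ?S ?i (\<lambda>p. if same_lead (fst (snd p)) (snd (snd p)) then code_vec (vdiv (fst (snd p)) (snd (snd p)))
      else code_vec (snd (snd p)))"
  proof (rule ptime_If)
    show "ptime ?S ?i (\<lambda>p. code_bool (same_lead (fst (snd p)) (snd (snd p))))"
      by (rule ptime_same_lead, rule ptime_fold_elem, rule ptime_fold_state) (erule vec)+
    show "ptime {p \<in> ?S. same_lead (fst (snd p)) (snd (snd p))} ?i (\<lambda>p. code_vec (vdiv (fst (snd p)) (snd (snd p))))"
      by (rule ptime_vdiv, rule ptime_fold_elem, rule ptime_fold_state) (rule vec, simp)+
  qed (rule ptime_fold_state)
  then show "ptime ?S ?i (\<lambda>p. code_vec (if same_lead (fst (snd p)) (snd (snd p)) then vdiv (fst (snd p)) (snd (snd p))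
      else snd (snd p)))"
    by (simp only: if_distrib[of code_vec])
  show "pbounded D inp (\<lambda>x. d x * (order G + 1))" by (intro pbounded_mult d pbounded_const)
  show "(if same_lead t s then vdiv t s else s) \<in> vecs (d x)"
    if "x \<in> D" "t \<in> set (T x)" "s \<in> vecs (d x)" for x t s
    using v(1)[OF that(1)] that by auto
qed (use v size_code_vec in auto)

lemma ptime_sift:
  assumes T: "ptime D inp (\<lambda>x. code_tab (T x))" and g: "ptime D inp (\<lambda>x. code_vec (g x))"
    and v: "\<And>x. x \<in> D \<Longrightarrow> set (T x) \<subseteq> vecs (d x)" "\<And>x. x \<in> D \<Longrightarrow> g x \<in> vecs (d x)"
    and d: "pbounded D inp d"
  shows "ptime D inp (\<lambda>x. code_vec (sift (T x) (g x)))"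
  unfolding sift_def
proof (rule ptime_fold_inv[where I = "\<lambda>x s. s \<in> vecs (d x)" and h = "\<lambda>x _. reduce (T x)", OF g g])
  let ?S = "{p. fst p \<in> D \<and> fst (snd p) \<in> set (g (fst p)) \<and> snd (snd p) \<in> vecs (d (fst p))}"
  show "ptime ?S (\<lambda>p. Pair (inp (fst p)) (Pair (code_el (fst (snd p))) (code_vec (snd (snd p)))))
      (\<lambda>p. code_vec (reduce (T (fst p)) (snd (snd p))))"
    by (rule ptime_reduce[where d = "\<lambda>p. d (fst p)"], rule ptime_env[OF T], simp, rule ptime_fold_state)
      (use v in \<open>auto intro: pbounded_env[OF d]\<close>)
  show "pbounded D inp (\<lambda>x. d x * (order G + 1))" by (intro pbounded_mult d pbounded_const)
qed (use v size_code_vec reduce_vecs in auto)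

lemma ptime_ins:
  assumes T: "ptime D inp (\<lambda>x. code_tab (T x))" and g: "ptime D inp (\<lambda>x. code_vec (g x))"
    and v: "\<And>x. x \<in> D \<Longrightarrow> set (T x) \<subseteq> vecs (d x)" "\<And>x. x \<in> D \<Longrightarrow> g x \<in> vecs (d x)"
    and d: "pbounded D inp d"
  shows "ptime D inp (\<lambda>x. code_tab (ins (g x) (T x)))"
proof -
  have s: "ptime D inp (\<lambda>x. code_vec (sift (T x) (g x)))" by (rule ptime_sift[OF assms])
  have "ptime D inp (\<lambda>x. if \<forall>a\<in>set (sift (T x) (g x)). a = \<one> then code_tab (T x)
      else code_tab (sift (T x) (g x) # T x))"
  proof (rule ptime_If)
    show "ptime D inp (\<lambda>x. code_bool (\<forall>a\<in>set (sift (T x) (g x)). a = \<one>))"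
    proof (rule ptime_Ball[OF s])
      show "ptime {p. fst p \<in> D \<and> snd p \<in> set (sift (T (fst p)) (g (fst p)))}
        (\<lambda>p. Pair (inp (fst p)) (code_el (snd p))) (\<lambda>p. code_bool (snd p = \<one>))"
        by (rule ptime_el[OF ptime_map_elem]) (use sift_vecs[OF v] in \<open>auto simp: vecs_def\<close>)
    qed
  qed (auto intro: ptime_subset[OF T] ptime_Cons ptime_subset[OF s] simp del: code_list_simps)
  then show ?thesis by (simp only: ins_def if_distrib[of code_tab])
qed

lemma size_table: "table_inv n T \<Longrightarrow> size (code_tab T) \<le> n * order G * (n * (order G + 1) + 1)"
  using size_code_tab[OF table_inv_vecs, of n T] table_inv_length[of n T]
  by (meson mult_le_mono1 order.trans)

lemma ptime_fold_ins:
  assumes gs: "ptime D inp (\<lambda>x. code_tab (gs x))" and T: "ptime D inp (\<lambda>x. code_tab (T x))"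
    and v: "\<And>x. x \<in> D \<Longrightarrow> table_inv (d x) (T x)" "\<And>x. x \<in> D \<Longrightarrow> set (gs x) \<subseteq> vecs (d x)"
    and d: "pbounded D inp d"
  shows "ptime D inp (\<lambda>x. code_tab (fold ins (gs x) (T x)))"
proof (rule ptime_fold_inv[where I = "\<lambda>x. table_inv (d x)" and h = "\<lambda>_. ins", OF gs T])
  let ?S = "{p. fst p \<in> D \<and> fst (snd p) \<in> set (gs (fst p)) \<and> table_inv (d (fst p)) (snd (snd p))}"
  show "ptime ?S (\<lambda>p. Pair (inp (fst p)) (Pair (code_vec (fst (snd p))) (code_tab (snd (snd p)))))
      (\<lambda>p. code_tab (ins (fst (snd p)) (snd (snd p))))"
    by (rule ptime_ins[where d = "\<lambda>p. d (fst p)"], rule ptime_fold_state, rule ptime_fold_elem)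
      (use v(2) in \<open>auto intro!: pbounded_env[OF d] dest: table_inv_vecs\<close>)
  show "pbounded D inp (\<lambda>x. d x * order G * (d x * (order G + 1) + 1))"
    by (intro pbounded_mult pbounded_add d pbounded_const)
  show "table_inv (d x) (ins a s)" if "x \<in> D" "a \<in> set (gs x)" "table_inv (d x) s" for x a s
    by (rule ins_props(1)[OF that(3)]) (use that v(2) in blast)
qed (use v(1) size_table in auto)

lemma ptime_saturate:
  assumes T: "ptime D inp (\<lambda>x. code_tab (T x))"
    and v: "\<And>x. x \<in> D \<Longrightarrow> table_inv (d x) (T x)" and d: "pbounded D inp d"
  shows "ptime D inp (\<lambda>x. code_tab (saturate (T x)))"
  unfolding saturate_def
proof (rule ptime_fold_ins[OF _ T v products_vecs[OF table_inv_vecs[OF v]] d])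
  let ?S = "{p. fst p \<in> D \<and> snd p \<in> set (T (fst p))}"
  let ?i = "\<lambda>p. Pair (inp (fst p)) (code_vec (snd p))"
  have vec: "t \<in> vecs (d x)" if "x \<in> D" "t \<in> set (T x)" for x t
    using table_inv_vecs[OF v[OF that(1)]] that(2) by blast
  have "ptime ?S ?i (\<lambda>p. code_tab (map (vmul (snd p)) (T (fst p))))"
  proof (rule ptime_map[where h = "\<lambda>p. vmul (snd p)"])
    show T': "ptime ?S ?i (\<lambda>p. code_tab (T (fst p)))" by (rule ptime_env[OF T]) simp
    let ?S' = "{q. fst q \<in> ?S \<and> snd q \<in> set (T (fst (fst q)))}"
    show "ptime ?S' (\<lambda>q. Pair (?i (fst q)) (code_vec (snd q))) (\<lambda>q. code_vec (vmul (snd (fst q)) (snd q)))"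
    proof (rule ptime_vmul[where d = "\<lambda>q. d (fst (fst q))"])
      show "ptime ?S' (\<lambda>q. Pair (?i (fst q)) (code_vec (snd q))) (\<lambda>q. code_vec (snd (fst q)))"
        by (rule ptime_env[where F = "\<lambda>p. code_vec (snd p)" and D = ?S, OF ptime_map_elem]) simp
    qed (rule ptime_map_elem, auto intro: vec)
  qed
  then show "ptime D inp (\<lambda>x. code_tab (concat (map (\<lambda>s. map (vmul s) (T x)) (T x))))"
    by (intro ptime_concat ptime_map[where h = "\<lambda>x s. map (vmul s) (T x)", OF T])
qed

lemma ptime_table:
  assumes us: "ptime D inp (\<lambda>x. code_list X (us x))" and gens: "ptime D inp (\<lambda>x. code_tab (gens x))"
    and v: "\<And>x. x \<in> D \<Longrightarrow> set (gens x) \<subseteq> vecs (d x)" and d: "pbounded D inp d"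
  shows "ptime D inp (\<lambda>x. code_tab (table (us x) (gens x)))"
  unfolding table_def
proof (rule ptime_fold_inv[where I = "\<lambda>x. table_inv (d x)" and h = "\<lambda>_ _. saturate", OF us])
  show "ptime D inp (\<lambda>x. code_tab (fold ins (gens x) []))"
    by (rule ptime_fold_ins[OF gens ptime_Nil table_inv_Nil v d])
  let ?S = "{p. fst p \<in> D \<and> fst (snd p) \<in> set (us (fst p)) \<and> table_inv (d (fst p)) (snd (snd p))}"
  show "ptime ?S (\<lambda>p. Pair (inp (fst p)) (Pair (X (fst (snd p))) (code_tab (snd (snd p)))))
      (\<lambda>p. code_tab (saturate (snd (snd p))))"
    by (rule ptime_saturate[where d = "\<lambda>p. d (fst p)"], rule ptime_fold_state) (auto intro: pbounded_env[OF d])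
  show "pbounded D inp (\<lambda>x. d x * order G * (d x * (order G + 1) + 1))"
    by (intro pbounded_mult pbounded_add d pbounded_const)
  show "table_inv (d x) (fold ins (gens x) [])" if "x \<in> D" for x
    by (rule fold_ins_props(1)[OF table_inv_Nil v[OF that]])
qed (use size_table saturate_props(1) in auto)

section \<open>Programs for the greedy choice\<close>

definition entry_vec :: "nat \<Rightarrow> 'a list list \<times> 'a list \<Rightarrow> bool" where
  "entry_vec n E \<longleftrightarrow> set (fst E) \<subseteq> vecs n \<and> snd E \<in> vecs n"

lemma advance_vecs: "entry_vec n E \<Longrightarrow> u \<in> vecs n \<Longrightarrow> advance E u \<in> vecs n"
  by (auto simp: advance_def entry_vec_def intro: reduce_vecs)

lemma ptime_advance:
  assumes E: "ptime D inp (\<lambda>x. code_entry (E x))" and u: "ptime D inp (\<lambda>x. code_vec (u x))"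
    and v: "\<And>x. x \<in> D \<Longrightarrow> entry_vec (d x) (E x)" "\<And>x. x \<in> D \<Longrightarrow> u x \<in> vecs (d x)"
    and d: "pbounded D inp d"
  shows "ptime D inp (\<lambda>x. code_vec (advance (E x) (u x)))"
  unfolding advance_def
  by (rule ptime_reduce[where d = d], rule ptime_fst[OF E], rule ptime_vmul[where d = d], rule ptime_snd[OF E], rule u)
    (use v d in \<open>auto simp: entry_vec_def\<close>)

lemma ptime_step_entry:
  assumes ul: "ptime D inp (\<lambda>x. code_tab (ul x))" and u: "ptime D inp (\<lambda>x. code_vec (u x))"
    and E: "ptime D inp (\<lambda>x. code_entry (E x))"
    and v: "\<And>x. x \<in> D \<Longrightarrow> entry_vec (d x) (E x)" "\<And>x. x \<in> D \<Longrightarrow> u x \<in> vecs (d x)"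
      "\<And>x. x \<in> D \<Longrightarrow> set (ul x) \<subseteq> vecs (d x)" "\<And>x. x \<in> D \<Longrightarrow> ul x \<noteq> []"
    and d: "pbounded D inp d"
  shows "ptime D inp (\<lambda>x. code_entries (step_entry (ul x) (u x) (E x)))"
proof -
  have hd: "ptime D inp (\<lambda>x. code_vec (hd (ul x)))" by (rule ptime_hd[OF ul v(4)])
  have hdv: "hd (ul x) \<in> vecs (d x)" if "x \<in> D" for x
    using v(3,4)[OF that] by (auto intro: subsetD)
  have adv: "ptime D inp (\<lambda>x. code_vec (advance (E x) (u x)))" by (rule ptime_advance[OF E u v(1,2) d])
  have one: "ptime D inp (\<lambda>x. code_bool (alive (hd (ul x)) (advance (E x) (u x))))"
    by (rule ptime_alive[where d = d, OF hd adv hdv advance_vecs[OF v(1,2)]])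
  have all: "ptime D inp (\<lambda>x. code_bool (\<forall>v\<in>set (ul x). alive (hd (ul x)) (advance (E x) v)))"
  proof (rule ptime_Ball[OF ul])
    let ?S = "{p. fst p \<in> D \<and> snd p \<in> set (ul (fst p))}"
    have vec: "snd p \<in> vecs (d (fst p))" "entry_vec (d (fst p)) (E (fst p))"
      "hd (ul (fst p)) \<in> vecs (d (fst p))" if "p \<in> ?S" for p
      using that v hdv by auto
    show "ptime ?S (\<lambda>p. Pair (inp (fst p)) (code_vec (snd p)))
        (\<lambda>p. code_bool (alive (hd (ul (fst p))) (advance (E (fst p)) (snd p))))"
      by (rule ptime_alive[where d = "\<lambda>p. d (fst p)"], rule ptime_env[OF hd], simp,
          rule ptime_advance[where d = "\<lambda>p. d (fst p)"], rule ptime_env[OF E], simp, rule ptime_map_elem)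
        (auto intro: vec advance_vecs pbounded_env[OF d])
  qed
  have res: "ptime D inp (\<lambda>x. code_entry (fst (E x), advance (E x) (u x)))"
    by (rule ptime_code_pair, rule ptime_fst[OF E], rule adv)
  have "ptime D inp (\<lambda>x. if alive (hd (ul x)) (advance (E x) (u x))
      then if \<forall>v\<in>set (ul x). alive (hd (ul x)) (advance (E x) v)
           then code_entries [(fst (E x), advance (E x) (u x))]
           else code_entries [(fst (E x), advance (E x) (u x)), (fst (E x), advance (E x) (u x))]
      else code_entries [])"
    by (rule ptime_If[OF one ptime_If[OF ptime_subset[OF all]] ptime_Nil])
      (auto intro!: ptime_Cons ptime_Nil ptime_subset[OF res] simp del: code_list_simps)
  then show ?thesis by (simp only: step_entry_def if_distrib[of code_entries])
qed

lemma ptime_step_entries: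
  assumes ul: "ptime D inp (\<lambda>x. code_tab (ul x))" and u: "ptime D inp (\<lambda>x. code_vec (u x))"
    and L: "ptime D inp (\<lambda>x. code_entries (L x))"
    and v: "\<And>x E. x \<in> D \<Longrightarrow> E \<in> set (L x) \<Longrightarrow> entry_vec (d x) E" "\<And>x. x \<in> D \<Longrightarrow> u x \<in> vecs (d x)"
      "\<And>x. x \<in> D \<Longrightarrow> set (ul x) \<subseteq> vecs (d x)" "\<And>x. x \<in> D \<Longrightarrow> ul x \<noteq> []"
    and d: "pbounded D inp d"
  shows "ptime D inp (\<lambda>x. code_entries (step_entries (ul x) (L x) (u x)))"
  unfolding step_entries_def
proof (intro ptime_concat ptime_map[where h = "\<lambda>x. step_entry (ul x) (u x)", OF L])
  let ?S = "{p. fst p \<in> D \<and> snd p \<in> set (L (fst p))}"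
  show "ptime ?S (\<lambda>p. Pair (inp (fst p)) (code_entry (snd p)))
      (\<lambda>p. code_entries (step_entry (ul (fst p)) (u (fst p)) (snd p)))"
    by (rule ptime_step_entry[where d = "\<lambda>p. d (fst p)"], rule ptime_env[OF ul], simp, rule ptime_env[OF u], simp,
        rule ptime_map_elem) (auto intro: pbounded_env[OF d] v v(3)[THEN subsetD] dest: v(4))
qed

text \<open>Along a run only the vectors are new; tables are copied from the starting list
  \<open>K\<close>. Controlling the number of entries therefore controls the size.\<close>

lemma size_entries_le:
  assumes "\<And>E. E \<in> set L \<Longrightarrow> fst E \<in> fst ` set K \<and> snd E \<in> vecs n"
  shows "size (code_entries L) \<le> length L * (size (code_entries K) + n * (order G + 1) + 2)"
proof -
  have "size (code_entry E) \<le> size (code_entries K) + n * (order G + 1) + 1" if E: "E \<in> set L" for E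
  proof -
    obtain F where F: "F \<in> set K" "fst E = fst F" using assms[OF E] by auto
    have "size (code_tab (fst E)) \<le> size (code_entry F)" by (simp add: F code_pair_def)
    also have "\<dots> \<le> size (code_entries K)" by (rule size_member_code_list[OF F(1)])
    finally show ?thesis
      using size_code_vec[of "snd E" n] assms[OF E] by (simp add: code_pair_def)
  qed
  then show ?thesis
    using size_code_list_le[of L code_entry "size (code_entries K) + n * (order G + 1) + 1"] by simp
qed

lemma step_entries_props:
  assumes "\<And>E. E \<in> set L \<Longrightarrow> entry_vec n E" "u \<in> vecs n"
  shows "E \<in> set (step_entries ul L u) \<Longrightarrow> fst E \<in> fst ` set L \<and> snd E \<in> vecs n"
    and "length (step_entries ul L u) \<le> 2 * length L"
proof -
  show "fst E \<in> fst ` set L \<and> snd E \<in> vecs n" if E: "E \<in> set (step_entries ul L u)"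
  proof -
    obtain F where F: "F \<in> set L" "E \<in> set (step_entry ul u F)"
      using E unfolding step_entries_def by auto
    then have "E = (fst F, advance F u)" by (auto simp: step_entry_def split: if_splits)
    then show ?thesis using F(1) advance_vecs[OF assms(1)[OF F(1)] assms(2)] by simp
  qed
  have "length (step_entry ul u E) \<le> 2" for E by (simp add: step_entry_def)
  then show "length (step_entries ul L u) \<le> 2 * length L"
    unfolding step_entries_def length_concat map_map comp_def
    using sum_list_mono[of L "\<lambda>E. length (step_entry ul u E)" "\<lambda>_. 2"] by (simp add: sum_list_triv mult.commute)
qed

lemma ptime_choose_unit:
  assumes ul: "ptime D inp (\<lambda>x. code_tab (ul x))" and L: "ptime D inp (\<lambda>x. code_entries (L x))"
    and v: "\<And>x E. x \<in> D \<Longrightarrow> E \<in> set (L x) \<Longrightarrow> entry_vec (d x) E"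
      "\<And>x. x \<in> D \<Longrightarrow> set (ul x) \<subseteq> vecs (d x)" "\<And>x. x \<in> D \<Longrightarrow> ul x \<noteq> []"
    and d: "pbounded D inp d"
  shows "ptime D inp (\<lambda>x. code_pair code_entries code_vec (choose_unit (ul x) (L x)))"
  unfolding choose_unit_def
\<comment> \<open>The invariant expresses the state through the chosen unit: each candidate list is
  computed afresh from \<open>L x\<close>, so sizes do not compound over the loop.\<close>
proof (rule ptime_fold_inv[where h = "\<lambda>x. better (ul x) (L x)" and
      I = "\<lambda>x s. snd s \<in> set (ul x) \<and> s = (step_entries (ul x) (L x) (snd s), snd s)", OF ul])
  have hdv: "hd (ul x) \<in> vecs (d x)" if "x \<in> D" for x
    using v(2,3)[OF that] by (auto intro: subsetD)
  have hd: "ptime D inp (\<lambda>x. code_vec (hd (ul x)))" by (rule ptime_hd[OF ul v(3)])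
  show "ptime D inp (\<lambda>x. code_pair code_entries code_vec (step_entries (ul x) (L x) (hd (ul x)), hd (ul x)))"
    by (rule ptime_code_pair, rule ptime_step_entries[where d = d, OF ul hd L])
      (use v hdv d hd in auto)
  let ?S = "{p. fst p \<in> D \<and> fst (snd p) \<in> set (ul (fst p)) \<and> (snd (snd (snd p)) \<in> set (ul (fst p)) \<and>
      snd (snd p) = (step_entries (ul (fst p)) (L (fst p)) (snd (snd (snd p))), snd (snd (snd p))))}"
  let ?i = "\<lambda>p. Pair (inp (fst p)) (Pair (code_vec (fst (snd p))) (code_pair code_entries code_vec (snd (snd p))))"
  have st: "ptime ?S ?i (\<lambda>p. code_pair code_entries code_vec (snd (snd p)))" by (rule ptime_fold_state)
  have new: "ptime ?S ?i (\<lambda>p. code_entries (step_entries (ul (fst p)) (L (fst p)) (fst (snd p))))"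
    by (rule ptime_step_entries[where d = "\<lambda>p. d (fst p)"], rule ptime_env[OF ul], simp, rule ptime_fold_elem,
        rule ptime_env[OF L]) (auto intro: pbounded_env[OF d] v v(2)[THEN subsetD] dest: v(3))
  have "ptime ?S ?i (\<lambda>p. if length (step_entries (ul (fst p)) (L (fst p)) (fst (snd p))) \<le> length (fst (snd (snd p)))
     then code_pair code_entries code_vec (step_entries (ul (fst p)) (L (fst p)) (fst (snd p)), fst (snd p))
     else code_pair code_entries code_vec (snd (snd p)))"
  proof (rule ptime_If)
    show "ptime ?S ?i (\<lambda>p. code_bool (length (step_entries (ul (fst p)) (L (fst p)) (fst (snd p))) \<le> length (fst (snd (snd p)))))"
      by (rule ptime_length_le, rule ptime_fst[OF st], rule new)
  qed (rule ptime_code_pair ptime_fold_elem ptime_subset[OF new] ptime_subset[OF st]; blast?)+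
  then show "ptime ?S ?i (\<lambda>p. code_pair code_entries code_vec (better (ul (fst p)) (L (fst p)) (fst (snd p)) (snd (snd p))))"
    by (simp only: better_def if_distrib[of "code_pair code_entries code_vec"])
  show "pbounded D inp (\<lambda>x. 2 * size (code_entries (L x)) * (size (code_entries (L x)) + d x * (order G + 1) + 2)
      + d x * (order G + 1) + 1)"
    by (intro pbounded_add pbounded_mult pbounded_const d ptime_size[OF L])
  fix x s assume x: "x \<in> D" and s: "snd s \<in> set (ul x) \<and> s = (step_entries (ul x) (L x) (snd s), snd s)"
  have u: "snd s \<in> vecs (d x)" using s v(2)[OF x] by blast
  note sp = step_entries_props[where L = "L x" and ul = "ul x", OF v(1)[OF x] u]
  have fs: "fst s = step_entries (ul x) (L x) (snd s)" using s by (cases s) auto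
  have "size (code_entries (fst s)) \<le> length (fst s) * (size (code_entries (L x)) + d x * (order G + 1) + 2)"
    unfolding fs by (rule size_entries_le[OF sp(1)])
  also have "\<dots> \<le> 2 * size (code_entries (L x)) * (size (code_entries (L x)) + d x * (order G + 1) + 2)"
    unfolding fs using sp(2) length_le_size_code_list[of "L x" code_entry] by (intro mult_right_mono) simp_all
  finally show "size (code_pair code_entries code_vec s) \<le>
      2 * size (code_entries (L x)) * (size (code_entries (L x)) + d x * (order G + 1) + 2) + d x * (order G + 1) + 1"
    using size_code_vec[OF u] by (simp add: code_pair_def)
qed (use v(3) in \<open>auto simp: better_def\<close>)

end

section \<open>Logarithms and masks\<close>

lemma encode_unary_code_list: "encode_unary k = code_list (\<lambda>_::unit. Leaf) (replicate k ())"
  by (simp add: encode_unary_def code_list_def)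

lemma ptime_unary_add:
  assumes "ptime D inp (\<lambda>x. encode_unary (a x))" "ptime D inp (\<lambda>x. encode_unary (b x))"
  shows "ptime D inp (\<lambda>x. encode_unary (a x + b x))"
  using ptime_append[OF assms[unfolded encode_unary_code_list]]
  by (simp add: encode_unary_code_list replicate_add)

lemma ptime_unary_le:
  assumes "ptime D inp (\<lambda>x. encode_unary (a x))" "ptime D inp (\<lambda>x. encode_unary (b x))"
  shows "ptime D inp (\<lambda>x. code_bool (a x \<le> b x))"
  using ptime_length_le[OF assms(2,1)[unfolded encode_unary_code_list]] by simp

lemma ptime_unary_mult_const:
  assumes "ptime D inp (\<lambda>x. encode_unary (a x))"
  shows "ptime D inp (\<lambda>x. encode_unary (A * a x))"
  by (induction A) (auto simp: ptime_const intro!: ptime_unary_add assms)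

definition bit_count_step :: "nat \<Rightarrow> nat \<times> nat \<Rightarrow> nat \<times> nat" where
  "bit_count_step n s = (if snd s \<le> n then (Suc (fst s), snd s + snd s) else s)"

text \<open>The bit length of \<open>n\<close>, a logarithm computed in unary by repeated doubling.
  \<open>n\<close> rounds suffice since \<open>n < 2 ^ n\<close>.\<close>

definition bit_count :: "nat \<Rightarrow> nat" where
  "bit_count n = fst (fold (\<lambda>_. bit_count_step n) (replicate n ()) (0, 1))"

lemma bit_count_inv:
  fixes ys :: "unit list"
  shows "(let s = fold (\<lambda>_. bit_count_step n) ys (0, 1) in snd s = 2 ^ fst s \<and> snd s \<le> 2 * n + 1 \<and>
    (n < snd s \<or> fst s = length ys))"
  by (induction ys rule: rev_induct) (auto simp: bit_count_step_def Let_def)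

lemma bit_count_bounds: "n < 2 ^ bit_count n" "2 ^ bit_count n \<le> 2 * n + 1"
proof -
  note inv = bit_count_inv[of n "replicate n ()", unfolded Let_def, folded bit_count_def]
  show "2 ^ bit_count n \<le> 2 * n + 1" using inv by simp
  show "n < 2 ^ bit_count n" using inv less_exp[of n] by auto
qed

lemma ptime_bit_count:
  assumes "ptime D inp (\<lambda>x. encode_unary (n x))"
  shows "ptime D inp (\<lambda>x. encode_unary (bit_count (n x)))"
proof -
  let ?Z = "code_pair encode_unary encode_unary"
  have "ptime D inp (\<lambda>x. ?Z (fold (\<lambda>_. bit_count_step (n x)) (replicate (n x) ()) (0, 1)))"
  proof (rule ptime_fold_inv[where h = "\<lambda>x _. bit_count_step (n x)" and
        I = "\<lambda>x s. snd s = 2 ^ fst s \<and> snd s \<le> 2 * n x + 1", OF assms[unfolded encode_unary_code_list] ptime_const])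
    let ?S = "{p. fst p \<in> D \<and> fst (snd p) \<in> set (replicate (n (fst p)) ()) \<and>
      (snd (snd (snd p)) = 2 ^ fst (snd (snd p)) \<and> snd (snd (snd p)) \<le> 2 * n (fst p) + 1)}"
    let ?i = "\<lambda>p. Pair (inp (fst p)) (Pair Leaf (?Z (snd (snd p))))"
    have st: "ptime ?S ?i (\<lambda>p. ?Z (snd (snd p)))"
      by (rule ptime_sel[of _ _ "[True, True]"]) simp
    have n: "ptime ?S ?i (\<lambda>p. encode_unary (n (fst p)))" by (rule ptime_env[OF assms]) simp
    have suc: "ptime ?S ?i (\<lambda>p. encode_unary (Suc (fst (snd (snd p)))))"
      using ptime_unary_add[OF ptime_const[where c = "encode_unary 1"] ptime_fst[OF st]] by simp
    have "ptime ?S ?i (\<lambda>p. if snd (snd (snd p)) \<le> n (fst p)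
        then ?Z (Suc (fst (snd (snd p))), snd (snd (snd p)) + snd (snd (snd p))) else ?Z (snd (snd p)))"
    proof (rule ptime_If)
      show "ptime ?S ?i (\<lambda>p. code_bool (snd (snd (snd p)) \<le> n (fst p)))"
        by (rule ptime_unary_le[OF ptime_snd[OF st] n])
    qed (rule ptime_code_pair ptime_unary_add ptime_subset[OF suc] ptime_subset[OF ptime_snd[OF st]] ptime_subset[OF st]; blast?)+
    then show "ptime ?S ?i (\<lambda>p. ?Z (bit_count_step (n (fst p)) (snd (snd p))))"
      by (simp only: bit_count_step_def if_distrib[of ?Z])
    have "ptime D inp (\<lambda>x. encode_unary (n x))" by (rule assms)
    from ptime_size[OF this] show "pbounded D inp (\<lambda>x. 4 * n x + 3)"
      by (intro pbounded_add pbounded_mult pbounded_const) (simp add: size_encode_unary)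
    show "size (?Z s) \<le> 4 * n x + 3" if "snd s = 2 ^ fst s \<and> snd s \<le> 2 * n x + 1" for x s
    proof -
      have "fst s < snd s" using that less_exp[of "fst s"] by metis
      then have "fst s + snd s + 1 \<le> 4 * n x + 3" using that by linarith
      then show ?thesis by (simp add: code_pair_def size_encode_unary)
    qed
  qed (auto simp: bit_count_step_def)
  from ptime_fst[OF this] show ?thesis by (simp add: bit_count_def)
qed

definition masks :: "nat \<Rightarrow> bool list list" where
  "masks k = fold (\<lambda>_ ms. map (Cons False) ms @ map (Cons True) ms) (replicate k ()) [[]]"

lemma masks_0: "masks 0 = [[]]"
  by (simp add: masks_def)

lemma masks_Suc: "masks (Suc k) = map (Cons False) (masks k) @ map (Cons True) (masks k)"
proof -
  have "replicate (Suc k) () = replicate k () @ [()]" by (simp add: replicate_append_same)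
  then show ?thesis unfolding masks_def by (simp only: fold_append o_def fold.simps id_apply)
qed

lemma length_masks: "length (masks k) = 2 ^ k"
  by (induction k) (simp_all add: masks_0 masks_Suc)

lemma set_masks: "set (masks k) = {m. length m = k}"
proof (induction k)
  case (Suc k)
  have "m \<in> set (masks (Suc k)) \<longleftrightarrow> length m = Suc k" for m
  proof (cases m)
    case (Cons b l)
    then show ?thesis by (cases b) (auto simp: masks_Suc Suc image_iff)
  qed (auto simp: masks_Suc)
  then show ?case by blast
qed (simp add: masks_0)

text \<open>All \<open>2 ^ k x\<close> masks are written out, so \<open>k x\<close> must be
  logarithmic in the input; this is the content of \<open>bd\<close>.\<close>

lemma ptime_masks:
  assumes k: "ptime D inp (\<lambda>x. encode_unary (k x))" and bd: "pbounded D inp (\<lambda>x. 2 ^ k x)"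
  shows "ptime D inp (\<lambda>x. code_list (code_list code_bool) (masks (k x)))"
  unfolding masks_def
proof (rule ptime_fold[where h = "\<lambda>_ _ ms. map (Cons False) ms @ map (Cons True) ms" and S = UNIV,
      OF k[unfolded encode_unary_code_list] ptime_const])
  let ?C = "code_list (code_list code_bool)"
  let ?i = "\<lambda>p. Pair (inp (fst p)) (Pair Leaf (?C (snd (snd p))))"
  have "ptime UNIV ?i (\<lambda>p. ?C (map (Cons b) (snd (snd p))))" for b
  proof (rule ptime_map[where h = "\<lambda>_. Cons b"])
    show "ptime UNIV ?i (\<lambda>p. ?C (snd (snd p)))" by (rule ptime_sel[of _ _ "[True, True]"]) simp
    show "ptime {p. fst p \<in> UNIV \<and> snd p \<in> set (snd (snd (fst p)))}
        (\<lambda>p. Pair (?i (fst p)) (code_list code_bool (snd p))) (\<lambda>p. code_list code_bool (b # snd p))"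
      by (rule ptime_Cons, rule ptime_const, rule ptime_map_elem)
  qed
  then show "ptime UNIV ?i (\<lambda>p. ?C (map (Cons False) (snd (snd p)) @ map (Cons True) (snd (snd p))))"
    by (intro ptime_append)
  show "pbounded D inp (\<lambda>x. 2 ^ k x * (2 ^ k x * 2 + 1))" by (intro pbounded_mult pbounded_add bd pbounded_const)
  show "size (?C (fold (\<lambda>_ ms. map (Cons False) ms @ map (Cons True) ms) ys [[]])) \<le> 2 ^ k x * (2 ^ k x * 2 + 1)"
    if "replicate (k x) () = ys @ zs" for x ys zs
  proof -
    define m where "m = length ys"
    have ys: "ys = replicate m ()" unfolding m_def by (rule replicate_eqI) auto
    have mk: "m \<le> k x" using arg_cong[OF that, of length] by (simp add: m_def)
    have "size (?C (masks m)) \<le> length (masks m) * (m * 2 + 1)"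
    proof (rule size_code_list_le)
      fix v assume "v \<in> set (masks m)"
      then have "length v = m" by (simp add: set_masks)
      moreover have "size (code_list code_bool v) \<le> length v * (1 + 1)"
        by (rule size_code_list_le) (simp add: code_bool_def)
      ultimately show "size (code_list code_bool v) \<le> m * 2" by simp
    qed
    moreover have "m \<le> 2 ^ k x" by (rule order.trans[OF mk less_imp_le[OF less_exp]])
    then have "length (masks m) * (m * 2 + 1) \<le> 2 ^ k x * (2 ^ k x * 2 + 1)"
      using power_increasing[OF mk, of "2 :: nat"]
      by (intro mult_mono add_mono) (simp_all add: length_masks)
    ultimately show ?thesis by (simp add: masks_def ys)
  qed
qed auto

text \<open>Adds to \<open>gens\<close> the units at all positions whose residue modulo the mask
  length is selected. Rotating the mask once per position brings the bit of the current residue to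
  the front, so residue classes are read off without index arithmetic, unlike intervals.\<close>

definition mask_gens :: "'v list list \<Rightarrow> bool list \<Rightarrow> 'v list \<Rightarrow> 'v list" where
  "mask_gens us bs gens = snd (fold (\<lambda>ul s. (rotate1 (fst s),
     if fst s \<noteq> [] \<and> hd (fst s) then ul @ snd s else snd s)) us (bs, gens))"

lemma set_mask_gens:
  assumes "bs \<noteq> []"
  shows "set (mask_gens us bs gens) = set gens \<union> (\<Union>p\<in>{p. p < length us \<and> bs ! (p mod length bs)}. set (us ! p))"
proof -
  let ?h = "\<lambda>ul s. (rotate1 (fst s), if fst s \<noteq> [] \<and> hd (fst s) then ul @ snd s else snd s)"
  have "fst (fold ?h us (bs, gens)) = rotate (length us) bs \<and>
    set (snd (fold ?h us (bs, gens))) =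
      set gens \<union> (\<Union>p\<in>{p. p < length us \<and> bs ! (p mod length bs)}. set (us ! p))"
  proof (induction us rule: rev_induct)
    case (snoc u us)
    have hd: "hd (rotate (length us) bs) = bs ! (length us mod length bs)"
      by (rule hd_rotate_conv_nth[OF assms])
    have "{p. p < length (us @ [u]) \<and> bs ! (p mod length bs)} =
      {p. p < length us \<and> bs ! (p mod length bs)} \<union>
      (if bs ! (length us mod length bs) then {length us} else {})"
      by (auto simp: less_Suc_eq)
    then show ?case using snoc hd assms by (auto simp: nth_append)
  qed simp
  then show ?thesis by (simp add: mask_gens_def)
qed

lemma ptime_rotate1:
  assumes "ptime D inp (\<lambda>x. code_list X (l x))"
  shows "ptime D inp (\<lambda>x. code_list X (rotate1 (l x)))"
proof -
  have "ptime D inp (\<lambda>x. if code_list X (l x) \<noteq> Leaf then code_list X (tl (l x) @ [hd (l x)]) else Leaf)"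
    by (rule ptime_if[OF assms], rule ptime_append, rule ptime_tl, rule ptime_subset[OF assms], blast,
        rule ptime_Cons, rule ptime_hd, rule ptime_subset[OF assms], blast, simp, rule ptime_Nil, rule ptime_const)
  then show ?thesis
  proof (rule ptime_cong)
    show "code_list X (rotate1 (l x)) = (if code_list X (l x) \<noteq> Leaf then code_list X (tl (l x) @ [hd (l x)]) else Leaf)" for x
      by (cases "l x") auto
  qed
qed

lemma size_rotate1: "size (code_list X (rotate1 xs)) = size (code_list X xs)"
  by (cases xs) (simp_all add: size_code_list_append)

lemma ptime_mask_gens:
  assumes us: "ptime D inp (\<lambda>x. code_list (code_list X) (us x))"
    and bs: "ptime D inp (\<lambda>x. code_list code_bool (bs x))"
    and gens: "ptime D inp (\<lambda>x. code_list X (gens x))"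
  shows "ptime D inp (\<lambda>x. code_list X (mask_gens (us x) (bs x) (gens x)))"
proof -
  let ?Z = "code_pair (code_list code_bool) (code_list X)"
  let ?h = "\<lambda>ul s. (rotate1 (fst s), if fst s \<noteq> [] \<and> hd (fst s) then ul @ snd s else snd s)"
  have "ptime D inp (\<lambda>x. ?Z (fold ?h (us x) (bs x, gens x)))"
  proof (rule ptime_fold[where h = "\<lambda>_. ?h" and S = UNIV, OF us ptime_code_pair[where X = "code_list code_bool" and Y = "code_list X", OF bs gens]])
    let ?i = "\<lambda>p. Pair (inp (fst p)) (Pair (code_list X (fst (snd p))) (?Z (snd (snd p))))"
    have st: "ptime UNIV ?i (\<lambda>p. ?Z (snd (snd p)))" by (rule ptime_fold_state)
    have test: "ptime UNIV ?i (\<lambda>p. code_bool (fst (snd (snd p)) \<noteq> [] \<and> hd (fst (snd (snd p)))))"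
    proof (rule ptime_cong[OF ptime_left[OF ptime_fst[OF st]]])
      show "code_bool (fst (snd (snd p)) \<noteq> [] \<and> hd (fst (snd (snd p)))) =
        left (code_list code_bool (fst (snd (snd p))))" for p :: "'a \<times> 'b list \<times> bool list \<times> 'b list"
        by (cases "fst (snd (snd p))") (auto simp: code_bool_def)
    qed
    have "ptime UNIV ?i (\<lambda>p. if fst (snd (snd p)) \<noteq> [] \<and> hd (fst (snd (snd p)))
      then code_list X (fst (snd p) @ snd (snd (snd p))) else code_list X (snd (snd (snd p))))"
      by (rule ptime_If[OF test], rule ptime_append, rule ptime_fold_elem, rule ptime_subset[OF ptime_snd[OF st]], blast,
          rule ptime_subset[OF ptime_snd[OF st]], blast)
    then have "ptime UNIV ?i (\<lambda>p. code_list X (if fst (snd (snd p)) \<noteq> [] \<and> hd (fst (snd (snd p)))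
      then fst (snd p) @ snd (snd (snd p)) else snd (snd (snd p))))"
      by (simp only: if_distrib[of "code_list X"])
    then show "ptime UNIV ?i (\<lambda>p. ?Z (?h (fst (snd p)) (snd (snd p))))"
      by (intro ptime_code_pair ptime_rotate1 ptime_fst[OF st])
    show "pbounded D inp (\<lambda>x. size (code_list code_bool (bs x)) + size (code_list (code_list X) (us x)) +
        size (code_list X (gens x)) + 1)"
      by (intro pbounded_add pbounded_const ptime_size[OF us] ptime_size[OF bs] ptime_size[OF gens])
    have size: "size (?Z (fold ?h ys s)) \<le> size (?Z s) + size (code_list (code_list X) ys)" for ys s
    proof (induction ys arbitrary: s)
      case (Cons y ys)
      have "size (?Z (?h y s)) \<le> size (?Z s) + size (code_list X y)"
        by (simp add: code_pair_def size_rotate1 size_code_list_append)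
      then show ?case using Cons[of "?h y s"] by simp
    qed simp
    show "size (?Z (fold ?h ys (bs x, gens x))) \<le> size (code_list code_bool (bs x)) +
        size (code_list (code_list X) (us x)) + size (code_list X (gens x)) + 1"
      if "us x = ys @ zs" for x ys zs
      using size[of ys "(bs x, gens x)"] that by (simp add: code_pair_def size_code_list_append)
  qed auto
  from ptime_snd[OF this] show ?thesis by (simp add: mask_gens_def)
qed

context coded_group begin

section \<open>The remote point\<close>

definition units :: "nat \<Rightarrow> 'a list list list" where
  "units n = map (unit_list n) [0..<n]"

text \<open>Dimension grows by prepending: the units at the new position 0 come first, the old ones
  are shifted by one. The first component supplies the trivial vector that the new units
  extend.\<close>

definition units_step :: "'a list \<times> 'a list list list \<Rightarrow> 'a list \<times> 'a list list list" where
  "units_step s = (\<one> # fst s, map (\<lambda>a. a # fst s) els # map (map (Cons \<one>)) (snd s))"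

lemma units_fold:
  fixes ys :: "'c list"
  shows "fold (\<lambda>_. units_step) ys ([], []) = (vone (length ys), units (length ys))"
proof (induction ys rule: rev_induct)
  case (snoc y ys)
  have "unit (Suc m) 0 a = a # vone m" for m a
    by (simp add: unit_def vone_def)
  moreover have "unit (Suc m) (Suc i) a = \<one> # unit m i a" for m i a
    by (simp add: unit_def vone_def)
  ultimately have "units (Suc m) = map (\<lambda>a. a # vone m) els # map (map (Cons \<one>)) (units m)" for m
    unfolding units_def by (simp add: upt_conv_Cons map_Suc_upt[symmetric] unit_list_def comp_def del: upt_Suc)
  then show ?case using snoc by (simp add: units_step_def vone_def)
qed (simp add: units_def vone_def)

lemma set_units_vecs: "ul \<in> set (units n) \<Longrightarrow> set ul \<subseteq> vecs n"
  by (auto simp: units_def set_unit_list unit_vecs)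

lemma size_units: "size (code_list code_tab (units n)) \<le> n * (order G * (n * (order G + 1) + 1) + 1)"
proof -
  have "size (code_list code_tab (units n)) \<le> length (units n) * (order G * (n * (order G + 1) + 1) + 1)"
  proof (rule size_code_list_le)
    fix ul assume ul: "ul \<in> set (units n)"
    then have "length ul = order G" by (auto simp: units_def unit_list_def length_els)
    then show "size (code_tab ul) \<le> order G * (n * (order G + 1) + 1)"
      using size_code_tab[OF set_units_vecs[OF ul]] by simp
  qed
  then show ?thesis by (simp add: units_def)
qed

lemma ptime_units:
  assumes n: "ptime D inp (\<lambda>x. encode_unary (n x))"
  shows "ptime D inp (\<lambda>x. code_pair code_vec (code_list code_tab) (vone (n x), units (n x)))"
proof -
  let ?Z = "code_pair code_vec (code_list code_tab)"
  have "ptime D inp (\<lambda>x. ?Z (fold (\<lambda>_. units_step) (replicate (n x) ()) ([], [])))"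
  proof (rule ptime_fold[where h = "\<lambda>_ _. units_step" and S = UNIV, OF n[unfolded encode_unary_code_list] ptime_const])
    let ?i = "\<lambda>p. Pair (inp (fst p)) (Pair Leaf (?Z (snd (snd p))))"
    have st: "ptime UNIV ?i (\<lambda>p. ?Z (snd (snd p)))" by (rule ptime_sel[of _ _ "[True, True]"]) simp
    have one: "ptime UNIV ?i (\<lambda>p. code_vec (fst (snd (snd p))))" by (rule ptime_fst[OF st])
    have us: "ptime UNIV ?i (\<lambda>p. code_list code_tab (snd (snd (snd p))))" by (rule ptime_snd[OF st])
    have a: "ptime UNIV ?i (\<lambda>p. code_vec (\<one> # fst (snd (snd p))))"
      by (rule ptime_Cons, rule ptime_const, rule one)
    have b: "ptime UNIV ?i (\<lambda>p. code_tab (map (\<lambda>a. a # fst (snd (snd p))) els))"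
    proof (rule ptime_map[where h = "\<lambda>p a. a # fst (snd (snd p))" and X = code_el and l = "\<lambda>_. els"])
      show "ptime {q. fst q \<in> UNIV \<and> snd q \<in> set els} (\<lambda>q. Pair (?i (fst q)) (code_el (snd q)))
        (\<lambda>q. code_vec (snd q # fst (snd (snd (fst q)))))"
        by (rule ptime_Cons, rule ptime_map_elem, rule ptime_env[OF one], simp)
    qed (rule ptime_const)
    have c: "ptime UNIV ?i (\<lambda>p. code_list code_tab (map (map (Cons \<one>)) (snd (snd (snd p)))))"
    proof (rule ptime_map[where h = "\<lambda>_. map (Cons \<one>)", OF us])
      let ?S = "{q. fst q \<in> UNIV \<and> snd q \<in> set (snd (snd (snd (fst q))))}"
      let ?j = "\<lambda>q. Pair (?i (fst q)) (code_tab (snd q))"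
      show "ptime ?S ?j (\<lambda>q. code_tab (map (Cons \<one>) (snd q)))"
      proof (rule ptime_map[where h = "\<lambda>_. Cons \<one>", OF ptime_map_elem])
        show "ptime {r. fst r \<in> ?S \<and> snd r \<in> set (snd (fst r))} (\<lambda>r. Pair (?j (fst r)) (code_vec (snd r)))
          (\<lambda>r. code_vec (\<one> # snd r))"
          by (rule ptime_Cons, rule ptime_const, rule ptime_map_elem)
      qed
    qed
    show "ptime UNIV ?i (\<lambda>p. ?Z (units_step (snd (snd p))))"
      unfolding units_step_def by (rule ptime_code_pair, rule a, rule ptime_Cons, rule b, rule c)
    let ?B = "\<lambda>n. n * (order G + 1) + n * (order G * (n * (order G + 1) + 1) + 1) + 1"
    have "pbounded D inp n" using ptime_size[OF n] by (simp add: size_encode_unary)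
    then show "pbounded D inp (\<lambda>x. ?B (n x))" by (intro pbounded_add pbounded_mult pbounded_const)
    show "size (?Z (fold (\<lambda>_. units_step) ys ([], []))) \<le> ?B (n x)" if "replicate (n x) () = ys @ zs" for x ys zs
    proof -
      let ?m = "length ys"
      have m: "?m \<le> n x" using arg_cong[OF that, of length] by simp
      have "size (?Z (vone ?m, units ?m)) \<le> ?B ?m"
        using size_code_vec[OF vone_vecs, of ?m] size_units[of ?m] by (simp add: code_pair_def)
      also have "\<dots> \<le> ?B (n x)" using m by (intro add_mono mult_mono) auto
      finally show ?thesis by (simp add: units_fold)
    qed
  qed auto
  then show ?thesis by (simp only: units_fold length_replicate)
qed

text \<open>A single step may double the list, so no local estimate prevents exponential growth. The
  bound comes from the averaging argument in \<open>greedy_state_props\<close>; for this reason the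
  states are described exactly, as greedy states, and not by a syntactic invariant.\<close>

lemma ptime_greedy:
  assumes us: "ptime D inp (\<lambda>x. code_list code_tab (units (n x)))" and one: "ptime D inp (\<lambda>x. code_vec (vone (n x)))"
    and L: "ptime D inp (\<lambda>x. code_entries (L x))"
    and ok: "\<And>x E. x \<in> D \<Longrightarrow> E \<in> set (L x) \<Longrightarrow> entry_ok (n x) 0 E"
    and n: "pbounded D inp n"
  shows "ptime D inp (\<lambda>x. code_pair code_entries code_vec (greedy_state (n x) (L x) (n x)))"
proof -
  let ?Z = "code_pair code_entries code_vec"
  let ?S = "{p. fst p \<in> D \<and> (\<exists>m<n (fst p). fst (snd p) = unit_list (n (fst p)) m \<and>
    snd (snd p) = greedy_state (n (fst p)) (L (fst p)) m)}"
  have prefix: "\<exists>m\<le>n x. ys = map (unit_list (n x)) [0..<m] \<and> m = length ys" if "units (n x) = ys @ zs" for x ys zs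
  proof -
    have "length ys \<le> n x" using arg_cong[OF that, of length] by (simp add: units_def)
    moreover have "ys = take (length ys) (units (n x))" using that by simp
    ultimately show ?thesis by (auto simp: units_def take_map)
  qed
  have "ptime D inp (\<lambda>x. ?Z (fold choose_step (units (n x)) (L x, vone (n x))))"
  proof (rule ptime_fold[where h = "\<lambda>_. choose_step" and S = ?S, OF us])
    show "ptime D inp (\<lambda>x. ?Z (L x, vone (n x)))" by (rule ptime_code_pair, rule L, rule one)
    let ?i = "\<lambda>p. Pair (inp (fst p)) (Pair (code_tab (fst (snd p))) (?Z (snd (snd p))))"
    have st: "ptime ?S ?i (\<lambda>p. ?Z (snd (snd p)))" by (rule ptime_fold_state)
    have ul: "set (fst (snd p)) \<subseteq> vecs (n (fst p))" "fst (snd p) \<noteq> []"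
      and ent: "\<And>E. E \<in> set (fst (snd (snd p))) \<Longrightarrow> entry_vec (n (fst p)) E"
      and vec: "snd (snd (snd p)) \<in> vecs (n (fst p))" if p: "p \<in> ?S" for p
    proof -
      obtain m where m: "m < n (fst p)" "fst (snd p) = unit_list (n (fst p)) m"
        "snd (snd p) = greedy_state (n (fst p)) (L (fst p)) m" and D: "fst p \<in> D" using p by blast
      show "set (fst (snd p)) \<subseteq> vecs (n (fst p))" by (auto simp: m(2) set_unit_list unit_vecs)
      show "fst (snd p) \<noteq> []" by (simp add: m(2) unit_list_def els)
      note props = greedy_state_props[OF ok[OF D] less_imp_le[OF m(1)]]
      show "snd (snd (snd p)) \<in> vecs (n (fst p))" using props(1) by (simp add: m(3))
      show "entry_vec (n (fst p)) E" if "E \<in> set (fst (snd (snd p)))" for E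
        using props(2)[where E = E] that good_tableD(1) by (auto simp: m(3) entry_vec_def entry_ok_def)
    qed
    have nn: "pbounded ?S ?i (\<lambda>p. n (fst p))" by (rule pbounded_env[OF n]) blast
    have B: "ptime ?S ?i (\<lambda>p. ?Z (choose_unit (fst (snd p)) (fst (snd (snd p)))))"
      by (rule ptime_choose_unit[where d = "\<lambda>p. n (fst p)"], rule ptime_fold_elem, rule ptime_fst[OF st])
        (use ul ent nn in blast)+
    have "ptime ?S ?i (\<lambda>p. ?Z (fst (choose_unit (fst (snd p)) (fst (snd (snd p)))),
        vmul (snd (snd (snd p))) (snd (choose_unit (fst (snd p)) (fst (snd (snd p)))))))"
    proof (rule ptime_code_pair, rule ptime_fst[OF B], rule ptime_vmul[where d = "\<lambda>p. n (fst p)"],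
        rule ptime_snd[OF st], rule ptime_snd[OF B])
      show "snd (choose_unit (fst (snd p)) (fst (snd (snd p)))) \<in> vecs (n (fst p))" if "p \<in> ?S" for p
        by (rule choose_unit_props[OF ul(2)[OF that], of "fst (snd (snd p))"]) (use ul(1)[OF that] in auto)
    qed (rule vec)
    then show "ptime ?S ?i (\<lambda>p. ?Z (choose_step (fst (snd p)) (snd (snd p))))"
      by (simp only: choose_step_def Let_def)
    show "(x, a, fold choose_step ys (L x, vone (n x))) \<in> ?S" if x: "x \<in> D" and s: "units (n x) = ys @ a # zs" for x ys a zs
    proof -
      obtain m where m: "ys = map (unit_list (n x)) [0..<m]" "m = length ys" using prefix[OF s] by blast
      have len: "m < n x" using arg_cong[OF s, of length] m(2) by (simp add: units_def)
      have "a = units (n x) ! m" using s m(2) by (simp add: nth_append)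
      then show ?thesis using m(1) x len by (auto simp: units_def greedy_state_def)
    qed
    let ?B = "\<lambda>x. size (code_entries (L x)) * (size (code_entries (L x)) + n x * (order G + 1) + 2) +
      n x * (order G + 1) + 1"
    show "pbounded D inp ?B" by (intro pbounded_add pbounded_mult pbounded_const n ptime_size[OF L])
    show "size (?Z (fold choose_step ys (L x, vone (n x)))) \<le> ?B x" if x: "x \<in> D" and s: "units (n x) = ys @ zs" for x ys zs
    proof -
      obtain m where m: "m \<le> n x" "ys = map (unit_list (n x)) [0..<m]" using prefix[OF s] by blast
      define T where "T = greedy_state (n x) (L x) m"
      note props = greedy_state_props[where L = "L x" and n = "n x" and m = m, OF ok[OF x] m(1), folded T_def]
      have "size (code_entries (fst T)) \<le> length (fst T) * (size (code_entries (L x)) + n x * (order G + 1) + 2)"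
        by (rule size_entries_le) (use props(2) in \<open>auto simp: entry_ok_def\<close>)
      also have "\<dots> \<le> size (code_entries (L x)) * (size (code_entries (L x)) + n x * (order G + 1) + 2)"
        using props(3) length_le_size_code_list[of "L x" code_entry] by (intro mult_right_mono) simp_all
      finally have "size (?Z T) \<le> ?B x" using size_code_vec[OF props(1)] by (simp add: code_pair_def)
      then show ?thesis by (simp add: T_def greedy_state_def m(2))
    qed
  qed
  then show ?thesis by (simp add: greedy_state_def units_def)
qed

definition initial_entries :: "nat \<Rightarrow> nat \<Rightarrow> 'a list list \<Rightarrow> ('a list list \<times> 'a list) list" where
  "initial_entries k n gens =
     map (\<lambda>m. (table (concat (units n)) (mask_gens (units n) m gens), vone n)) (masks k)"

text \<open>\<open>A\<close> is a constant built into the program. \<open>bit_count n\<close> is a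
  logarithm that the program can compute, and a large \<open>A\<close> makes the number of classes a
  large multiple of the radius bound.\<close>

definition remote_point :: "nat \<Rightarrow> nat \<Rightarrow> 'a list list \<Rightarrow> 'a list" where
  "remote_point A n gens = snd (greedy_state n (initial_entries (A * bit_count n) n gens) n)"

lemma mask_gens_vecs:
  assumes "set gens \<subseteq> vecs n"
  shows "set (mask_gens (units n) m gens) \<subseteq> vecs n"
proof (cases "m = []")
  case True
  have "fold (\<lambda>ul s. (rotate1 (fst s), if fst s \<noteq> [] \<and> hd (fst s) then ul @ snd s else snd s)) us ([], gens)
    = ([], gens)" for us
    by (induction us) auto
  then show ?thesis using True assms by (simp add: mask_gens_def)
next
  case False
  have "set (units n ! p) \<subseteq> vecs n" if "p < length (units n)" for p
    using set_units_vecs[OF nth_mem[OF that]] .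
  then show ?thesis using assms by (auto simp: set_mask_gens[OF False])
qed

lemma length_concat_units: "length (concat (units n)) = n * order G"
  by (simp add: units_def length_concat comp_def unit_list_def length_els sum_list_triv)

lemma good_mask_table:
  assumes "set gens \<subseteq> vecs n"
  shows "good_table n (table (concat (units n)) (mask_gens (units n) m gens))"
  unfolding good_table_def
  by (intro conjI table_props mask_gens_vecs assms) (simp_all add: length_concat_units)

lemma initial_entries_ok:
  "set gens \<subseteq> vecs n \<Longrightarrow> E \<in> set (initial_entries k n gens) \<Longrightarrow> entry_ok n 0 E"
  using good_mask_table by (auto simp: initial_entries_def entry_ok_def trivial_below_def)

lemma remote_point_vecs: "set gens \<subseteq> vecs n \<Longrightarrow> remote_point A n gens \<in> vecs n"
  unfolding remote_point_def by (rule greedy_state_props(1)[OF initial_entries_ok]) auto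

lemma ptime_remote_point:
  assumes n: "ptime D inp (\<lambda>x. encode_unary (n x))" and gens: "ptime D inp (\<lambda>x. code_tab (gens x))"
    and v: "\<And>x. x \<in> D \<Longrightarrow> set (gens x) \<subseteq> vecs (n x)"
  shows "ptime D inp (\<lambda>x. code_vec (remote_point A (n x) (gens x)))"
  unfolding remote_point_def
proof (rule ptime_snd[where X = code_entries and Y = code_vec], rule ptime_greedy)
  have u: "ptime D inp (\<lambda>x. code_pair code_vec (code_list code_tab) (vone (n x), units (n x)))"
    by (rule ptime_units[OF n])
  show us: "ptime D inp (\<lambda>x. code_list code_tab (units (n x)))" using ptime_snd[OF u] by simp
  show one: "ptime D inp (\<lambda>x. code_vec (vone (n x)))" using ptime_fst[OF u] by simp
  show pn: "pbounded D inp n" using ptime_size[OF n] by (simp add: size_encode_unary)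
  show "entry_ok (n x) 0 E" if "x \<in> D" "E \<in> set (initial_entries (A * bit_count (n x)) (n x) (gens x))" for x E
    by (rule initial_entries_ok[OF v[OF that(1)] that(2)])
  \<comment> \<open>Since \<open>2 ^ bit_count n\<close> is at most \<open>2 * n + 1\<close>, the
    constant factor \<open>A\<close> in the exponent costs only a fixed power. This is where the
    number of classes has to be logarithmic.\<close>
  have bd: "pbounded D inp (\<lambda>x. 2 ^ (A * bit_count (n x)))"
  proof (rule pbounded_mono)
    show "pbounded D inp (\<lambda>x. (2 * n x + 1) ^ A)" by (intro pbounded_power pbounded_add pbounded_mult pbounded_const pn)
    show "2 ^ (A * bit_count (n x)) \<le> (2 * n x + 1) ^ A" for x
      using power_mono[OF bit_count_bounds(2), of "n x" A] by (simp add: power_mult[symmetric] mult.commute)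
  qed
  have masks: "ptime D inp (\<lambda>x. code_list (code_list code_bool) (masks (A * bit_count (n x))))"
    by (rule ptime_masks[OF ptime_unary_mult_const[OF ptime_bit_count[OF n]] bd])
  show "ptime D inp (\<lambda>x. code_entries (initial_entries (A * bit_count (n x)) (n x) (gens x)))"
    unfolding initial_entries_def
  proof (rule ptime_map[where h = "\<lambda>x m. (table (concat (units (n x))) (mask_gens (units (n x)) m (gens x)), vone (n x))",
      OF masks])
    let ?S = "{p. fst p \<in> D \<and> snd p \<in> set (masks (A * bit_count (n (fst p))))}"
    let ?i = "\<lambda>p. Pair (inp (fst p)) (code_list code_bool (snd p))"
    have us': "ptime ?S ?i (\<lambda>p. code_list code_tab (units (n (fst p))))" by (rule ptime_env[OF us]) simp
    have "ptime ?S ?i (\<lambda>p. code_tab (mask_gens (units (n (fst p))) (snd p) (gens (fst p))))"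
      by (rule ptime_mask_gens[OF us'], rule ptime_map_elem, rule ptime_env[OF gens], simp)
    then have "ptime ?S ?i (\<lambda>p. code_tab (table (concat (units (n (fst p)))) (mask_gens (units (n (fst p))) (snd p) (gens (fst p)))))"
      by (rule ptime_table[OF ptime_concat[OF us'], where d = "\<lambda>p. n (fst p)"])
        (use mask_gens_vecs v in \<open>auto intro: pbounded_env[OF pn]\<close>)
    then show "ptime ?S ?i (\<lambda>p. code_entry (table (concat (units (n (fst p)))) (mask_gens (units (n (fst p))) (snd p) (gens (fst p))), vone (n (fst p))))"
      by (rule ptime_code_pair) (rule ptime_env[OF one], simp)
  qed
qed

end

section \<open>Correctness: errors, residue classes and counting of levels\<close>

context coded_group begin

text \<open>\<open>y\<close> is the product of the units at its nontrivial coordinates; the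
  induction multiplies them up from left to right, with a prefix of \<open>y\<close> as partial
  product.\<close>

lemma unit_products:
  assumes M: "vsubgroup n M" and y: "y \<in> vecs n"
    and u: "\<And>i. i < n \<Longrightarrow> y ! i \<noteq> \<one> \<Longrightarrow> unit n i (y ! i) \<in> M"
  shows "y \<in> M"
proof -
  have "m \<le> n \<Longrightarrow> take m y @ vone (n - m) \<in> M" for m
  proof (induction m)
    case 0
    then show ?case using vsubgroupD(2)[OF M] by simp
  next
    case (Suc m)
    let ?p = "\<lambda>m. take m y @ vone (n - m)"
    have mn: "m < n" using Suc by simp
    have len: "length y = n" by (rule vecs_length[OF y])
    have pv: "?p k \<in> vecs n" if "k \<le> n" for k
      using that y by (auto simp: vecs_def vone_def dest: in_set_takeD)
    have nth: "?p k ! j = (if j < k then y ! j else \<one>)" if "k \<le> n" "j < n" for k j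
      using that len by (auto simp: nth_append vone_def min_def)
    have uv: "unit n m (y ! m) \<in> vecs n" by (rule unit_vecs[OF vecs_nth[OF y mn]])
    have eq: "?p (Suc m) = vmul (?p m) (unit n m (y ! m))"
    proof (rule vecs_eqI[OF pv vmul_vecs[OF pv uv]])
      show "?p (Suc m) ! j = vmul (?p m) (unit n m (y ! m)) ! j" if "j < n" for j
        using that mn vecs_nth[OF y that] nth[of m j] nth[of "Suc m" j] vmul_nth[OF pv uv that, of m]
        by (simp add: unit_nth)
    qed (use mn in auto)
    show ?case
    proof (cases "y ! m = \<one>")
      case True
      have "?p (Suc m) = ?p m"
        by (rule vecs_eqI[OF pv pv]) (use mn True nth[of m] nth[of "Suc m"] in \<open>auto simp: less_Suc_eq\<close>)
      then show ?thesis using Suc by simp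
    next
      case False
      then show ?thesis unfolding eq using Suc mn u by (intro vsubgroupD(3)[OF M]) auto
    qed
  qed
  from this[of n] show ?thesis using vecs_length[OF y] by (simp add: vone_def)
qed

text \<open>Members of one class are told apart by their quotient by \<open>k\<close>, which is at
  most \<open>n div k\<close>.\<close>

lemma card_residue_class_le: "card {p. p < n \<and> p mod k = b} \<le> n div k + 1" for n k b :: nat
proof -
  have "inj_on (\<lambda>p. p div k) {p. p < n \<and> p mod k = b}"
    by (rule inj_onI) (metis (mono_tags, lifting) div_mult_mod_eq mem_Collect_eq)
  moreover have "(\<lambda>p. p div k) ` {p. p < n \<and> p mod k = b} \<subseteq> {..n div k}"
    by (auto intro: div_le_mono)
  ultimately show ?thesis using card_inj_on_le[of _ _ "{..n div k}"] by fastforce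
qed

text \<open>A point at distance at most r from H lies in the subgroup generated by H and the unit vectors
  in the residue classes mod k that are hit by the errors, which is one of the subgroups avoided by the greedy choice.\<close>

lemma remote_point_remote:
  assumes gens: "set gens \<subseteq> vecs n" and H: "vsubgroup n H" and gens_H: "set gens \<subseteq> H"
    and generated: "\<And>S. vsubgroup n S \<Longrightarrow> set gens \<subseteq> S \<Longrightarrow> H \<subseteq> S"
    and card_H: "card H ^ 2 \<le> order G ^ n"
    and h: "h \<in> H" and y: "y \<in> vecs n" "card {i. i < n \<and> y ! i \<noteq> \<one>} \<le> r"
    and k: "k = A * bit_count n" "0 < k" "2 * k + 2 * r * (n div k + 1) < n"
  shows "remote_point A n gens \<noteq> vmul h y"
proof
  assume x: "remote_point A n gens = vmul h y"
  \<comment> \<open>The classes hit by an error, at most \<open>r\<close> of them because there are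
    at most \<open>r\<close> errors.\<close>
  define C where "C = (\<lambda>i. i mod k) ` {i. i < n \<and> y ! i \<noteq> \<one>}"
  define bs where "bs = map (\<lambda>b. b \<in> C) [0..<k]"
  define U where "U = {p. p < n \<and> p mod k \<in> C}"
  define gs where "gs = mask_gens (units n) bs gens"
  define T where "T = table (concat (units n)) gs"
  have bs: "bs \<in> set (masks k)" "bs \<noteq> []" "length bs = k"
    using k(2) by (auto simp: bs_def set_masks)
  have gs: "set gs = set gens \<union> (\<Union>p\<in>U. unit n p ` carrier G)"
  proof -
    have "{p. p < length (units n) \<and> bs ! (p mod length bs)} = U"
      using k(2) by (auto simp: U_def bs(3)) (simp_all add: bs_def units_def)
    moreover have "set (units n ! p) = unit n p ` carrier G" if "p \<in> U" for p
      using that by (simp add: U_def units_def set_unit_list)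
    ultimately show ?thesis by (simp add: gs_def set_mask_gens[OF bs(2)])
  qed
  have gsv: "set gs \<subseteq> vecs n" unfolding gs_def by (rule mask_gens_vecs[OF gens])
  have T: "good_table n T" unfolding T_def gs_def by (rule good_mask_table[OF gens])
  let ?M = "{z. nform n (set T) 0 z}"
  note M = good_tableD(2)[OF T]
  have gsM: "g \<in> ?M" if "g \<in> set gs" for g
    using table_props(3)[OF gsv _ that, of "concat (units n)"] by (simp add: T_def length_concat_units)
  have "h \<in> ?M" using generated[OF M] gsM h by (auto simp: gs)
  moreover have "y \<in> ?M"
  proof (rule unit_products[OF M y(1)])
    fix i assume i: "i < n" "y ! i \<noteq> \<one>"
    then have "i \<in> U" by (auto simp: U_def C_def)
    then show "unit n i (y ! i) \<in> ?M" using gsM vecs_nth[OF y(1) i(1)] by (auto simp: gs)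
  qed
  ultimately have member: "nform n (set T) 0 (remote_point A n gens)"
    using vsubgroupD(3)[OF M] by (simp add: x)

  \<comment> \<open>The product of \<open>H\<close> with all vectors supported in \<open>U\<close>,
    described by agreement with \<open>H\<close> outside \<open>U\<close>; closure is then checked
    coordinatewise.\<close>
  define S where "S = {z \<in> vecs n. \<exists>g\<in>H. \<forall>j<n. j \<notin> U \<longrightarrow> z ! j = g ! j}"
  have Hv: "g \<in> H \<Longrightarrow> g \<in> vecs n" for g by (rule vsubgroupD(1)[OF H])
  have S_mul: "vmul u v \<in> S" and S_div: "vdiv u v \<in> S" if uv: "u \<in> S" "v \<in> S" for u v
  proof -
    obtain a b where ab: "a \<in> H" "b \<in> H" "\<forall>j<n. j \<notin> U \<longrightarrow> u ! j = a ! j"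
      "\<forall>j<n. j \<notin> U \<longrightarrow> v ! j = b ! j" "u \<in> vecs n" "v \<in> vecs n"
      using uv unfolding S_def by blast
    have "\<forall>j<n. j \<notin> U \<longrightarrow> vmul u v ! j = vmul a b ! j" "\<forall>j<n. j \<notin> U \<longrightarrow> vdiv u v ! j = vdiv a b ! j"
      using ab Hv by (simp_all add: vmul_nth[of _ n] vdiv_nth[of _ n])
    then show "vmul u v \<in> S" "vdiv u v \<in> S"
      using ab vsubgroupD(3)[OF H ab(1,2)] vsubgroup_vdiv[OF H ab(1,2)] by (auto simp: S_def)
  qed
  have S_one: "vone n \<in> S" using vsubgroupD(2)[OF H] by (auto simp: S_def intro!: bexI[of _ "vone n"])
  have gsS: "set gs \<subseteq> S"
  proof
    fix g assume g: "g \<in> set gs"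
    show "g \<in> S"
    proof (cases "g \<in> set gens")
      case True
      then show ?thesis using gens gens_H by (auto simp: S_def)
    next
      case False
      then obtain p a where "p \<in> U" "a \<in> carrier G" "g = unit n p a" using g by (auto simp: gs)
      then show ?thesis using vsubgroupD(2)[OF H]
        by (auto simp: S_def unit_vecs unit_nth intro!: bexI[of _ "vone n"])
    qed
  qed
  have TS: "set T \<subseteq> S"
    unfolding T_def by (rule table_closed) (use S_mul S_div gsS in \<open>auto simp: vdiv_closed_def\<close>)
  have MS: "\<exists>g\<in>H. \<forall>j<n. j \<notin> U \<longrightarrow> z ! j = g ! j" if "nform n (set T) 0 z" for z
    using nform_closed[OF TS S_one S_mul that] by (simp add: S_def)
  let ?F = "{j. j < n \<and> level T j = carrier G}"
  have finH: "finite H" by (rule finite_subset[OF _ finite_vecs[of n]]) (use Hv in blast)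
  have "(order G ^ card (?F - U)) ^ 2 \<le> card H ^ 2"
    by (rule power_mono[OF card_full_levels[OF T finH MS]]) simp_all
  also have "\<dots> \<le> order G ^ n" by (rule card_H)
  finally have "order G ^ (card (?F - U) * 2) \<le> order G ^ n" by (simp add: power_mult)
  \<comment> \<open>Comparing exponents: at most half of the coordinates are full levels outside
    \<open>U\<close>.\<close>
  then have FU: "2 * card (?F - U) \<le> n"
    using order_ge_2 by (subst (asm) power_increasing_iff) auto
  have "card U \<le> r * (n div k + 1)"
  proof -
    have finC: "finite C" by (simp add: C_def)
    have "U = (\<Union>b\<in>C. {p. p < n \<and> p mod k = b})" by (auto simp: U_def)
    then have "card U \<le> (\<Sum>b\<in>C. card {p. p < n \<and> p mod k = b})"
      using card_UN_le[OF finC] by simp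
    also have "\<dots> \<le> (\<Sum>b\<in>C. n div k + 1)" by (rule sum_mono) (rule card_residue_class_le)
    also have "\<dots> = card C * (n div k + 1)" by simp
    also have "card C \<le> r"
      using y(2) card_image_le[of "{i. i < n \<and> y ! i \<noteq> \<one>}" "\<lambda>i. i mod k"] by (simp add: C_def)
    then have "card C * (n div k + 1) \<le> r * (n div k + 1)" by (rule mult_right_mono) simp
    finally show ?thesis .
  qed
  moreover have "card ?F \<le> card (?F - U) + card U"
  proof -
    have "card ?F \<le> card ((?F - U) \<union> U)" by (rule card_mono) (auto simp: U_def)
    also have "\<dots> \<le> card (?F - U) + card U" by (rule card_Un_le)
    finally show ?thesis .
  qed
  moreover have "n = card ?F + card {j. j < n \<and> level T j \<noteq> carrier G}"
  proof -
    have "{..<n} = ?F \<union> {j. j < n \<and> level T j \<noteq> carrier G}" by auto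
    then have "card {..<n} = card ?F + card {j. j < n \<and> level T j \<noteq> carrier G}"
      by (simp only:) (rule card_Un_disjoint; auto)
    then show ?thesis by simp
  qed
  \<comment> \<open>At least \<open>n - n/2 - r * (n div k + 1)\<close> levels are proper, which
    exceeds \<open>k\<close> by the inequality required of \<open>k\<close>.\<close>
  ultimately have "k < card {j. j < n \<and> level T j \<noteq> carrier G}"
    using FU k(3) by (simp add: algebra_simps)
  then have "length (initial_entries k n gens) < 2 ^ card {j. j < n \<and> level T j \<noteq> carrier G}"
    by (simp add: initial_entries_def length_masks)
  moreover have "(T, vone n) \<in> set (initial_entries k n gens)"
    using bs(1) by (auto simp: initial_entries_def T_def gs_def)
  ultimately have "\<not> nform n (set T) 0 (remote_point A n gens)"
    unfolding remote_point_def k(1)[symmetric]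
    by (intro greedy_avoids initial_entries_ok[OF gens])
  then show False using member by contradiction
qed

section \<open>Transfer from the power group to lists\<close>

definition vec_of :: "nat \<Rightarrow> (nat \<Rightarrow> 'a) \<Rightarrow> 'a list" where
  "vec_of n x = map x [0..<n]"

lemma carrier_power_group: "carrier (power_group G n) = PiE {..<n} (\<lambda>_. carrier G)"
  by (simp add: power_group_def product_group_def)

lemma mult_power_group: "i < n \<Longrightarrow> (x \<otimes>\<^bsub>power_group G n\<^esub> y) i = x i \<otimes> y i"
  by (simp add: power_group_def product_group_def)

lemma one_power_group: "i < n \<Longrightarrow> \<one>\<^bsub>power_group G n\<^esub> i = \<one>"
  by (simp add: power_group_def product_group_def)

lemma group_power_group: "group (power_group G n)"
  unfolding power_group_def by (rule product_group) (rule group_axioms)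

lemma vec_of_nth [simp]: "i < n \<Longrightarrow> vec_of n x ! i = x i"
  by (simp add: vec_of_def)

lemma vec_of_vecs: "x \<in> carrier (power_group G n) \<Longrightarrow> vec_of n x \<in> vecs n"
  by (rule vecsI) (auto simp: carrier_power_group vec_of_def)

lemma vec_of_mult:
  assumes "x \<in> carrier (power_group G n)" "y \<in> carrier (power_group G n)"
  shows "vec_of n (x \<otimes>\<^bsub>power_group G n\<^esub> y) = vmul (vec_of n x) (vec_of n y)"
proof -
  interpret P: group "power_group G n" by (rule group_power_group)
  show ?thesis
    by (rule vecs_eqI[of _ n])
      (use assms in \<open>simp_all add: vec_of_vecs mult_power_group vmul_nth[of _ n]\<close>)
qed

lemma vec_of_one: "vec_of n \<one>\<^bsub>power_group G n\<^esub> = vone n"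
proof -
  interpret P: group "power_group G n" by (rule group_power_group)
  show ?thesis by (rule vecs_eqI[of _ n]) (simp_all add: vec_of_vecs one_power_group)
qed

lemma inj_vec_of: "inj_on (vec_of n) (carrier (power_group G n))"
proof (rule inj_onI)
  fix x y assume xy: "x \<in> carrier (power_group G n)" "y \<in> carrier (power_group G n)" "vec_of n x = vec_of n y"
  have "x i = y i" if "i < n" for i using vec_of_nth[OF that] xy(3) by metis
  then show "x = y" using xy(1,2) unfolding carrier_power_group by (intro PiE_ext) auto
qed

lemma encode_vector_vec_of: "encode_vector e n x = code_vec (vec_of n x)"
  by (simp add: encode_vector_def code_list_def vec_of_def code_el_def comp_def)

lemma subgroup_vec_of:
  assumes "subgroup H (power_group G n)"
  shows "vsubgroup n (vec_of n ` H)"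
proof -
  interpret H: subgroup H "power_group G n" by (rule assms)
  have "vmul u v \<in> vec_of n ` H" if uv: "u \<in> vec_of n ` H" "v \<in> vec_of n ` H" for u v
  proof -
    obtain x y where xy: "x \<in> H" "y \<in> H" "u = vec_of n x" "v = vec_of n y" using uv by blast
    have "vec_of n (x \<otimes>\<^bsub>power_group G n\<^esub> y) = vmul u v"
      unfolding xy(3,4) by (rule vec_of_mult) (use xy in auto)
    then show ?thesis using imageI[OF H.m_closed[OF xy(1,2)], of "vec_of n"] by simp
  qed
  moreover have "vec_of n ` H \<subseteq> vecs n" using vec_of_vecs by auto
  moreover have "vone n \<in> vec_of n ` H" using imageI[OF H.one_closed, of "vec_of n"] by (simp add: vec_of_one)
  ultimately show ?thesis unfolding vsubgroup_def by blast
qed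

text \<open>Induction over generation. The inverse of a generator is expressed as its left quotient
  with the trivial vector, which \<open>vsubgroup_vdiv\<close> keeps in \<open>S\<close>.\<close>

lemma generate_vec_of:
  assumes S: "vsubgroup n S" and gens: "set gens \<subseteq> carrier (power_group G n)" "vec_of n ` set gens \<subseteq> S"
    and x: "x \<in> generate (power_group G n) (set gens)"
  shows "vec_of n x \<in> S"
proof -
  interpret P: group "power_group G n" by (rule group_power_group)
  show ?thesis
    using x
  proof (induction rule: generate.induct)
    case one
    then show ?case using vsubgroupD(2)[OF S] by (simp add: vec_of_one)
  next
    case (incl g)
    then show ?case using gens by auto
  next
    case (inv g)
    have g: "g \<in> carrier (power_group G n)" "vec_of n g \<in> S" using inv gens by auto
    have v: "vec_of n (inv\<^bsub>power_group G n\<^esub> g) \<in> vecs n" using g by (simp add: vec_of_vecs)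
    have "vmul (vec_of n g) (vec_of n (inv\<^bsub>power_group G n\<^esub> g)) = vone n"
      using g by (simp add: vec_of_mult[symmetric] vec_of_one)
    then have "vec_of n (inv\<^bsub>power_group G n\<^esub> g) = vdiv (vec_of n g) (vone n)"
      using vdiv_vmul[OF vec_of_vecs[OF g(1)] v] by simp
    then show ?case using vsubgroup_vdiv[OF S g(2) vsubgroupD(2)[OF S]] by simp
  next
    case (eng a b)
    then show ?case
      using vsubgroupD(3)[OF S] P.generate_in_carrier[OF gens(1)] by (simp add: vec_of_mult)
  qed
qed

lemma ptime_instances:
  "ptime {(n, gens, r). set gens \<subseteq> carrier (power_group G n)} (\<lambda>(n, gens, r). encode_instance e n gens r)
     (\<lambda>(n, gens, r). code_vec (remote_point A n (map (vec_of n) gens)))"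
  (is "ptime ?D ?i _")
proof -
  have "ptime ?D ?i (\<lambda>x. code_vec (remote_point A (fst x) (map (vec_of (fst x)) (fst (snd x)))))"
  proof (rule ptime_remote_point)
    show "ptime ?D ?i (\<lambda>x. encode_unary (fst x))"
      by (rule ptime_sel[of _ _ "[False]"]) (auto simp: encode_instance_def)
    show "ptime ?D ?i (\<lambda>x. code_tab (map (vec_of (fst x)) (fst (snd x))))"
      by (rule ptime_sel[of _ _ "[True, True]"])
        (auto simp: encode_instance_def code_list_def[of code_vec] comp_def encode_vector_vec_of[abs_def])
    show "set (map (vec_of (fst x)) (fst (snd x))) \<subseteq> vecs (fst x)" if "x \<in> ?D" for x
      using that vec_of_vecs[of _ "fst x"] by (cases x) fastforce
  qed
  then show ?thesis by (rule ptime_cong) auto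
qed

lemma remote_point_correct:
  assumes H: "subgroup H (power_group G n)" and gens: "set gens \<subseteq> carrier (power_group G n)"
    and gen: "generate (power_group G n) (set gens) = H" and dim: "group_dim G H \<le> real n / 2"
    and k: "k = A * bit_count n" "0 < k" "2 * k + 2 * r * (n div k + 1) < n"
    and x: "x \<in> carrier (power_group G n)" "vec_of n x = remote_point A n (map (vec_of n) gens)"
  shows "x \<notin> ball_around G n H r"
proof
  assume "x \<in> ball_around G n H r"
  then obtain h y where hy: "h \<in> H" "y \<in> hamming_ball G n r" "x = h \<otimes>\<^bsub>power_group G n\<^esub> y"
    by (auto simp: ball_around_def set_mult_def)
  interpret H: subgroup H "power_group G n" by (rule H)
  have finH: "finite H"
    using finite_subset[OF H.subset] finite_carrier by (simp add: carrier_power_group finite_PiE)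
  have yc: "y \<in> carrier (power_group G n)" "card {i \<in> {..<n}. y i \<noteq> \<one>} \<le> r"
    using hy(2) by (auto simp: hamming_ball_def weight_def)
  have hc: "h \<in> carrier (power_group G n)" using hy(1) by auto
  have card: "card (vec_of n ` H) = card H"
    by (rule card_image[OF inj_on_subset[OF inj_vec_of H.subset]])
  \<comment> \<open>The logarithmic bound is squared so that the counting stays within natural
    numbers, for odd \<open>n\<close> as well.\<close>
  have "card (vec_of n ` H) ^ 2 \<le> order G ^ n"
  proof -
    have pos: "0 < card H" using finH hy(1) by (auto simp: card_gt_0_iff)
    have q: "1 < real (order G)" using order_ge_2 by simp
    have "log (order G) (card H) \<le> n / 2" using dim by (simp only: group_dim_def)
    moreover have "0 < real (card H)" using pos by simp
    ultimately have "real (card H) \<le> real (order G) powr (n / 2)" using log_le_iff[OF q] by blast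
    then have "real (card H) ^ 2 \<le> (real (order G) powr (n / 2)) ^ 2" by (rule power_mono) simp
    also have "\<dots> = real (order G) ^ n"
      using q by (simp add: powr_realpow[symmetric] powr_powr flip: powr_numeral)
    finally show ?thesis unfolding card by (metis of_nat_le_iff of_nat_power)
  qed
  moreover have "vec_of n ` H \<subseteq> S" if "vsubgroup n S" "set (map (vec_of n) gens) \<subseteq> S" for S
    using generate_vec_of[OF that(1) gens] that(2) gen by auto
  moreover have "card {i. i < n \<and> vec_of n y ! i \<noteq> \<one>} \<le> r"
  proof -
    have "{i. i < n \<and> vec_of n y ! i \<noteq> \<one>} = {i \<in> {..<n}. y i \<noteq> \<one>}" by auto
    then show ?thesis using yc(2) by simp
  qed
  moreover have "set gens \<subseteq> H" using gen generate.incl[of _ "set gens" "power_group G n"] by blast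
  ultimately have "remote_point A n (map (vec_of n) gens) \<noteq> vmul (vec_of n h) (vec_of n y)"
    using k gens hy(1) yc(1)
    by (intro remote_point_remote[OF _ subgroup_vec_of[OF H]]) (auto intro: vec_of_vecs)
  then show False using x(2) hy(3) vec_of_mult[OF hc yc(1)] by simp
qed

end

text \<open>The number of classes is \<open>A * bit_count n\<close> with
  \<open>A \<ge> 8 * c\<close>, and \<open>bit_count n \<ge> ln n\<close>. So it is at least eight
  times the radius, and \<open>2 * r * (n div k)\<close> is at most \<open>n/4\<close>. For large
  \<open>n\<close> the logarithmic terms \<open>2 * k\<close> and \<open>2 * r\<close> are below
  \<open>n/4\<close> each, which leaves the sum below \<open>3 * n / 4\<close>.\<close>

lemma eventually_parameters:
  fixes c :: real
  assumes "c > 0"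
  shows "\<forall>\<^sub>F n in sequentially. \<forall>r. real r \<le> c * ln (real n) \<longrightarrow>
    0 < (nat \<lceil>8 * c\<rceil> + 1) * bit_count n \<and>
    2 * ((nat \<lceil>8 * c\<rceil> + 1) * bit_count n) + 2 * r * (n div ((nat \<lceil>8 * c\<rceil> + 1) * bit_count n) + 1) < n"
proof -
  define A where "A = nat \<lceil>8 * c\<rceil> + 1"
  have A: "8 * c \<le> real A" "0 < A" unfolding A_def by linarith+
  have "\<forall>\<^sub>F n in sequentially. 2 * real A * (ln (2 * real n + 1) / ln 2) < real n / 4"
    by real_asymp
  moreover have "\<forall>\<^sub>F n in sequentially. 2 * (c * ln (real n)) < real n / 4"
    using assms by real_asymp
  ultimately have "\<forall>\<^sub>F n in sequentially. \<forall>r. real r \<le> c * ln (real n) \<longrightarrow>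
    0 < A * bit_count n \<and> 2 * (A * bit_count n) + 2 * r * (n div (A * bit_count n) + 1) < n"
    using eventually_gt_at_top[of 1]
  proof eventually_elim
    case (elim n)
    let ?k = "A * bit_count n"
    show ?case
    proof (intro allI impI)
      fix r assume r: "real r \<le> c * ln (real n)"
      \<comment> \<open>\<open>ln 2 \<le> 1\<close> allows the natural logarithm of \<open>n\<close>
        to be bounded by its binary length.\<close>
      have ln2: "0 < ln (2::real)" "ln (2::real) \<le> 1" using ln_le_minus_one[of "2::real"] by auto
      have "ln (real n) \<le> ln (real (2 ^ bit_count n))" using elim(3) bit_count_bounds(1)[of n] by simp
      also have "\<dots> = real (bit_count n) * ln 2" by (simp add: ln_realpow)
      also have "\<dots> \<le> real (bit_count n)" using ln2 by (simp add: mult_left_le)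
      finally have low: "ln (real n) \<le> real (bit_count n)" .
      have pos: "0 < ln (real n)" using elim(3) by simp
      then have b: "0 < bit_count n" using low by linarith
      have "real (bit_count n) * ln 2 = ln (real (2 ^ bit_count n))" by (simp add: ln_realpow)
      also have "\<dots> \<le> ln (2 * real n + 1)"
        using of_nat_mono[OF bit_count_bounds(2)[of n], where 'a = real] by (subst ln_le_cancel_iff) auto
      finally have "real (bit_count n) \<le> ln (2 * real n + 1) / ln 2" using ln2 by (simp add: field_simps)
      then have "2 * real A * real (bit_count n) \<le> 2 * real A * (ln (2 * real n + 1) / ln 2)"
        by (intro mult_left_mono) auto
      then have one: "2 * real ?k < real n / 4" using elim(1) by simp
      have kpos: "0 < real ?k" using A b by simp
      have "real (n div ?k) \<le> real n / real ?k" by (rule of_nat_div_le_of_nat)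
      then have "real r * real (n div ?k) \<le> (c * ln (real n)) * (real n / real ?k)"
        using r assms pos by (intro mult_mono) auto
      also have "\<dots> \<le> real n / 8"
      proof -
        have "8 * c * ln (real n) \<le> real A * real (bit_count n)"
          using A low pos assms by (intro mult_mono) auto
        then have "8 * (c * ln (real n)) * real n \<le> real ?k * real n"
          by (intro mult_right_mono) auto
        then show ?thesis using kpos by (simp add: field_simps)
      qed
      finally have two: "real r * real (n div ?k) \<le> real n / 8" .
      have "real (2 * ?k + 2 * r * (n div ?k + 1)) = 2 * real ?k + 2 * (real r * real (n div ?k)) + 2 * real r"
        by (simp add: algebra_simps)
      also have "\<dots> < real n" using one two r elim(2,3) by linarith
      finally show "0 < ?k \<and> 2 * ?k + 2 * r * (n div ?k + 1) < n"
        using A b by (simp only: of_nat_less_iff) simp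
    qed
  qed
  then show ?thesis by (simp add: A_def)
qed

theorem theorem5p1:
  fixes G :: "('a, 'b) monoid_scheme" and e :: "'a \<Rightarrow> nat" and c :: real
  assumes "group G" and "finite (carrier G)" and "order G \<ge> 2"
    and "bij_betw e (carrier G) {..<order G}"
    and "c > 0"
  shows "\<exists>P. polynomial_time_on P (RPP_instances G e) \<and>
             RPP_algorithm G e (\<lambda>n. real n / 2) (\<lambda>n. c * ln (real n)) P"
proof -
  interpret coded_group G e
    by (intro coded_group.intro coded_group_axioms.intro assms)
  define A where "A = nat \<lceil>8 * c\<rceil> + 1"
  let ?D = "{(n, gens, r). set gens \<subseteq> carrier (power_group G n)}"
  let ?i = "\<lambda>(n, gens, r). encode_instance e n gens r"
  let ?F = "\<lambda>(n, gens, r). code_vec (remote_point A n (map (vec_of n) gens))"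
  obtain P m T where "pbounded ?D ?i (\<lambda>x. size (?F x))" and T: "pbounded ?D ?i T"
    and R: "\<And>x. x \<in> ?D \<Longrightarrow> runs P m (?i x) (T x) (?F x)"
    by (rule ptimeE[OF ptime_instances[of A]], rule that; assumption)
  have runs: "runs P m (encode_instance e n gens r) (T (n, gens, r))
      (code_vec (remote_point A n (map (vec_of n) gens)))"
    if "set gens \<subseteq> carrier (power_group G n)" for n gens r
    using R[of "(n, gens, r)"] that by simp
  have comp: "\<exists>t\<le>T (n, gens, r). computes_in_time P (encode_instance e n gens r) t
      (code_vec (remote_point A n (map (vec_of n) gens)))"
    if gens: "set gens \<subseteq> carrier (power_group G n)" for n gens r
  proof -
    let ?d = "encode_instance e n gens r"
    \<comment> \<open>An input store is empty outside variable 0, so the scratch condition of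
      \<open>runs\<close> holds for every \<open>m\<close>.\<close>
    obtain t where t: "t \<le> T (n, gens, r)"
      "exec P (input_store ?d) t ((input_store ?d)(0 := code_vec (remote_point A n (map (vec_of n) gens))))"
      by (rule runsE[OF runs[OF gens, of r], of "input_store ?d"]) (auto simp: input_store_def)
    then show ?thesis unfolding computes_in_time_def by (metis fun_upd_same)
  qed
  obtain k where k: "\<And>n gens r. set gens \<subseteq> carrier (power_group G n) \<Longrightarrow>
      T (n, gens, r) \<le> (size (encode_instance e n gens r) + 2) ^ k"
    using T unfolding pbounded_def by fastforce
  have "polynomial_time_on P (RPP_instances G e)"
    unfolding polynomial_time_on_def
  \<comment> \<open>\<open>[:2, 1:]\<close> is the polynomial X + 2, the base used in
    \<open>pbounded\<close>.\<close>
  proof (intro exI[of _ "[:2, 1:] ^ k"] ballI)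
    fix d assume "d \<in> RPP_instances G e"
    then obtain n gens r where d: "d = encode_instance e n gens r" "set gens \<subseteq> carrier (power_group G n)"
      by (auto simp: RPP_instances_def)
    have "poly ([:2, 1:] ^ k) (size d) = (size d + 2) ^ k" by (simp add: poly_power add.commute)
    then show "\<exists>t d'. computes_in_time P d t d' \<and> t \<le> poly ([:2, 1:] ^ k) (size d)"
      using comp[OF d(2), of r] k[OF d(2), of r] unfolding d(1) by (metis order.trans)
  qed
  moreover have "RPP_algorithm G e (\<lambda>n. real n / 2) (\<lambda>n. c * ln (real n)) P"
    unfolding RPP_algorithm_def
    using eventually_parameters[OF assms(5), folded A_def]
  proof eventually_elim
    case (elim n)
    show ?case
    proof (intro allI impI, elim conjE)
      fix H gens r
      assume H: "subgroup H (power_group G n)" and gens: "set gens \<subseteq> carrier (power_group G n)"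
        and gen: "generate (power_group G n) (set gens) = H" and dim: "group_dim G H \<le> real n / 2"
        and r: "real r \<le> c * ln (real n)"
      define out where "out = remote_point A n (map (vec_of n) gens)"
      \<comment> \<open>Elements of the power group are undefined outside \<open>{..<n}\<close>,
        hence the restriction.\<close>
      define x where "x = restrict ((!) out) {..<n}"
      have out: "out \<in> vecs n"
        unfolding out_def by (rule remote_point_vecs) (use gens vec_of_vecs in auto)
      have x: "x \<in> carrier (power_group G n)" "vec_of n x = out"
        using vecs_nth[OF out] vecs_length[OF out]
        by (auto simp: x_def carrier_power_group vec_of_def intro: nth_equalityI)
      have "x \<notin> ball_around G n H r"
        by (rule remote_point_correct[OF H gens gen dim refl _ _ x(1)])
          (use elim r x(2) in \<open>auto simp: out_def\<close>)
      moreover obtain t where "computes_in_time P (encode_instance e n gens r) t (encode_vector e n x)"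
        using comp[OF gens, of r] x(2) by (auto simp: encode_vector_vec_of out_def)
      ultimately show "\<exists>x t. x \<in> carrier (power_group G n) \<and> x \<notin> ball_around G n H r \<and>
          computes_in_time P (encode_instance e n gens r) t (encode_vector e n x)"
        using x(1) by blast
    qed
  qed
  ultimately show ?thesis by blast
qed

end
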